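(* Let $\mathbb{F}$ be a field of characteristic $7$ and let $\mathcal{C}_s$ be the split Cayley algebra over $\mathbb{F}$. Every twisted form (over $\mathbb{F}$) of the Witt algebra $W_1$ embeds, as a Lie algebra, in $\mathrm{Der}(\mathcal{C}_s)$. Moreover, any two embeddings of the same twisted form of the Witt algebra in $\mathrm{Der}(\mathcal{C}_s)$ are conjugate: if $L$ is a twisted form of $W_1$ and $\iota_1,\iota_2:L\to\mathrm{Der}(\mathcal{C}_s)$ are injective Lie algebra homomorphisms, then there is an automorphism $\varphi$ of $\mathcal{C}_s$ such that $\iota_2(x)=\varphi\,\iota_1(x)\,\varphi^{-1}$ for all $x\in L$.
   Context: A Cayley algebra over a field $\mathbb{F}$ is a unital nonassociative $\mathbb{F}$-algebra $\mathcal{C}$ of dimension $8$ endowed with a quadratic form $q:\mathcal{C}\to\mathbb{F}$ (the norm) that is multiplicative ($q(xy)=q(x)q(y)$) and nonsingular, i.e. the polar form $b_q(x,y)=q(x+y)-q(x)-q(y)$ is nondegenerate. It is split if $q$ is isotropic ($q(x)=0$ for some $x\neq0$); up to isomorphism there is exactly one split Cayley algebra over $\mathbb{F}$, denoted $\mathcal{C}_s$. $\mathrm{Der}(\mathcal{C})=\{d\in\mathfrak{gl}(\mathcal{C}): d(xy)=d(x)y+xd(y)\ \forall x,y\in\mathcal{C}\}$. The Witt algebra over a field $\mathbb{F}$ of characteristic $7$ is the Lie algebra $W_1=\mathrm{Der}(\mathbb{F}[X]/(X^7))$. An $\mathbb{F}$-algebra $\mathcal{A}$ is a twisted form of an $\mathbb{F}$-algebra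 $\mathcal{B}$ if $\mathcal{A}\otimes_{\mathbb{F}}\mathbb{F}_{\mathrm{alg}}\cong\mathcal{B}\otimes_{\mathbb{F}}\mathbb{F}_{\mathrm{alg}}$ as $\mathbb{F}_{\mathrm{alg}}$-algebras, where $\mathbb{F}_{\mathrm{alg}}$ is an algebraic closure of $\mathbb{F}$. *)

theory Defs
  imports "HOL-Algebra.Algebraic_Closure_Type" "HOL-Library.Poly_Mapping"
begin

section \<open>Nonassociative algebras and their derivations\<close>

text \<open>Neither associativity, commutativity nor a unit is assumed; Lie algebras and Cayley
  algebras are both instances.\<close>

locale nonassoc_algebra = vector_space scale
  for scale :: "'f::field \<Rightarrow> 'a::ab_group_add \<Rightarrow> 'a" +
  fixes mul :: "'a \<Rightarrow> 'a \<Rightarrow> 'a"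
  assumes mult_add_left: "mul (x + y) z = mul x z + mul y z"
    and mult_add_right: "mul x (y + z) = mul x y + mul x z"
    and mult_scale_left: "mul (scale c x) y = scale c (mul x y)"
    and mult_scale_right: "mul x (scale c y) = scale c (mul x y)"

definition derivations ::
    "('f::field \<Rightarrow> 'a::ab_group_add \<Rightarrow> 'a) \<Rightarrow> ('a \<Rightarrow> 'a \<Rightarrow> 'a) \<Rightarrow> ('a \<Rightarrow> 'a) set" where
  "derivations scale mul =
     {d. Vector_Spaces.linear scale scale d \<and>
         (\<forall>x y. d (mul x y) = mul (d x) y + mul x (d y))}"

definition commutator :: "('a::ab_group_add \<Rightarrow> 'a) \<Rightarrow> ('a \<Rightarrow> 'a) \<Rightarrow> 'a \<Rightarrow> 'a" where
  "commutator d e = (\<lambda>x. d (e x) - e (d x))"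

definition algebra_automorphism ::
    "('f::field \<Rightarrow> 'a::ab_group_add \<Rightarrow> 'a) \<Rightarrow> ('a \<Rightarrow> 'a \<Rightarrow> 'a) \<Rightarrow> ('a \<Rightarrow> 'a) \<Rightarrow> bool" where
  "algebra_automorphism scale mul \<phi> \<longleftrightarrow>
     Vector_Spaces.linear scale scale \<phi> \<and> bij \<phi> \<and> (\<forall>x y. \<phi> (mul x y) = mul (\<phi> x) (\<phi> y))"

text \<open>Injective Lie algebra homomorphisms into the derivations of an algebra, the latter being a
  Lie algebra under pointwise addition, pointwise scaling and the commutator.\<close>

definition lie_embedding_in_Der ::
    "('f::field \<Rightarrow> 'l::ab_group_add \<Rightarrow> 'l) \<Rightarrow> ('l \<Rightarrow> 'l \<Rightarrow> 'l) \<Rightarrow>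
     ('f \<Rightarrow> 'a::ab_group_add \<Rightarrow> 'a) \<Rightarrow> ('a \<Rightarrow> 'a \<Rightarrow> 'a) \<Rightarrow> ('l \<Rightarrow> 'a \<Rightarrow> 'a) \<Rightarrow> bool" where
  "lie_embedding_in_Der scaleL bracketL scaleA multA \<iota> \<longleftrightarrow>
     (\<forall>x. \<iota> x \<in> derivations scaleA multA) \<and> inj \<iota> \<and>
     (\<forall>x y. \<iota> (x + y) = (\<lambda>a. \<iota> x a + \<iota> y a)) \<and>
     (\<forall>c x. \<iota> (scaleL c x) = (\<lambda>a. scaleA c (\<iota> x a))) \<and>
     (\<forall>x y. \<iota> (bracketL x y) = commutator (\<iota> x) (\<iota> y))"

section \<open>Cayley algebras\<close>

definition polar :: "('a::ab_group_add \<Rightarrow> 'f::ab_group_add) \<Rightarrow> 'a \<Rightarrow> 'a \<Rightarrow> 'f" where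
  "polar q x y = q (x + y) - q x - q y"

definition quadratic_form ::
    "('f::field \<Rightarrow> 'a::ab_group_add \<Rightarrow> 'a) \<Rightarrow> ('a \<Rightarrow> 'f) \<Rightarrow> bool" where
  "quadratic_form scale q \<longleftrightarrow>
     (\<forall>c x. q (scale c x) = c\<^sup>2 * q x) \<and>
     (\<forall>y. Vector_Spaces.linear scale (*) (\<lambda>x. polar q x y)) \<and>
     (\<forall>x. Vector_Spaces.linear scale (*) (\<lambda>y. polar q x y))"

locale cayley_algebra = nonassoc_algebra scale mul
  for scale :: "'f::field \<Rightarrow> 'a::ab_group_add \<Rightarrow> 'a" and mul :: "'a \<Rightarrow> 'a \<Rightarrow> 'a" +
  fixes norm :: "'a \<Rightarrow> 'f"
  assumes unital: "\<exists>e. \<forall>x. mul e x = x \<and> mul x e = x"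
    and dim_8: "dim UNIV = 8"
    and norm_quadratic: "quadratic_form scale norm"
    and norm_mult: "norm (mul x y) = norm x * norm y"
    and norm_nondegenerate: "(\<forall>y. polar norm x y = 0) \<Longrightarrow> x = 0"

locale split_cayley_algebra = cayley_algebra +
  assumes norm_isotropic: "\<exists>x. x \<noteq> 0 \<and> norm x = 0"

section \<open>Extension of scalars\<close>

text \<open>
  For a vector space \<open>A\<close> over \<open>F\<close> and a field homomorphism \<open>j : F \<rightarrow> K\<close>, the tensor product of
  \<open>A\<close> and \<open>K\<close> over \<open>F\<close> is the free abelian group on \<open>A \<times> K\<close> modulo the subgroup \<open>tensor_null\<close>.
  Its elements are represented by the cosets of that subgroup.
\<close>

inductive_set tensor_null ::
    "('f \<Rightarrow> 'k) \<Rightarrow> ('f::field \<Rightarrow> 'a::ab_group_add \<Rightarrow> 'a) \<Rightarrow> ('a \<times> 'k::field \<Rightarrow>\<^sub>0 int) set"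
  for j :: "'f \<Rightarrow> 'k" and scale :: "'f \<Rightarrow> 'a \<Rightarrow> 'a" where
  zero: "0 \<in> tensor_null j scale"
| diff: "u \<in> tensor_null j scale \<Longrightarrow> v \<in> tensor_null j scale \<Longrightarrow> u - v \<in> tensor_null j scale"
| add_left: "frag_of (x + y, b) - frag_of (x, b) - frag_of (y, b) \<in> tensor_null j scale"
| add_right: "frag_of (x, b + c) - frag_of (x, b) - frag_of (x, c) \<in> tensor_null j scale"
| balanced: "frag_of (scale r x, b) - frag_of (x, j r * b) \<in> tensor_null j scale"

definition tensor_class ::
    "('f \<Rightarrow> 'k) \<Rightarrow> ('f::field \<Rightarrow> 'a::ab_group_add \<Rightarrow> 'a) \<Rightarrow>
     ('a \<times> 'k::field \<Rightarrow>\<^sub>0 int) \<Rightarrow> ('a \<times> 'k \<Rightarrow>\<^sub>0 int) set" where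
  "tensor_class j scale u = {v. v - u \<in> tensor_null j scale}"

definition tensor_carrier ::
    "('f \<Rightarrow> 'k) \<Rightarrow> ('f::field \<Rightarrow> 'a::ab_group_add \<Rightarrow> 'a) \<Rightarrow> ('a \<times> 'k::field \<Rightarrow>\<^sub>0 int) set set" where
  "tensor_carrier j scale = range (tensor_class j scale)"

definition formal_smult :: "'k::field \<Rightarrow> ('a \<times> 'k \<Rightarrow>\<^sub>0 int) \<Rightarrow> ('a \<times> 'k \<Rightarrow>\<^sub>0 int)" where
  "formal_smult c = frag_extend (\<lambda>(x, b). frag_of (x, c * b))"

definition formal_mult ::
    "('a \<Rightarrow> 'a \<Rightarrow> 'a) \<Rightarrow> ('a \<times> 'k::field \<Rightarrow>\<^sub>0 int) \<Rightarrow> ('a \<times> 'k \<Rightarrow>\<^sub>0 int) \<Rightarrow> ('a \<times> 'k \<Rightarrow>\<^sub>0 int)" where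
  "formal_mult mul u v =
     frag_extend (\<lambda>(x, b). frag_extend (\<lambda>(y, c). frag_of (mul x y, b * c)) v) u"

definition tensor_add ::
    "('f \<Rightarrow> 'k) \<Rightarrow> ('f::field \<Rightarrow> 'a::ab_group_add \<Rightarrow> 'a) \<Rightarrow>
     ('a \<times> 'k::field \<Rightarrow>\<^sub>0 int) set \<Rightarrow> ('a \<times> 'k \<Rightarrow>\<^sub>0 int) set \<Rightarrow> ('a \<times> 'k \<Rightarrow>\<^sub>0 int) set" where
  "tensor_add j scale U V = (\<Union>u\<in>U. \<Union>v\<in>V. tensor_class j scale (u + v))"

definition tensor_smult ::
    "('f \<Rightarrow> 'k) \<Rightarrow> ('f::field \<Rightarrow> 'a::ab_group_add \<Rightarrow> 'a) \<Rightarrow>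
     'k::field \<Rightarrow> ('a \<times> 'k \<Rightarrow>\<^sub>0 int) set \<Rightarrow> ('a \<times> 'k \<Rightarrow>\<^sub>0 int) set" where
  "tensor_smult j scale c U = (\<Union>u\<in>U. tensor_class j scale (formal_smult c u))"

definition tensor_mult ::
    "('f \<Rightarrow> 'k) \<Rightarrow> ('f::field \<Rightarrow> 'a::ab_group_add \<Rightarrow> 'a) \<Rightarrow> ('a \<Rightarrow> 'a \<Rightarrow> 'a) \<Rightarrow>
     ('a \<times> 'k::field \<Rightarrow>\<^sub>0 int) set \<Rightarrow> ('a \<times> 'k \<Rightarrow>\<^sub>0 int) set \<Rightarrow> ('a \<times> 'k \<Rightarrow>\<^sub>0 int) set" where
  "tensor_mult j scale mul U V = (\<Union>u\<in>U. \<Union>v\<in>V. tensor_class j scale (formal_mult mul u v))"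

lemma tensor_null_uminus: "u \<in> tensor_null j scale \<Longrightarrow> - u \<in> tensor_null j scale"
  using tensor_null.diff[OF tensor_null.zero] by fastforce

lemma tensor_null_add:
  "u \<in> tensor_null j scale \<Longrightarrow> v \<in> tensor_null j scale \<Longrightarrow> u + v \<in> tensor_null j scale"
  using tensor_null.diff[OF _ tensor_null_uminus] by fastforce

lemma tensor_class_self: "u \<in> tensor_class j scale u"
  by (simp add: tensor_class_def tensor_null.zero)

lemma tensor_class_eq_iff:
  "tensor_class j scale u = tensor_class j scale v \<longleftrightarrow> u - v \<in> tensor_null j scale"
proof
  assume "tensor_class j scale u = tensor_class j scale v"
  then have "u \<in> tensor_class j scale v"
    using tensor_class_self by blast
  then show "u - v \<in> tensor_null j scale"
    by (simp add: tensor_class_def)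
next
  assume uv: "u - v \<in> tensor_null j scale"
  have "w - u \<in> tensor_null j scale \<longleftrightarrow> w - v \<in> tensor_null j scale" for w
    using tensor_null_add[OF _ uv, of "w - u"] tensor_null.diff[OF _ uv, of "w - v"] by auto
  then show "tensor_class j scale u = tensor_class j scale v"
    by (auto simp: tensor_class_def)
qed

lemma tensor_class_UN2:
  assumes "\<And>u' v'. u' - u \<in> tensor_null j scale \<Longrightarrow> v' - v \<in> tensor_null j scale \<Longrightarrow> f u' v' = C"
  shows "(\<Union>u'\<in>tensor_class j scale u. \<Union>v'\<in>tensor_class j scale v. f u' v') = C"
proof -
  have inner: "(\<Union>v'\<in>tensor_class j scale v. f u' v') = C" if u': "u' \<in> tensor_class j scale u" for u'
  proof (rule UN_constant_eq[OF tensor_class_self], rule ballI)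
    fix v' assume "v' \<in> tensor_class j scale v"
    with u' show "f u' v' = C"
      using assms by (simp add: tensor_class_def)
  qed
  show ?thesis
    by (rule UN_constant_eq[OF tensor_class_self], rule ballI, rule inner)
qed

lemma tensor_add_class:
  "tensor_add j scale (tensor_class j scale u) (tensor_class j scale v) = tensor_class j scale (u + v)"
proof -
  have const: "tensor_class j scale (u' + v') = tensor_class j scale (u + v)"
    if "u' - u \<in> tensor_null j scale" "v' - v \<in> tensor_null j scale" for u' v'
    using tensor_null_add[OF that] by (simp add: tensor_class_eq_iff algebra_simps)
  show ?thesis
    unfolding tensor_add_def by (rule tensor_class_UN2) (rule const)
qed

lemma formal_smult_null:
  assumes "u \<in> tensor_null j scale"
  shows "formal_smult c u \<in> tensor_null j scale"
  using assms
proof induction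
  case (balanced r x b)
  have "c * (j r * b) = j r * (c * b)" by (simp add: ac_simps)
  then show ?case
    using tensor_null.balanced[of scale r x "c * b" j]
    by (simp only: formal_smult_def frag_extend_diff frag_extend_of prod.case)
qed (auto simp: formal_smult_def frag_extend_diff distrib_left intro: tensor_null.intros)

lemma tensor_smult_class:
  "tensor_smult j scale c (tensor_class j scale u) = tensor_class j scale (formal_smult c u)"
proof -
  have "tensor_class j scale (formal_smult c u') = tensor_class j scale (formal_smult c u)"
    if "u' - u \<in> tensor_null j scale" for u'
    using formal_smult_null[OF that] by (simp add: tensor_class_eq_iff formal_smult_def frag_extend_diff)
  then show ?thesis
    unfolding tensor_smult_def
    by (intro UN_constant_eq[OF tensor_class_self]) (simp add: tensor_class_def[of _ _ u])
qed

lemma formal_mult_0_left: "formal_mult mul 0 v = 0"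
  by (simp add: formal_mult_def)

lemma formal_mult_0_right: "formal_mult mul u 0 = 0"
  by (simp add: formal_mult_def frag_extend_eq_0)

lemma formal_mult_diff_left: "formal_mult mul (u - u') v = formal_mult mul u v - formal_mult mul u' v"
  by (simp add: formal_mult_def frag_extend_diff)

lemma formal_mult_diff_right: "formal_mult mul u (v - v') = formal_mult mul u v - formal_mult mul u v'"
  by (induction u rule: frag_induction[OF subset_UNIV])
     (auto simp: formal_mult_def frag_extend_diff)

lemma formal_mult_of: "formal_mult mul (frag_of (x, b)) (frag_of (y, c)) = frag_of (mul x y, b * c)"
  by (simp add: formal_mult_def)

context nonassoc_algebra
begin

lemma formal_mult_null_left:
  assumes "u \<in> tensor_null j scale"
  shows "formal_mult mul u v \<in> tensor_null j scale"
proof (induction v rule: frag_induction[OF subset_UNIV])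
  case 1
  show ?case by (simp add: formal_mult_0_right tensor_null.zero)
next
  case (2 p)
  obtain y c where p: "p = (y, c)" by (cases p)
  show ?case
    using assms
  proof induction
    case (balanced r x b)
    then show ?case
      using tensor_null.balanced[of scale r "mul x y" "b * c" j]
      by (simp add: p formal_mult_diff_left formal_mult_of mult_scale_left mult.assoc)
  qed (auto simp: p formal_mult_0_left formal_mult_diff_left formal_mult_of mult_add_left
         distrib_right intro: tensor_null.intros)
next
  case (3 v v')
  then show ?case by (simp add: formal_mult_diff_right tensor_null.diff)
qed

lemma formal_mult_null_right:
  assumes "v \<in> tensor_null j scale"
  shows "formal_mult mul u v \<in> tensor_null j scale"
proof (induction u rule: frag_induction[OF subset_UNIV])
  case 1
  show ?case by (simp add: formal_mult_0_left tensor_null.zero)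
next
  case (2 p)
  obtain y c where p: "p = (y, c)" by (cases p)
  show ?case
    using assms
  proof induction
    case (balanced r x b)
    have "c * (j r * b) = j r * (c * b)" by (simp add: ac_simps)
    then show ?case
      using tensor_null.balanced[of scale r "mul y x" "c * b" j]
      by (simp only: p formal_mult_diff_right formal_mult_of mult_scale_right)
  qed (auto simp: p formal_mult_0_right formal_mult_diff_right formal_mult_of mult_add_right
         distrib_left intro: tensor_null.intros)
next
  case (3 v v')
  then show ?case by (simp add: formal_mult_diff_left tensor_null.diff)
qed

lemma tensor_mult_class:
  "tensor_mult j scale mul (tensor_class j scale u) (tensor_class j scale v) =
   tensor_class j scale (formal_mult mul u v)"
proof -
  have const: "tensor_class j scale (formal_mult mul u' v') = tensor_class j scale (formal_mult mul u v)"
    if "u' - u \<in> tensor_null j scale" "v' - v \<in> tensor_null j scale" for u' v'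
    using tensor_null_add[OF formal_mult_null_left[OF that(1), of v']
        formal_mult_null_right[OF that(2), of u]]
    by (simp add: tensor_class_eq_iff formal_mult_diff_left formal_mult_diff_right)
  show ?thesis
    unfolding tensor_mult_def by (rule tensor_class_UN2) (rule const)
qed

end

definition scalar_extension_iso ::
    "('f::field \<Rightarrow> 'k::field) \<Rightarrow> ('f \<Rightarrow> 'a::ab_group_add \<Rightarrow> 'a) \<Rightarrow> ('a \<Rightarrow> 'a \<Rightarrow> 'a) \<Rightarrow>
     ('f \<Rightarrow> 'b::ab_group_add \<Rightarrow> 'b) \<Rightarrow> ('b \<Rightarrow> 'b \<Rightarrow> 'b) \<Rightarrow>
     (('a \<times> 'k \<Rightarrow>\<^sub>0 int) set \<Rightarrow> ('b \<times> 'k \<Rightarrow>\<^sub>0 int) set) \<Rightarrow> bool" where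
  "scalar_extension_iso j scaleA multA scaleB multB \<psi> \<longleftrightarrow>
     bij_betw \<psi> (tensor_carrier j scaleA) (tensor_carrier j scaleB) \<and>
     (\<forall>U\<in>tensor_carrier j scaleA. \<forall>V\<in>tensor_carrier j scaleA.
        \<psi> (tensor_add j scaleA U V) = tensor_add j scaleB (\<psi> U) (\<psi> V)) \<and>
     (\<forall>c. \<forall>U\<in>tensor_carrier j scaleA.
        \<psi> (tensor_smult j scaleA c U) = tensor_smult j scaleB c (\<psi> U)) \<and>
     (\<forall>U\<in>tensor_carrier j scaleA. \<forall>V\<in>tensor_carrier j scaleA.
        \<psi> (tensor_mult j scaleA multA U V) = tensor_mult j scaleB multB (\<psi> U) (\<psi> V))"

definition twisted_form ::
    "('f::field \<Rightarrow> 'a::ab_group_add \<Rightarrow> 'a) \<Rightarrow> ('a \<Rightarrow> 'a \<Rightarrow> 'a) \<Rightarrow>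
     ('f \<Rightarrow> 'b::ab_group_add \<Rightarrow> 'b) \<Rightarrow> ('b \<Rightarrow> 'b \<Rightarrow> 'b) \<Rightarrow> bool" where
  "twisted_form scaleA multA scaleB multB \<longleftrightarrow>
     nonassoc_algebra scaleA multA \<and> nonassoc_algebra scaleB multB \<and>
     (\<exists>\<psi>. scalar_extension_iso (to_ac :: 'f \<Rightarrow> 'f alg_closure) scaleA multA scaleB multB \<psi>)"

section \<open>The Witt algebra in characteristic 7\<close>

text \<open>The ring \<open>F[X]/(X^7)\<close>.\<close>

quotient_type (overloaded) 'f trunc7 = "'f::field poly" / "\<lambda>p q. [:0, 1:] ^ 7 dvd p - q"
proof (rule equivpI)
  show "reflp (\<lambda>p q::'f poly. [:0, 1:] ^ 7 dvd p - q)"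
    by (simp add: reflp_def)
  show "symp (\<lambda>p q::'f poly. [:0, 1:] ^ 7 dvd p - q)"
    by (simp add: symp_def dvd_diff_commute)
  show "transp (\<lambda>p q::'f poly. [:0, 1:] ^ 7 dvd p - q)"
  proof (rule transpI)
    fix p q r :: "'f poly"
    assume "[:0, 1:] ^ 7 dvd p - q" "[:0, 1:] ^ 7 dvd q - r"
    from dvd_add[OF this] show "[:0, 1:] ^ 7 dvd p - r" by simp
  qed
qed

lemma dvd_diff_of_eq: "p = q \<Longrightarrow> d dvd p - q" for p q d :: "'f::field poly"
  by simp

instantiation trunc7 :: (field) comm_ring_1
begin

lift_definition zero_trunc7 :: "'a trunc7" is 0 .
lift_definition one_trunc7 :: "'a trunc7" is 1 .
lift_definition plus_trunc7 :: "'a trunc7 \<Rightarrow> 'a trunc7 \<Rightarrow> 'a trunc7" is "(+)"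
  by (simp only: add_diff_add dvd_add)
lift_definition minus_trunc7 :: "'a trunc7 \<Rightarrow> 'a trunc7 \<Rightarrow> 'a trunc7" is "(-)"
proof -
  fix p p' q q' :: "'a poly"
  assume *: "[:0, 1:] ^ 7 dvd p - p'" "[:0, 1:] ^ 7 dvd q - q'"
  have "p - q - (p' - q') = (p - p') - (q - q')" by simp
  with * show "[:0, 1:] ^ 7 dvd p - q - (p' - q')" by (simp only: dvd_diff)
qed
lift_definition uminus_trunc7 :: "'a trunc7 \<Rightarrow> 'a trunc7" is uminus
  by (simp only: minus_diff_minus dvd_minus_iff)
lift_definition times_trunc7 :: "'a trunc7 \<Rightarrow> 'a trunc7 \<Rightarrow> 'a trunc7" is "(*)"
proof -
  fix p p' q q' :: "'a poly"
  assume *: "[:0, 1:] ^ 7 dvd p - p'" "[:0, 1:] ^ 7 dvd q - q'"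
  have "p * q - p' * q' = (p - p') * q + p' * (q - q')"
    by (simp add: algebra_simps)
  with * show "[:0, 1:] ^ 7 dvd p * q - p' * q'"
    by simp
qed

instance
proof
  have "\<not> [:0, 1:] dvd (1 :: 'a poly)"
    by (simp add: is_unit_poly_iff)
  then have "\<not> [:0, 1:] ^ 7 dvd (1 :: 'a poly)"
    by (simp only: is_unit_power_iff) simp
  then show "(0 :: 'a trunc7) \<noteq> 1"
    by transfer simp
qed (transfer; rule dvd_diff_of_eq; simp add: algebra_simps)+

end

lift_definition scale_trunc7 :: "'f::field \<Rightarrow> 'f trunc7 \<Rightarrow> 'f trunc7" is smult
  by (simp only: smult_diff_right[symmetric] dvd_smult)

lemma vector_space_scale_trunc7: "vector_space scale_trunc7"
  by standard (transfer; rule dvd_diff_of_eq; simp add: smult_add_left smult_add_right)+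

lemma linear_scale_trunc7_iff:
  "Vector_Spaces.linear scale_trunc7 scale_trunc7 d \<longleftrightarrow>
     (\<forall>x y. d (x + y) = d x + d y) \<and> (\<forall>c x. d (scale_trunc7 c x) = scale_trunc7 c (d x))"
  using vector_space_scale_trunc7
  by (auto simp: Vector_Spaces.linear_def module_hom_iff module_hom_axioms_def
      Modules.module_hom_def vector_space_def Modules.module_def)

lemma scale_trunc7_mult:
  "scale_trunc7 c x * y = scale_trunc7 c (x * y)" "x * scale_trunc7 c y = scale_trunc7 c (x * y)"
  by (transfer; rule dvd_diff_of_eq; simp)+

lemma in_derivations_trunc7_iff:
  "d \<in> derivations scale_trunc7 (*) \<longleftrightarrow>
     (\<forall>x y. d (x + y) = d x + d y) \<and> (\<forall>c x. d (scale_trunc7 c x) = scale_trunc7 c (d x)) \<and>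
     (\<forall>x y. d (x * y) = d x * y + x * d y)"
  by (simp add: derivations_def linear_scale_trunc7_iff)

interpretation trunc7: vector_space scale_trunc7
  by (rule vector_space_scale_trunc7)

text \<open>The type below is meant for fields of characteristic 7 only.\<close>

typedef (overloaded) 'f witt = "derivations scale_trunc7 (*) :: ('f::field trunc7 \<Rightarrow> 'f trunc7) set"
  by (rule exI[of _ "\<lambda>_. 0"]) (simp add: in_derivations_trunc7_iff)

setup_lifting type_definition_witt

instantiation witt :: (field) ab_group_add
begin

lift_definition zero_witt :: "'a witt" is "\<lambda>_. 0"
  by (simp add: in_derivations_trunc7_iff)
lift_definition plus_witt :: "'a witt \<Rightarrow> 'a witt \<Rightarrow> 'a witt" is "\<lambda>d e x. d x + e x"
  by (simp add: in_derivations_trunc7_iff trunc7.scale_right_distrib algebra_simps)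
lift_definition minus_witt :: "'a witt \<Rightarrow> 'a witt \<Rightarrow> 'a witt" is "\<lambda>d e x. d x - e x"
  by (simp add: in_derivations_trunc7_iff trunc7.scale_right_diff_distrib algebra_simps)
lift_definition uminus_witt :: "'a witt \<Rightarrow> 'a witt" is "\<lambda>d x. - d x"
  by (simp add: in_derivations_trunc7_iff algebra_simps)

instance
  by standard (transfer; simp add: fun_eq_iff algebra_simps)+

end

lift_definition witt_scale :: "'f::field \<Rightarrow> 'f witt \<Rightarrow> 'f witt" is "\<lambda>c d x. scale_trunc7 c (d x)"
  by (simp add: in_derivations_trunc7_iff trunc7.scale_right_distrib scale_trunc7_mult mult.commute)

lift_definition witt_bracket :: "'f::field witt \<Rightarrow> 'f witt \<Rightarrow> 'f witt" is commutator
  by (simp add: in_derivations_trunc7_iff commutator_def trunc7.scale_right_diff_distrib algebra_simps)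

lemma nonassoc_algebra_witt: "nonassoc_algebra witt_scale witt_bracket"
proof
qed (transfer; simp add: in_derivations_trunc7_iff commutator_def fun_eq_iff
      trunc7.scale_right_distrib trunc7.scale_left_distrib trunc7.scale_right_diff_distrib)+

lemma twisted_form_witt_self: "twisted_form witt_scale witt_bracket witt_scale witt_bracket"
  unfolding twisted_form_def scalar_extension_iso_def
  using nonassoc_algebra_witt by (auto intro!: exI[of _ id])

end

theory Submission
  imports Defs "Jordan_Normal_Form.Char_Poly"
begin

text \<open>
  Let \<open>L\<close> be a twisted form of the Witt algebra over the field \<open>F\<close> of characteristic 7.

  \<^bold>\<open>Normal form.\<close> There is \<open>\<alpha>\<close> in \<open>F\<close> such that \<open>L\<close> is the Lie algebra of vector fields \<open>f d/dx\<close> on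
  \<open>F[x]/(x^7 - \<alpha>)\<close>; the basis \<open>e_k = x^k d/dx\<close> has \<open>[e_j, e_k] = (k - j) e_{j+k-1}\<close> with indices reduced
  by \<open>x^7 = \<alpha>\<close>. Over the algebraic closure \<open>K\<close> the elements of \<open>L\<close> become vector fields on \<open>K[X]/(X^7)\<close>, and
  multiplication by functions can be recovered from the bracket: by \<open>vf_half_derivation\<close> the linear maps \<open>S\<close>
  with \<open>2 S[u, v] = [S u, v] + [u, S v]\<close> are exactly the multiplications. This condition is linear, so the
  solution space over \<open>K\<close> is spanned by solutions over \<open>F\<close>, and one of these is multiplication by a function
  \<open>x\<close> with invertible derivative (\<open>multiplier_exists\<close>). The power \<open>x^7\<close> is a constant, and it lies in \<open>F\<close>
  because multiplication by it preserves \<open>L\<close>; a rescaling argument then shows that \<open>L\<close> contains a vector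
  field with value 1 on \<open>x\<close> (\<open>witt_frame_exists\<close>).

  \<^bold>\<open>Existence.\<close> Vector fields act on half densities \<open>f (dx)^{1/2}\<close>, where \<open>x^k d/dx\<close> maps
  \<open>y_i = x^i (dx)^{1/2}\<close> to \<open>(i + k/2) y_{i+k-1}\<close>, and \<open>1/2 = 4\<close> modulo 7. Half densities carry the invariant
  bilinear form that reads off the coefficient of \<open>x^6\<close> in a product. Grozman's third order bidifferential
  operator is an invariant map from pairs of densities of weight \<open>-2/3\<close> to densities of weight \<open>5/3\<close>; modulo
  7 these weights are both \<open>1/2\<close>, so it is an invariant product on half densities. Half densities together
  with a unit form the split Cayley algebra: a basis of a split Cayley algebra with the corresponding products
  is constructed by two Cayley-Dickson doublings of the span of a nontrivial idempotent and its conjugate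
  (\<open>half_density_basis_exists\<close>). The products do not involve \<open>\<alpha>\<close>, and for every \<open>\<alpha>\<close> the above action is an
  action by derivations (\<open>density_action_derivations\<close>), which yields \<open>lie_embedding_exists\<close>.

  \<^bold>\<open>Conjugacy.\<close> Given any embedding, let \<open>E_k\<close> be the image of \<open>e_k\<close> and \<open>V\<close> the 7-dimensional space of
  elements of trace 0. The operator \<open>E_1\<close> on \<open>V\<close> is skew for the norm, and trace identities obtained from the
  brackets show that its characteristic polynomial is \<open>X^7 - X\<close> (\<open>char_poly_toral\<close>). Thus every element of
  the prime field is a simple weight of \<open>E_1\<close>. Lowering a vector of weight 3 by \<open>E_0\<close> gives a basis of \<open>V\<close> on
  which all \<open>E_k\<close> act as on half densities (\<open>E_z\<close>). Invariance determines the products of this basis up to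
  one scalar, which disappears after rescaling (\<open>adapted_basis_exists\<close>). So each embedding comes with a basis
  in which both the products and the action are the standard ones, and the linear map between the bases of two
  embeddings is the automorphism that conjugates them (\<open>lie_embeddings_conjugate\<close>).
\<close>

section \<open>Finite bases indexed by natural numbers\<close>

definition indep_family :: "('f::field \<Rightarrow> 'a::ab_group_add \<Rightarrow> 'a) \<Rightarrow> nat \<Rightarrow> (nat \<Rightarrow> 'a) \<Rightarrow> bool" where
  "indep_family scale n v \<longleftrightarrow> (\<forall>c. (\<Sum>i<n. scale (c i) (v i)) = 0 \<longrightarrow> (\<forall>i<n. c i = 0))"

lemma indep_familyD:
  assumes "indep_family scale n v" "(\<Sum>i<n. scale (c i) (v i)) = 0" "i < n"
  shows "c i = 0"
proof -
  have "(\<Sum>i<n. scale (c i) (v i)) = 0 \<longrightarrow> (\<forall>i<n. c i = 0)"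
    using assms(1) unfolding indep_family_def by (rule spec)
  with assms(2,3) show ?thesis by simp
qed

text \<open>
  A basis \<open>v 0, \<dots>, v (n - 1)\<close> of the subspace \<open>S\<close>. Indexing by natural numbers makes coordinates functions
  on numbers, so that multiplication tables and matrices can be written down directly.
\<close>

locale frame = vector_space scale
  for scale :: "'f::field \<Rightarrow> 'a::ab_group_add \<Rightarrow> 'a" and S :: "'a set" and n :: nat and v :: "nat \<Rightarrow> 'a" +
  assumes in_frame_iff: "x \<in> S \<longleftrightarrow> (\<exists>c. x = (\<Sum>i<n. scale (c i) (v i)))"
    and frame_indep: "indep_family scale n v"
begin

definition coord :: "'a \<Rightarrow> nat \<Rightarrow> 'f" where
  "coord x i = (if i < n then (SOME c. x = (\<Sum>i<n. scale (c i) (v i))) i else 0)"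

lemma sum_coord: "x \<in> S \<Longrightarrow> (\<Sum>i<n. scale (coord x i) (v i)) = x"
proof -
  assume "x \<in> S"
  then have "x = (\<Sum>i<n. scale ((SOME c. x = (\<Sum>i<n. scale (c i) (v i))) i) (v i))"
    unfolding in_frame_iff by (rule someI_ex)
  also have "\<dots> = (\<Sum>i<n. scale (coord x i) (v i))"
    by (rule sum.cong) (simp_all add: coord_def)
  finally show ?thesis by simp
qed

lemma coeff_eqI:
  assumes "(\<Sum>i<n. scale (c i) (v i)) = (\<Sum>i<n. scale (d i) (v i))" "i < n"
  shows "c i = d i"
proof -
  have "(\<Sum>i<n. scale (c i - d i) (v i)) = 0"
    using assms(1) by (simp add: scale_left_diff_distrib sum_subtractf)
  from indep_familyD[OF frame_indep this assms(2)] show ?thesis by simp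
qed

lemma comb_in [simp]: "(\<Sum>i<n. scale (c i) (v i)) \<in> S"
  by (auto simp: in_frame_iff)

lemma coord_comb: "i < n \<Longrightarrow> coord (\<Sum>i<n. scale (c i) (v i)) i = c i"
  using coeff_eqI sum_coord comb_in by metis

lemma basis_comb: "i < n \<Longrightarrow> v i = (\<Sum>k<n. scale (if k = i then 1 else 0) (v k))"
proof -
  assume i: "i < n"
  have "(\<Sum>k<n. scale (if k = i then 1 else 0) (v k)) = (\<Sum>k<n. if k = i then v k else 0)"
    by (rule sum.cong) auto
  with i show ?thesis by simp
qed

lemma basis_in [simp]: "i < n \<Longrightarrow> v i \<in> S"
  by (subst basis_comb) simp_all

lemma coord_basis: "i < n \<Longrightarrow> coord (v i) k = (if k = i then 1 else 0)"
proof (cases "k < n")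
  case True
  assume "i < n"
  show ?thesis by (subst basis_comb[OF \<open>i < n\<close>]) (rule coord_comb[OF True])
qed (auto simp: coord_def)

lemma scale_in: "x \<in> S \<Longrightarrow> scale a x \<in> S"
proof -
  assume "x \<in> S"
  then obtain c where "x = (\<Sum>i<n. scale (c i) (v i))" by (auto simp: in_frame_iff)
  then have "scale a x = (\<Sum>i<n. scale (a * c i) (v i))" by (simp add: scale_sum_right)
  then show ?thesis by simp
qed

lemma coord_add: "x \<in> S \<Longrightarrow> y \<in> S \<Longrightarrow> coord (x + y) i = coord x i + coord y i"
proof (cases "i < n")
  case True
  assume "x \<in> S" "y \<in> S"
  then have "x + y = (\<Sum>i<n. scale (coord x i + coord y i) (v i))"
    by (simp add: scale_left_distrib sum.distrib sum_coord)
  then show ?thesis using coord_comb[OF True, of "\<lambda>i. coord x i + coord y i"] by simp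
qed (simp add: coord_def)

lemma coord_scale: "x \<in> S \<Longrightarrow> coord (scale a x) i = a * coord x i"
proof (cases "i < n")
  case True
  assume "x \<in> S"
  then have "scale a x = (\<Sum>i<n. scale (a * coord x i) (v i))"
    by (simp flip: scale_scale scale_sum_right add: sum_coord)
  then show ?thesis using coord_comb[OF True, of "\<lambda>i. a * coord x i"] by simp
qed (simp add: coord_def)

lemma zero_in: "0 \<in> S"
  using comb_in[of "\<lambda>_. 0"] by simp

lemma coord_zero [simp]: "coord 0 i = 0"
  using coord_scale[OF zero_in, of 0 i] by simp

lemma coord_eqI:
  assumes "x \<in> S" "y \<in> S" "\<And>i. i < n \<Longrightarrow> coord x i = coord y i"
  shows "x = y"
proof -
  have "x = (\<Sum>i<n. scale (coord x i) (v i))" using assms(1) by (simp add: sum_coord)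
  also have "\<dots> = (\<Sum>i<n. scale (coord y i) (v i))" by (rule sum.cong) (simp_all add: assms(3))
  also have "\<dots> = y" using assms(2) by (simp add: sum_coord)
  finally show ?thesis .
qed

end

text \<open>
  The bridge to linear independence of sets, through which the results on dimension become available.
\<close>

lemma family_independent:
  fixes scale :: "'f::field \<Rightarrow> 'a::ab_group_add \<Rightarrow> 'a" and v :: "nat \<Rightarrow> 'a"
  assumes "vector_space scale"
    and indep: "indep_family scale n v"
  shows "inj_on v {..<n}" "\<not> module.dependent scale (v ` {..<n})"
proof -
  interpret vector_space scale by fact
  show inj: "inj_on v {..<n}"
  proof (rule inj_onI, rule ccontr)
    fix i k assume ik: "i \<in> {..<n}" "k \<in> {..<n}" "v i = v k" "i \<noteq> k"
    let ?c = "\<lambda>l. if l = i then 1 else if l = k then - 1 else (0::'f)"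
    have "(\<Sum>l<n. scale (?c l) (v l)) = (\<Sum>l\<in>{i, k}. scale (?c l) (v l))"
      using ik by (intro sum.mono_neutral_right) auto
    also have "\<dots> = 0" using ik by simp
    finally have "?c i = 0" using ik indep_familyD[OF indep, of ?c i] by simp
    then show False by simp
  qed
  show "\<not> dependent (v ` {..<n})"
  proof (rule independent_if_scalars_zero)
    fix f x assume f: "(\<Sum>x\<in>v ` {..<n}. scale (f x) x) = 0" and x: "x \<in> v ` {..<n}"
    have "(\<Sum>i<n. scale (f (v i)) (v i)) = 0"
      using f by (simp add: sum.reindex[OF inj])
    then show "f x = 0" using x indep_familyD[OF indep, of "\<lambda>i. f (v i)"] by auto
  qed simp
qed

lemma frame_if_span:
  fixes scale :: "'f::field \<Rightarrow> 'a::ab_group_add \<Rightarrow> 'a" and v :: "nat \<Rightarrow> 'a"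
  assumes vs: "vector_space scale"
    and indep: "indep_family scale n v"
  shows "frame scale (module.span scale (v ` {..<n})) n v"
proof -
  interpret vector_space scale by fact
  note inj = family_independent(1)[OF vs indep]
  have "x \<in> span (v ` {..<n}) \<longleftrightarrow> (\<exists>c. x = (\<Sum>i<n. scale (c i) (v i)))" for x
  proof
    assume "x \<in> span (v ` {..<n})"
    then obtain f where "x = (\<Sum>y\<in>v ` {..<n}. scale (f y) y)"
      by (auto simp: span_finite)
    then have "x = (\<Sum>i<n. scale (f (v i)) (v i))" by (simp add: sum.reindex[OF inj])
    then show "\<exists>c. x = (\<Sum>i<n. scale (c i) (v i))" by (rule exI[of _ "\<lambda>i. f (v i)"])
  next
    assume "\<exists>c. x = (\<Sum>i<n. scale (c i) (v i))"
    then show "x \<in> span (v ` {..<n})"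
      by (auto intro!: span_sum span_scale intro: span_base)
  qed
  then show ?thesis using indep by unfold_locales auto
qed

text \<open>
  A vector of \<open>S\<close> outside the span of \<open>w\<close> would give \<open>n + 1\<close> independent vectors in the span of \<open>n\<close>.
\<close>

lemma frame_exchange:
  fixes scale :: "'f::field \<Rightarrow> 'a::ab_group_add \<Rightarrow> 'a" and v w :: "nat \<Rightarrow> 'a"
  assumes "frame scale S n v"
    and w: "\<And>i. i < n \<Longrightarrow> w i \<in> S"
    and indep: "indep_family scale n w"
  shows "frame scale S n w"
proof -
  interpret frame scale S n v by fact
  have vs: "vector_space scale" by unfold_locales
  note fw = family_independent[OF vs indep]
  have S: "S = span (v ` {..<n})"
    using frame.in_frame_iff[OF frame_if_span[OF vs frame_indep]] in_frame_iff by blast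
  have sub: "w ` {..<n} \<subseteq> S" using w by auto
  have "S \<subseteq> span (w ` {..<n})"
  proof
    fix x assume x: "x \<in> S"
    show "x \<in> span (w ` {..<n})"
    proof (rule ccontr)
      assume n: "x \<notin> span (w ` {..<n})"
      then have ind: "\<not> dependent (insert x (w ` {..<n}))" using fw(2) by (simp add: independent_insertI)
      have "card (insert x (w ` {..<n})) \<le> card (v ` {..<n})"
        using independent_span_bound[OF _ ind, of "v ` {..<n}"] x sub S by auto
      moreover have "card (insert x (w ` {..<n})) = Suc n"
        using n span_base fw(1) by (subst card_insert_disjoint) (auto simp: card_image)
      moreover have "card (v ` {..<n}) \<le> n" using card_image_le[of "{..<n}" v] by simp
      ultimately show False by simp
    qed
  qed
  moreover have "span (w ` {..<n}) \<subseteq> S"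
    unfolding S using sub S by (intro span_minimal) auto
  ultimately have "S = span (w ` {..<n})" by blast
  then show ?thesis using frame_if_span[OF vs indep] by simp
qed

lemma frame_of_finite_basis:
  fixes scale :: "'f::field \<Rightarrow> 'a::ab_group_add \<Rightarrow> 'a"
  assumes vs: "vector_space scale" and B: "finite B" "\<not> module.dependent scale B" "module.span scale B = UNIV"
  obtains v where "frame scale UNIV (card B) v" "v ` {..<card B} = B"
proof -
  interpret vector_space scale by fact
  obtain v where v: "bij_betw v {..<card B} B"
    using ex_bij_betw_nat_finite[OF B(1)] unfolding atLeast0LessThan by blast
  then have im: "v ` {..<card B} = B" and inj: "inj_on v {..<card B}" by (auto simp: bij_betw_def)
  have "indep_family scale (card B) v"
    unfolding indep_family_def
  proof (intro allI impI)
    fix c i assume c: "(\<Sum>i<card B. scale (c i) (v i)) = 0" and i: "i < card B"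
    let ?f = "\<lambda>b. c (inv_into {..<card B} v b)"
    have "(\<Sum>b\<in>B. scale (?f b) b) = (\<Sum>i<card B. scale (?f (v i)) (v i))"
      by (rule sum.reindex_bij_betw[OF v, symmetric])
    also have "\<dots> = 0" using c inj by (simp add: inv_into_f_f)
    finally have "?f (v i) = 0"
      using independentD[OF B(2) B(1) subset_refl, of ?f "v i"] i im by blast
    then show "c i = 0" using inj i by (simp add: inv_into_f_f)
  qed
  from frame_if_span[OF vs this] show ?thesis using that im B(3) by simp
qed

lemma frame_if_dim:
  fixes scale :: "'f::field \<Rightarrow> 'a::ab_group_add \<Rightarrow> 'a"
  assumes vs: "vector_space scale" and dim: "vector_space.dim scale UNIV = n" "0 < n"
    and indep: "indep_family scale n w"
  shows "frame scale UNIV n w"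
proof -
  interpret vector_space scale by fact
  obtain B where B: "B \<subseteq> UNIV" "independent B" "UNIV \<subseteq> span B" "card B = dim UNIV"
    by (rule basis_exists)
  have card: "card B = n" using B(4) dim(1) by simp
  then have "finite B" using dim(2) by (intro card_ge_0_finite) simp
  moreover have "span B = UNIV" using B(3) by (rule top.extremum_uniqueI)
  ultimately obtain v where "frame scale UNIV (card B) v"
    using frame_of_finite_basis[OF vs _ B(2)] by metis
  then have "frame scale UNIV n v" unfolding card .
  then show ?thesis
    by (rule frame_exchange) (simp_all add: indep)
qed

lemma linear_comb:
  assumes "Vector_Spaces.linear s1 s2 f"
  shows "f (\<Sum>i\<in>A. s1 (c i) (v i)) = (\<Sum>i\<in>A. s2 (c i) (f (v i)))"
proof -
  interpret Vector_Spaces.linear s1 s2 f by fact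
  show ?thesis by (simp add: sum scale)
qed

lemma (in frame) linear_frame_expansion:
  assumes "Vector_Spaces.linear scale s2 f" "x \<in> S"
  shows "f x = (\<Sum>i<n. s2 (coord x i) (f (v i)))"
  using linear_comb[OF assms(1), of "coord x" v "{..<n}"] sum_coord[OF assms(2)] by simp

lemma linear_comb_map:
  assumes fr: "frame s1 UNIV n v" and vs2: "vector_space s2"
  shows "Vector_Spaces.linear s1 s2 (\<lambda>x. \<Sum>i<n. s2 (frame.coord s1 n v x i) (w i))"
proof -
  interpret frame s1 UNIV n v by fact
  interpret V2: vector_space s2 by fact
  show ?thesis
    unfolding Vector_Spaces.linear_iff
    using vs2 vector_space_axioms
    by (auto simp: coord_add coord_scale V2.scale_left_distrib sum.distrib V2.scale_sum_right)
qed

lemma frame_linear_eqI: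
  assumes "frame s UNIV n v" "Vector_Spaces.linear s s' f" "Vector_Spaces.linear s s' g"
    and "\<And>i. i < n \<Longrightarrow> f (v i) = g (v i)"
  shows "f x = g x"
proof -
  interpret frame s UNIV n v by fact
  show ?thesis
    using linear_frame_expansion[OF assms(2), of x] linear_frame_expansion[OF assms(3), of x] assms(4) by simp
qed

lemma frame_bilinear_eqI:
  assumes fr: "frame s UNIV n v"
    and f: "\<And>y. Vector_Spaces.linear s s' (\<lambda>x. f x y)" "\<And>x. Vector_Spaces.linear s s' (f x)"
    and g: "\<And>y. Vector_Spaces.linear s s' (\<lambda>x. g x y)" "\<And>x. Vector_Spaces.linear s s' (g x)"
    and eq: "\<And>i j. i < n \<Longrightarrow> j < n \<Longrightarrow> f (v i) (v j) = g (v i) (v j)"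
  shows "f x y = g x y"
proof (rule frame_linear_eqI[OF fr f(1) g(1)])
  fix i assume "i < n"
  show "f (v i) y = g (v i) y"
    by (rule frame_linear_eqI[OF fr f(2) g(2)]) (rule eq[OF \<open>i < n\<close>])
qed

lemma frame_card_le:
  assumes "frame s S n v" "frame s S m w"
  shows "n \<le> m"
proof -
  interpret V: frame s S n v by fact
  interpret W: frame s S m w by fact
  note fi = family_independent[OF V.vector_space_axioms V.frame_indep]
  have "v ` {..<n} \<subseteq> V.span (w ` {..<m})"
  proof
    fix x assume "x \<in> v ` {..<n}"
    then have "x = (\<Sum>i<m. s (W.coord x i) (w i))" using W.sum_coord[of x] by auto
    also have "\<dots> \<in> V.span (w ` {..<m})"
      by (intro V.span_sum V.span_scale V.span_base) auto
    finally show "x \<in> V.span (w ` {..<m})" .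
  qed
  then have "card (v ` {..<n}) \<le> card (w ` {..<m})"
    using V.independent_span_bound[OF _ fi(2)] by auto
  also have "\<dots> \<le> m" using card_image_le[of "{..<m}" w] by simp
  finally show ?thesis using fi(1) by (simp add: card_image)
qed

lemma additive_sum:
  fixes f :: "'a::ab_group_add \<Rightarrow> 'b::ab_group_add"
  assumes "\<And>x y. f (x - y) = f x - f y"
  shows "f 0 = 0" "f (x + y) = f x + f y" "f (\<Sum>i\<in>A. g i) = (\<Sum>i\<in>A. f (g i))"
proof -
  show z: "f 0 = 0" using assms[of 0 0] by simp
  show a: "f (x + y) = f x + f y" for x y
    using assms[of x "- y"] assms[of 0 y] z by simp
  show "f (\<Sum>i\<in>A. g i) = (\<Sum>i\<in>A. f (g i))"
    by (induction A rule: infinite_finite_induct) (simp_all add: z a)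
qed

section \<open>Traces and characteristic polynomials\<close>

definition trace_mat :: "'a::comm_ring_1 mat \<Rightarrow> 'a" where
  "trace_mat A = (\<Sum>i<dim_row A. A $$ (i, i))"

lemma trace_mat_add: "A \<in> carrier_mat n n \<Longrightarrow> B \<in> carrier_mat n n \<Longrightarrow> trace_mat (A + B) = trace_mat A + trace_mat B"
  by (auto simp: trace_mat_def sum.distrib)

lemma trace_mat_minus: "A \<in> carrier_mat n n \<Longrightarrow> B \<in> carrier_mat n n \<Longrightarrow> trace_mat (A - B) = trace_mat A - trace_mat B"
  by (auto simp: trace_mat_def sum_subtractf)

lemma trace_mat_smult: "A \<in> carrier_mat n n \<Longrightarrow> trace_mat (c \<cdot>\<^sub>m A) = c * trace_mat A"
  by (auto simp: trace_mat_def sum_distrib_left)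

lemma trace_mat_one: "trace_mat (1\<^sub>m n) = of_nat n"
  by (simp add: trace_mat_def)

lemma trace_mat_transpose: "A \<in> carrier_mat n n \<Longrightarrow> trace_mat (transpose_mat A) = trace_mat A"
  by (auto simp: trace_mat_def)

lemma trace_mat_mult:
  assumes "A \<in> carrier_mat n n" "B \<in> carrier_mat n n"
  shows "trace_mat (A * B) = (\<Sum>i<n. \<Sum>j<n. A $$ (i, j) * B $$ (j, i))"
  using assms by (auto simp: trace_mat_def scalar_prod_def atLeast0LessThan)

lemma trace_mat_comm:
  assumes "A \<in> carrier_mat n n" "B \<in> carrier_mat n n"
  shows "trace_mat (A * B) = trace_mat (B * A)"
  unfolding trace_mat_mult[OF assms] trace_mat_mult[OF assms(2,1)]
  by (subst sum.swap) (simp add: mult.commute)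

text \<open>
  Differentiating the Leibniz formula row by row.
\<close>

lemma pderiv_det:
  fixes M :: "'a::field poly mat"
  assumes M: "M \<in> carrier_mat n n"
  shows "pderiv (det M) = (\<Sum>k<n. det (mat n n (\<lambda>(i, j). if i = k then pderiv (M $$ (i, j)) else M $$ (i, j))))"
proof -
  let ?R = "\<lambda>k. mat n n (\<lambda>(i, j). if i = k then pderiv (M $$ (i, j)) else M $$ (i, j))"
  let ?S = "{p. p permutes {0..<n}}"
  have *: "pderiv (of_int (sign p) * (\<Prod>i = 0..<n. M $$ (i, p i)))
    = (\<Sum>k<n. of_int (sign p) * (\<Prod>i = 0..<n. ?R k $$ (i, p i)))" if p: "p \<in> ?S" for p
  proof -
    have pi: "p i < n" if "i < n" for i
      using p that permutes_in_image[of p "{0..<n}" i] by auto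
    have "pderiv (\<Prod>i = 0..<n. M $$ (i, p i))
        = (\<Sum>k\<in>{0..<n}. (\<Prod>i\<in>{0..<n} - {k}. M $$ (i, p i)) * pderiv (M $$ (k, p k)))"
      by (rule pderiv_prod)
    also have "\<dots> = (\<Sum>k\<in>{0..<n}. \<Prod>i = 0..<n. ?R k $$ (i, p i))"
    proof (rule sum.cong[OF refl])
      fix k assume k: "k \<in> {0..<n}"
      have "(\<Prod>i = 0..<n. ?R k $$ (i, p i))
          = ?R k $$ (k, p k) * (\<Prod>i\<in>{0..<n} - {k}. ?R k $$ (i, p i))"
        using k by (intro prod.remove) auto
      also have "(\<Prod>i\<in>{0..<n} - {k}. ?R k $$ (i, p i)) = (\<Prod>i\<in>{0..<n} - {k}. M $$ (i, p i))"
        by (rule prod.cong) (auto simp: pi)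
      finally show "(\<Prod>i\<in>{0..<n} - {k}. M $$ (i, p i)) * pderiv (M $$ (k, p k))
          = (\<Prod>i = 0..<n. ?R k $$ (i, p i))"
        using k pi by (simp add: mult.commute)
    qed
    also have "\<dots> = (\<Sum>k<n. \<Prod>i = 0..<n. ?R k $$ (i, p i))"
      by (simp add: atLeast0LessThan)
    finally have e: "pderiv (\<Prod>i = 0..<n. M $$ (i, p i)) = (\<Sum>k<n. \<Prod>i = 0..<n. ?R k $$ (i, p i))" .
    show ?thesis
      by (cases p rule: sign_cases) (simp_all add: e pderiv_minus sum_negf)
  qed
  have "pderiv (det M) = (\<Sum>p\<in>?S. pderiv (of_int (sign p) * (\<Prod>i = 0..<n. M $$ (i, p i))))"
    using M by (simp add: det_def pderiv_sum)
  also have "\<dots> = (\<Sum>p\<in>?S. \<Sum>k<n. of_int (sign p) * (\<Prod>i = 0..<n. ?R k $$ (i, p i)))"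
    by (rule sum.cong[OF refl]) (rule *)
  also have "\<dots> = (\<Sum>k<n. \<Sum>p\<in>?S. of_int (sign p) * (\<Prod>i = 0..<n. ?R k $$ (i, p i)))"
    by (rule sum.swap)
  also have "\<dots> = (\<Sum>k<n. det (?R k))"
    by (simp add: det_def)
  finally show ?thesis .
qed

text \<open>
  Jacobi's formula: the derivative of the \<open>k\<close>-th row of \<open>X - A\<close> is a unit vector, so each determinant in the
  row-wise derivative is a cofactor.
\<close>

lemma pderiv_char_poly:
  fixes A :: "'a::field mat"
  assumes A: "A \<in> carrier_mat n n"
  shows "pderiv (char_poly A) = (\<Sum>k<n. adj_mat (char_poly_matrix A) $$ (k, k))"
proof -
  let ?M = "char_poly_matrix A"
  have M: "?M \<in> carrier_mat n n" using A by simp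
  let ?R = "\<lambda>k. mat n n (\<lambda>(i, j). if i = k then pderiv (?M $$ (i, j)) else ?M $$ (i, j))"
  have "det (?R k) = adj_mat ?M $$ (k, k)" if k: "k < n" for k
  proof -
    have row: "?R k $$ (k, j) = (if j = k then 1 else 0)" if "j < n" for j
      using k that A by (simp add: char_poly_matrix_def pderiv_pCons)
    have cof: "cofactor (?R k) k k = cofactor ?M k k"
    proof -
      have "mat_delete (?R k) k k = mat_delete ?M k k"
        using carrier_matD[OF M] k by (intro eq_matI) (auto simp: mat_delete_def)
      then show ?thesis by (simp add: cofactor_def)
    qed
    have "det (?R k) = (\<Sum>j<n. ?R k $$ (k, j) * cofactor (?R k) k j)"
      by (rule laplace_expansion_row[OF _ k]) simp
    also have "\<dots> = (\<Sum>j<n. if j = k then cofactor (?R k) k j else 0)"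
      by (rule sum.cong) (auto simp del: index_mat simp add: row)
    also have "\<dots> = cofactor ?M k k"
      using k cof by simp
    finally show ?thesis using k carrier_matD[OF M] by (simp add: adj_mat_def)
  qed
  then show ?thesis
    unfolding char_poly_def pderiv_det[OF M] by simp
qed

text \<open>
  The matrix coefficient of \<open>X^k\<close> in the adjugate of \<open>X - A\<close>. These matrices are the ones that occur in the
  Faddeev-LeVerrier recursion, which computes the characteristic polynomial from traces of powers.
\<close>

definition adj_coeff :: "'a::comm_ring_1 mat \<Rightarrow> nat \<Rightarrow> 'a mat" where
  "adj_coeff A k = mat (dim_row A) (dim_row A) (\<lambda>(i, j). coeff (adj_mat (char_poly_matrix A) $$ (i, j)) k)"

lemma adj_coeff_carrier [simp]: "A \<in> carrier_mat n n \<Longrightarrow> adj_coeff A k \<in> carrier_mat n n"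
  by (auto simp: adj_coeff_def)

lemma trace_adj_coeff:
  fixes A :: "'a::field mat"
  assumes A: "A \<in> carrier_mat n n"
  shows "trace_mat (adj_coeff A k) = of_nat (Suc k) * coeff (char_poly A) (Suc k)"
proof -
  have "trace_mat (adj_coeff A k) = coeff (pderiv (char_poly A)) k"
    using A by (simp add: trace_mat_def adj_coeff_def pderiv_char_poly[OF A] coeff_sum)
  then show ?thesis by (simp add: coeff_pderiv)
qed

text \<open>
  Comparison of coefficients in \<open>(X - A) adj (X - A) = char_poly A\<close>.
\<close>

lemma adj_coeff_rec:
  fixes A :: "'a::field mat"
  assumes A: "A \<in> carrier_mat n n"
  shows "A * adj_coeff A 0 = - coeff (char_poly A) 0 \<cdot>\<^sub>m 1\<^sub>m n"
    and "adj_coeff A k = A * adj_coeff A (Suc k) + coeff (char_poly A) (Suc k) \<cdot>\<^sub>m 1\<^sub>m n"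
proof -
  let ?M = "char_poly_matrix A" and ?B = "adj_mat (char_poly_matrix A)"
  have M: "?M \<in> carrier_mat n n" using A by simp
  note adj = adj_mat[OF M]
  have entry: "[:0, 1:] * ?B $$ (i, j) - (\<Sum>l<n. Polynomial.smult (A $$ (i, l)) (?B $$ (l, j)))
      = (if i = j then char_poly A else 0)" if ij: "i < n" "j < n" for i j
  proof -
    have "(?M * ?B) $$ (i, j) = (\<Sum>l<n. ?M $$ (i, l) * ?B $$ (l, j))"
      using M adj(1) ij by (auto simp: scalar_prod_def atLeast0LessThan simp del: adj intro!: sum.cong)
    also have "\<dots> = (\<Sum>l<n. (if l = i then [:0, 1:] * ?B $$ (l, j) else 0) - Polynomial.smult (A $$ (i, l)) (?B $$ (l, j)))"
      using A ij by (intro sum.cong) (auto simp: char_poly_matrix_def)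
    also have "\<dots> = [:0, 1:] * ?B $$ (i, j) - (\<Sum>l<n. Polynomial.smult (A $$ (i, l)) (?B $$ (l, j)))"
      using ij by (simp add: sum_subtractf)
    finally have "[:0, 1:] * ?B $$ (i, j) - (\<Sum>l<n. Polynomial.smult (A $$ (i, l)) (?B $$ (l, j)))
        = (?M * ?B) $$ (i, j)" by (rule sym)
    also have "\<dots> = (if i = j then char_poly A else 0)"
      unfolding adj(2) using ij by (simp add: char_poly_def)
    finally show ?thesis .
  qed
  show "A * adj_coeff A 0 = - coeff (char_poly A) 0 \<cdot>\<^sub>m 1\<^sub>m n"
  proof (rule eq_matI)
    fix i j assume "i < dim_row (- coeff (char_poly A) 0 \<cdot>\<^sub>m 1\<^sub>m n)" "j < dim_col (- coeff (char_poly A) 0 \<cdot>\<^sub>m 1\<^sub>m n)"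
    then have ij: "i < n" "j < n" by auto
    have "(A * adj_coeff A 0) $$ (i, j) = (\<Sum>l<n. A $$ (i, l) * coeff (?B $$ (l, j)) 0)"
      using A ij by (auto simp: adj_coeff_def scalar_prod_def atLeast0LessThan)
    also have "\<dots> = - (if i = j then coeff (char_poly A) 0 else 0)"
      using arg_cong[OF entry[OF ij], of "\<lambda>p. - coeff p 0"] by (auto simp: coeff_sum split: if_splits)
    finally show "(A * adj_coeff A 0) $$ (i, j) = (- coeff (char_poly A) 0 \<cdot>\<^sub>m 1\<^sub>m n) $$ (i, j)"
      using ij by auto
  qed (use A in \<open>auto simp: adj_coeff_def\<close>)
  show "adj_coeff A k = A * adj_coeff A (Suc k) + coeff (char_poly A) (Suc k) \<cdot>\<^sub>m 1\<^sub>m n"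
  proof (rule eq_matI)
    fix i j assume "i < dim_row (A * adj_coeff A (Suc k) + coeff (char_poly A) (Suc k) \<cdot>\<^sub>m 1\<^sub>m n)"
      "j < dim_col (A * adj_coeff A (Suc k) + coeff (char_poly A) (Suc k) \<cdot>\<^sub>m 1\<^sub>m n)"
    then have ij: "i < n" "j < n" by auto
    have "(A * adj_coeff A (Suc k)) $$ (i, j) = (\<Sum>l<n. A $$ (i, l) * coeff (?B $$ (l, j)) (Suc k))"
      using A ij by (auto simp: adj_coeff_def scalar_prod_def atLeast0LessThan)
    then show "adj_coeff A k $$ (i, j) = (A * adj_coeff A (Suc k) + coeff (char_poly A) (Suc k) \<cdot>\<^sub>m 1\<^sub>m n) $$ (i, j)"
      using arg_cong[OF entry[OF ij], of "\<lambda>p. coeff p (Suc k)"] A ij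
      by (auto simp: coeff_sum adj_coeff_def algebra_simps split: if_splits)
  qed (use A in \<open>auto simp: adj_coeff_def\<close>)
qed

text \<open>
  The coefficients vanish for large \<open>k\<close> because only finitely many polynomials are involved; the recursion
  carries this down to \<open>k = n\<close>.
\<close>

lemma adj_coeff_eq_0:
  fixes A :: "'a::field mat"
  assumes A: "A \<in> carrier_mat n n" and "n \<le> k"
  shows "adj_coeff A k = 0\<^sub>m n n"
proof -
  \<comment> \<open>\<open>N\<close> exceeds the degrees of all entries of the adjugate.\<close>
  define N where "N = Max (insert n ((\<lambda>(i, j). Suc (degree (adj_mat (char_poly_matrix A) $$ (i, j)))) ` ({..<n} \<times> {..<n})))"
  have big: "adj_coeff A m = 0\<^sub>m n n" if "N \<le> m" for m
  proof (rule eq_matI)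
    fix i j assume "i < dim_row (0\<^sub>m n n :: 'a mat)" "j < dim_col (0\<^sub>m n n :: 'a mat)"
    then have ij: "i < n" "j < n" by auto
    have "Suc (degree (adj_mat (char_poly_matrix A) $$ (i, j))) \<le> N"
      unfolding N_def using ij by (intro Max_ge) auto
    with that have "degree (adj_mat (char_poly_matrix A) $$ (i, j)) < m" by simp
    then show "adj_coeff A m $$ (i, j) = (0\<^sub>m n n) $$ (i, j)"
      using ij A by (simp add: adj_coeff_def coeff_eq_0)
  qed (use A in \<open>auto simp: adj_coeff_def\<close>)
  have down: "adj_coeff A m = 0\<^sub>m n n" if "n \<le> m" "adj_coeff A (Suc m) = 0\<^sub>m n n" for m
  proof -
    have "coeff (char_poly A) (Suc m) = 0"
      using that(1) degree_monic_char_poly[OF A] by (simp add: coeff_eq_0)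
    then show ?thesis
      unfolding adj_coeff_rec(2)[OF A, of m] using that(2) A by auto
  qed
  show ?thesis
  proof (cases "N \<le> k")
    case False
    then have "k \<le> N" by simp
    then show ?thesis using \<open>n \<le> k\<close>
    proof (induction rule: inc_induct)
      case base then show ?case by (simp add: big)
    next
      case (step m) then show ?case using down[of m] by simp
    qed
  qed (rule big)
qed

lemma square_mat_closed:
  "A \<in> carrier_mat n n \<Longrightarrow> B \<in> carrier_mat n n \<Longrightarrow> A * B \<in> carrier_mat n n"
  "A \<in> carrier_mat n n \<Longrightarrow> B \<in> carrier_mat n n \<Longrightarrow> A + B \<in> carrier_mat n n"
  "A \<in> carrier_mat n n \<Longrightarrow> B \<in> carrier_mat n n \<Longrightarrow> A - B \<in> carrier_mat n n"
  "A \<in> carrier_mat n n \<Longrightarrow> - A \<in> carrier_mat n n"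
  "A \<in> carrier_mat n n \<Longrightarrow> c \<cdot>\<^sub>m A \<in> carrier_mat n n"
  "A \<in> carrier_mat n n \<Longrightarrow> A ^\<^sub>m k \<in> carrier_mat n n"
  "A \<in> carrier_mat n n \<Longrightarrow> transpose_mat A \<in> carrier_mat n n"
  for A :: "'a::comm_ring_1 mat"
  by auto

lemma square_mat_algebra:
  fixes A B C :: "'a::comm_ring_1 mat"
  assumes "A \<in> carrier_mat n n" "B \<in> carrier_mat n n" "C \<in> carrier_mat n n"
  shows "A * B * C = A * (B * C)"
    "(A + B) * C = A * C + B * C" "A * (B + C) = A * B + A * C"
    "(A - B) * C = A * C - B * C" "A * (B - C) = A * B - A * C"
  using assms
  by (simp_all add: assoc_mult_mat[of A n n B n C n] add_mult_distrib_mat[of A n n B C n] mult_add_distrib_mat[of A n n B n C]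
      minus_mult_distrib_mat[of A n n B C n] mult_minus_distrib_mat[of A n n B n C])

lemma square_mat_scalar:
  fixes A B :: "'a::comm_ring_1 mat"
  assumes "A \<in> carrier_mat n n" "B \<in> carrier_mat n n"
  shows "(c \<cdot>\<^sub>m A) * B = c \<cdot>\<^sub>m (A * B)" "A * (c \<cdot>\<^sub>m B) = c \<cdot>\<^sub>m (A * B)"
    "(- A) * B = - (A * B)" "A * (- B) = - (A * B)"
  using assms by auto

lemma square_mat_units:
  fixes A :: "'a::comm_ring_1 mat"
  assumes "A \<in> carrier_mat n n"
  shows "A * 1\<^sub>m n = A" "1\<^sub>m n * A = A" "A * 0\<^sub>m n n = 0\<^sub>m n n" "0\<^sub>m n n * A = 0\<^sub>m n n"
    "A + 0\<^sub>m n n = A" "0\<^sub>m n n + A = A" "0 \<cdot>\<^sub>m A = 0\<^sub>m n n" "1 \<cdot>\<^sub>m A = A"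
  using assms by auto

lemmas square_mat_simps = square_mat_closed square_mat_algebra square_mat_scalar square_mat_units

lemma mult_pow_mat:
  assumes "A \<in> carrier_mat n n"
  shows "A * A ^\<^sub>m k = A ^\<^sub>m Suc k"
proof (induction k)
  case (Suc k)
  have "A * A ^\<^sub>m Suc k = A * A ^\<^sub>m k * A"
    using assms by (simp add: assoc_mult_mat[of _ n n _ n _ n])
  then show ?case using Suc by simp
qed (use assms in auto)

text \<open>
  The identity \<open>trace_adj_coeff\<close> determines \<open>p 6, p 5, p 4, p 2\<close> from the traces of powers, since their
  factors are invertible modulo 7. For \<open>p 3\<close> it gives only \<open>tr (A^4) = 3 p 3\<close>; here the trace of \<open>A\<close> times
  the Cayley-Hamilton equation helps. The coefficient \<open>p 1\<close> stays free as the \<open>c\<close> of the conclusion.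
\<close>

lemma char_poly_7:
  fixes A :: "'a::field mat"
  assumes A: "A \<in> carrier_mat 7 7" and char: "(7 :: 'a) = 0"
    and tr: "trace_mat A = 0" "trace_mat (A ^\<^sub>m 2) = 0" "trace_mat (A ^\<^sub>m 3) = 0" "trace_mat (A ^\<^sub>m 5) = 0"
      "trace_mat (A ^\<^sub>m 8) = 0"
    and det: "det A = 0"
  shows "\<exists>c. char_poly A = monom 1 7 + monom c 1 \<and> A ^\<^sub>m 7 = (- c) \<cdot>\<^sub>m A"
proof -
  define p where "p = coeff (char_poly A)"
  have p7: "p 7 = 1" and phigh: "\<And>k. k > 7 \<Longrightarrow> p k = 0"
    using degree_monic_char_poly[OF A] by (auto simp: p_def coeff_eq_0)
  have nz: "(2::'a) \<noteq> 0" "(3::'a) \<noteq> 0" "(4::'a) \<noteq> 0" "(5::'a) \<noteq> 0" "(6::'a) \<noteq> 0"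
  proof -
    have "(2::'a) * 4 = 7 + 1" "(3::'a) * 5 = 7 + 7 + 1" "(6::'a) * 6 = 7 + 7 + 7 + 7 + 7 + 1" by simp_all
    then show "(2::'a) \<noteq> 0" "(3::'a) \<noteq> 0" "(4::'a) \<noteq> 0" "(5::'a) \<noteq> 0" "(6::'a) \<noteq> 0"
      unfolding char by fastforce+
  qed
  note [simp] = A square_mat_simps[of _ 7] and [simp del] = pow_mat.simps
  note step = adj_coeff_rec(2)[OF A, folded p_def] and trB = trace_adj_coeff[OF A, folded p_def]
  have AP: "A * A ^\<^sub>m k = A ^\<^sub>m Suc k" for k by (rule mult_pow_mat[OF A])
  note trs = trace_mat_add[of _ 7] trace_mat_smult[of _ 7] trace_mat_one char
  have AA: "A * A = A ^\<^sub>m 2" by (simp add: numeral_2_eq_2 pow_mat.simps)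
  have B6: "adj_coeff A 6 = 1\<^sub>m 7"
    using step[of 6] adj_coeff_eq_0[OF A, of 7] by (simp add: p7)
  have B5: "adj_coeff A 5 = A + p 6 \<cdot>\<^sub>m 1\<^sub>m 7"
    using step[of 5] by (simp add: B6)
  have "p 6 = 0" using trB[of 5] nz unfolding B5 by (simp add: trs tr)
  with B5 have B5: "adj_coeff A 5 = A" by simp
  have B4: "adj_coeff A 4 = A ^\<^sub>m 2 + p 5 \<cdot>\<^sub>m 1\<^sub>m 7"
    using step[of 4] by (simp add: B5 AP AA numeral_2_eq_2 One_nat_def)
  have "p 5 = 0" using trB[of 4] nz unfolding B4 by (simp add: trs tr)
  with B4 have B4: "adj_coeff A 4 = A ^\<^sub>m 2" by simp
  have B3: "adj_coeff A 3 = A ^\<^sub>m 3 + p 4 \<cdot>\<^sub>m 1\<^sub>m 7"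
    using step[of 3] by (simp add: B4 AP)
  have "p 4 = 0" using trB[of 3] nz unfolding B3 by (simp add: trs tr)
  with B3 have B3: "adj_coeff A 3 = A ^\<^sub>m 3" by simp
  have B2: "adj_coeff A 2 = A ^\<^sub>m 4 + p 3 \<cdot>\<^sub>m 1\<^sub>m 7"
    using step[of 2] by (simp add: B3 AP)
  have tr4: "trace_mat (A ^\<^sub>m 4) = 3 * p 3"
    using trB[of 2] unfolding B2 by (simp add: trs tr)
  have B1: "adj_coeff A 1 = A ^\<^sub>m 5 + p 3 \<cdot>\<^sub>m A + p 2 \<cdot>\<^sub>m 1\<^sub>m 7"
    using step[of 1] by (simp add: B2 AP
        flip: numeral_2_eq_2)
  have "p 2 = 0" using trB[of 1] nz unfolding B1 by (simp add: trs tr flip: numeral_2_eq_2)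
  with B1 have B1: "adj_coeff A 1 = A ^\<^sub>m 5 + p 3 \<cdot>\<^sub>m A" by simp
  have B0: "adj_coeff A 0 = A ^\<^sub>m 6 + p 3 \<cdot>\<^sub>m A ^\<^sub>m 2 + p 1 \<cdot>\<^sub>m 1\<^sub>m 7"
    using step[of 0] by (simp add: B1[simplified] AP AA flip: numeral_2_eq_2)
  have p0: "p 0 = 0"
  proof -
    have "det (A * adj_coeff A 0) = 0"
      using det by (simp add: det_mult[of _ 7])
    then have "det (- p 0 \<cdot>\<^sub>m 1\<^sub>m 7) = 0"
      using adj_coeff_rec(1)[OF A] by (simp add: p_def)
    then show ?thesis by simp
  qed
  have CH: "A ^\<^sub>m 7 + p 3 \<cdot>\<^sub>m A ^\<^sub>m 3 + p 1 \<cdot>\<^sub>m A = 0\<^sub>m 7 7"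
  proof -
    have "A * adj_coeff A 0 = 0\<^sub>m 7 7"
      using adj_coeff_rec(1)[OF A] p0 by (auto simp: p_def)
    then show ?thesis
      by (simp add: B0 AP)
  qed
  \<comment> \<open>The trace of this equation is \<open>tr (A^4) p 3 = 3 (p 3)^2\<close>, all other traces being zero.\<close>
  have "A * (A ^\<^sub>m 7 + p 3 \<cdot>\<^sub>m A ^\<^sub>m 3 + p 1 \<cdot>\<^sub>m A) = 0\<^sub>m 7 7"
    unfolding CH by simp
  then have "A ^\<^sub>m 8 + p 3 \<cdot>\<^sub>m A ^\<^sub>m 4 + p 1 \<cdot>\<^sub>m A ^\<^sub>m 2 = 0\<^sub>m 7 7"
    by (simp add: AP AA
        flip: numeral_2_eq_2)
  then have "trace_mat (A ^\<^sub>m 8 + p 3 \<cdot>\<^sub>m A ^\<^sub>m 4 + p 1 \<cdot>\<^sub>m A ^\<^sub>m 2) = 0"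
    by (simp add: trace_mat_def)
  then have "p 3 = 0" using nz by (simp add: trs tr tr4)
  with CH have CH: "A ^\<^sub>m 7 + p 1 \<cdot>\<^sub>m A = 0\<^sub>m 7 7" by simp
  have "A ^\<^sub>m 7 = (- p 1) \<cdot>\<^sub>m A"
  proof (rule eq_matI)
    fix i j assume "i < dim_row (- p 1 \<cdot>\<^sub>m A)" "j < dim_col (- p 1 \<cdot>\<^sub>m A)"
    then have ij: "i < 7" "j < 7" using A by auto
    have "(A ^\<^sub>m 7 + p 1 \<cdot>\<^sub>m A) $$ (i, j) = 0" unfolding CH using ij by simp
    then show "(A ^\<^sub>m 7) $$ (i, j) = (- p 1 \<cdot>\<^sub>m A) $$ (i, j)"
      using ij carrier_matD[OF A] by (simp add: eq_neg_iff_add_eq_0)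
  qed auto
  moreover have "char_poly A = monom 1 7 + monom (p 1) 1"
  proof (rule poly_eqI)
    fix k :: nat
    consider "k < 7" | "k = 7" | "k > 7" by linarith
    then show "coeff (char_poly A) k = coeff (monom 1 7 + monom (p 1) 1) k"
    proof cases
      case 1
      then have "k \<in> {0, 1, 2, 3, 4, 5, 6}" by auto
      then show ?thesis
        using \<open>p 6 = 0\<close> \<open>p 5 = 0\<close> \<open>p 4 = 0\<close> \<open>p 3 = 0\<close> \<open>p 2 = 0\<close> p0 by (auto simp: p_def)
    qed (use p7 phigh in \<open>auto simp: p_def\<close>)
  qed
  ultimately show ?thesis by blast
qed

text \<open>
  If \<open>G\<close> is the matrix of a nondegenerate form for which \<open>H\<close> is skew, then \<open>G H^k = (-1)^k (H^k)^T G\<close>. So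
  \<open>H^k\<close> is conjugate to minus its transpose when \<open>k\<close> is odd.
\<close>

lemma trace_pow_odd:
  fixes H :: "'a::field mat"
  assumes H: "H \<in> carrier_mat n n" and G: "G \<in> carrier_mat n n" and G': "G' \<in> carrier_mat n n"
    and inv: "G * G' = 1\<^sub>m n" "G' * G = 1\<^sub>m n" and skew: "G * H = - (transpose_mat H * G)"
    and "odd k" "(2::'a) \<noteq> 0"
  shows "trace_mat (H ^\<^sub>m k) = 0"
proof -
  have P: "H ^\<^sub>m k \<in> carrier_mat n n" "transpose_mat (H ^\<^sub>m k) \<in> carrier_mat n n" for k
    using H by auto
  have HT: "transpose_mat H \<in> carrier_mat n n" using H by auto
  have GH: "G * H ^\<^sub>m k = (- 1) ^ k \<cdot>\<^sub>m (transpose_mat (H ^\<^sub>m k) * G)" for k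
  proof (induction k)
    case 0
    show ?case using G H by (intro eq_matI) auto
  next
    case (Suc k)
    have tr: "transpose_mat (H ^\<^sub>m Suc k) = transpose_mat (H ^\<^sub>m k) * transpose_mat H"
      unfolding mult_pow_mat[OF H, symmetric] by (rule transpose_mult[OF H P(1)])
    have "G * H ^\<^sub>m Suc k = G * H ^\<^sub>m k * H"
      by (simp add: square_mat_algebra(1)[OF G P(1) H])
    also have "\<dots> = (- 1) ^ k \<cdot>\<^sub>m (transpose_mat (H ^\<^sub>m k) * G) * H"
      by (simp only: Suc)
    also have "\<dots> = (- 1) ^ k \<cdot>\<^sub>m (transpose_mat (H ^\<^sub>m k) * (G * H))"
      by (simp add: square_mat_scalar(1)[OF square_mat_closed(1)[OF P(2) G] H] square_mat_algebra(1)[OF P(2) G H])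
    also have "\<dots> = (- 1) ^ k \<cdot>\<^sub>m (- (transpose_mat (H ^\<^sub>m k) * (transpose_mat H * G)))"
      by (simp only: skew square_mat_scalar(4)[OF P(2) square_mat_closed(1)[OF HT G]])
    also have "\<dots> = (- 1) ^ Suc k \<cdot>\<^sub>m (transpose_mat (H ^\<^sub>m k) * (transpose_mat H * G))"
      by (rule eq_matI) auto
    also have "transpose_mat (H ^\<^sub>m k) * (transpose_mat H * G) = transpose_mat (H ^\<^sub>m Suc k) * G"
      unfolding tr by (simp only: square_mat_algebra(1)[OF P(2) HT G])
    finally show ?case .
  qed
  have "G' * (G * H ^\<^sub>m k) = H ^\<^sub>m k"
    using left_mult_one_mat[OF P(1)] by (simp only: square_mat_algebra(1)[OF G' G P(1), symmetric] inv)
  then have "trace_mat (H ^\<^sub>m k) = trace_mat (G' * (G * H ^\<^sub>m k))" by simp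
  also have "\<dots> = trace_mat (G * H ^\<^sub>m k * G')"
    by (rule trace_mat_comm[OF G' square_mat_closed(1)[OF G P(1)]])
  also have "G * H ^\<^sub>m k * G' = (- 1) ^ k \<cdot>\<^sub>m transpose_mat (H ^\<^sub>m k)"
    using right_mult_one_mat[OF P(2)]
    by (simp only: GH square_mat_scalar(1)[OF square_mat_closed(1)[OF P(2) G] G'] square_mat_algebra(1)[OF P(2) G G'] inv)
  also have "trace_mat ((- 1) ^ k \<cdot>\<^sub>m transpose_mat (H ^\<^sub>m k)) = - trace_mat (H ^\<^sub>m k)"
    using \<open>odd k\<close> by (simp add: trace_mat_smult[OF P(2)] trace_mat_transpose[OF P(1)])
  finally have "trace_mat (H ^\<^sub>m k) + trace_mat (H ^\<^sub>m k) = 0" by (simp only: eq_neg_iff_add_eq_0)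
  then have "2 * trace_mat (H ^\<^sub>m k) = 0" by (simp only: mult_2)
  then show ?thesis using \<open>(2::'a) \<noteq> 0\<close> by simp
qed

text \<open>
  The matrices are those of \<open>E_0, E_1 = H, E_2, E_3\<close> on the elements of trace zero, and \<open>G\<close> is the Gram matrix
  of the norm. Odd powers of \<open>H\<close> have trace zero by skewness. For \<open>H^2\<close> and \<open>H^8\<close> one writes one factor
  as \<open>2 H = [E_0, E_2]\<close> and uses cyclicity of the trace; for \<open>H^2\<close> this leaves \<open>tr (E_0 E_2)\<close>, which
  vanishes as \<open>3 E_2 = [E_0, E_3]\<close>. With \<open>char_poly_7\<close> this gives \<open>H^7 = - c H\<close>, and
  \<open>c = -1\<close> follows by comparing the commutators of \<open>H\<close> and \<open>H^7\<close> with \<open>E_2\<close>.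
\<close>

lemma char_poly_toral:
  fixes H :: "'a::field mat"
  assumes car: "H \<in> carrier_mat 7 7" "G \<in> carrier_mat 7 7" "G' \<in> carrier_mat 7 7" "E0 \<in> carrier_mat 7 7"
      "E2 \<in> carrier_mat 7 7" "E3 \<in> carrier_mat 7 7"
    and char: "(7 :: 'a) = 0"
    and inv: "G * G' = 1\<^sub>m 7" "G' * G = 1\<^sub>m 7" and skew: "G * H = - (transpose_mat H * G)"
    and br12: "H * E2 - E2 * H = E2"
    and br02: "E0 * E2 - E2 * E0 = 2 \<cdot>\<^sub>m H" and br03: "E0 * E3 - E3 * E0 = 3 \<cdot>\<^sub>m E2"
    and pow: "H ^\<^sub>m 7 * E2 - E2 * H ^\<^sub>m 7 = E2" and ne: "E2 \<noteq> 0\<^sub>m 7 7"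
  shows "char_poly H = monom 1 7 - monom 1 1"
proof -
  have nz: "(2::'a) \<noteq> 0" "(3::'a) \<noteq> 0"
  proof -
    have "(2::'a) * 4 = 7 + 1" "(3::'a) * 5 = 7 + 7 + 1" by simp_all
    then show "(2::'a) \<noteq> 0" "(3::'a) \<noteq> 0" unfolding char by fastforce+
  qed
  note [simp] = car square_mat_simps[of _ 7] and [simp del] = pow_mat.simps
  note as = trace_mat_minus[of _ 7] trace_mat_smult[of _ 7]
  have odd: "trace_mat (H ^\<^sub>m k) = 0" if "odd k" for k
    by (rule trace_pow_odd[of H 7 G G']) (use that nz inv skew in auto)
  have t20: "trace_mat (E2 * E0) = 0"
  proof -
    have "trace_mat ((E0 * E3 - E3 * E0) * E0) = trace_mat (E0 * (E3 * E0)) - trace_mat ((E3 * E0) * E0)"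
      by (simp add: as)
    also have "\<dots> = 0" by (subst trace_mat_comm[of E0 7 "E3 * E0"]) auto
    finally have "3 * trace_mat (E2 * E0) = 0"
      unfolding br03 by (simp add: as)
    then show ?thesis using nz by simp
  qed
  have t2: "trace_mat (H * H) = 0"
  proof -
    have "2 * trace_mat (H * H) = trace_mat ((E0 * E2 - E2 * E0) * H)"
      unfolding br02 by (simp add: as)
    also have "\<dots> = trace_mat (E0 * (E2 * H)) - trace_mat (E2 * (E0 * H))" by (simp add: as)
    also have "trace_mat (E2 * (E0 * H)) = trace_mat (E0 * (H * E2))"
      by (subst trace_mat_comm[of E2 7]) (auto simp: as)
    also have "trace_mat (E0 * (E2 * H)) - trace_mat (E0 * (H * E2)) = - trace_mat (E0 * (H * E2 - E2 * H))"
      by (simp add: as)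
    also have "\<dots> = 0" unfolding br12 using t20 trace_mat_comm[of E0 7 E2] by simp
    finally show ?thesis using nz by simp
  qed
  define D where "D = H ^\<^sub>m 7 - H"
  have [simp]: "D \<in> carrier_mat 7 7" by (simp add: D_def)
  \<comment> \<open>\<open>H\<close> and \<open>H^7\<close> have the same commutator with \<open>E_2\<close>.\<close>
  have D2: "D * E2 = E2 * D"
  proof (rule eq_matI)
    fix i j assume "i < dim_row (E2 * D)" "j < dim_col (E2 * D)"
    then have ij: "i < 7" "j < 7" using car by (auto simp: D_def)
    have 1: "(H ^\<^sub>m 7 * E2 - E2 * H ^\<^sub>m 7) $$ (i, j) = (H * E2 - E2 * H) $$ (i, j)"
      unfolding pow br12 ..
    have a: "(D * E2) $$ (i, j) = (H ^\<^sub>m 7 * E2) $$ (i, j) - (H * E2) $$ (i, j)"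
      using ij carrier_matD[OF car(1)] carrier_matD[OF car(5)] by (simp add: D_def as del: index_mult_mat(1))
    have b: "(E2 * D) $$ (i, j) = (E2 * H ^\<^sub>m 7) $$ (i, j) - (E2 * H) $$ (i, j)"
      using ij carrier_matD[OF car(1)] carrier_matD[OF car(5)] by (simp add: D_def as del: index_mult_mat(1))
    have c: "(H ^\<^sub>m 7 * E2) $$ (i, j) - (E2 * H ^\<^sub>m 7) $$ (i, j) = (H * E2) $$ (i, j) - (E2 * H) $$ (i, j)"
      using 1 ij carrier_matD[OF car(1)] carrier_matD[OF car(5)] by (simp del: index_mult_mat(1))
    have "(D * E2) $$ (i, j) - (E2 * D) $$ (i, j)
        = ((H ^\<^sub>m 7 * E2) $$ (i, j) - (E2 * H ^\<^sub>m 7) $$ (i, j)) - ((H * E2) $$ (i, j) - (E2 * H) $$ (i, j))"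
      unfolding a b by (simp only: algebra_simps)
    then show "(D * E2) $$ (i, j) = (E2 * D) $$ (i, j)" unfolding c by simp
  qed (use carrier_matD[OF car(1)] carrier_matD[OF car(5)] in \<open>auto simp: D_def\<close>)
  have "2 * trace_mat (H * D) = trace_mat ((E0 * E2 - E2 * E0) * D)"
    unfolding br02 by (simp add: as)
  also have "\<dots> = trace_mat (E0 * (E2 * D)) - trace_mat (E2 * (E0 * D))" by (simp add: as)
  also have "trace_mat (E2 * (E0 * D)) = trace_mat (E0 * (D * E2))"
    by (subst trace_mat_comm[of E2 7]) (auto simp: as)
  finally have "trace_mat (H * D) = 0" using nz by (simp add: D2)
  then have "trace_mat (H * H ^\<^sub>m 7) = 0"
    using t2 by (simp add: D_def as)
  then have t8: "trace_mat (H ^\<^sub>m 8) = 0"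
    by (simp add: mult_pow_mat[of _ 7])
  \<comment> \<open>\<open>H\<close> is skew for a nondegenerate form in odd dimension.\<close>
  have det0: "det H = 0"
  proof -
    have "det (G * H) = det (- (transpose_mat H * G))" unfolding skew ..
    also have "- (transpose_mat H * G) = (- 1) \<cdot>\<^sub>m (transpose_mat H * G)" by (rule eq_matI) auto
    finally have "det G * det H = - (det H * det G)"
      using carrier_matD[OF car(2)] by (simp add: det_mult[of _ 7] det_transpose[of _ 7])
    then have "det G * det H + det G * det H = 0" by (simp only: eq_neg_iff_add_eq_0 mult.commute)
    then have "2 * (det G * det H) = 0" by (simp only: mult_2)
    moreover have "det G \<noteq> 0"
    proof -
      have "det G * det G' = 1" using det_mult[of G 7 G'] inv by simp
      then show ?thesis by auto
    qed
    ultimately show ?thesis using nz by simp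
  qed
  have "H ^\<^sub>m 2 = H * H" by (simp add: numeral_2_eq_2 pow_mat.simps)
  with t2 have "trace_mat (H ^\<^sub>m 2) = 0" by simp
  moreover have "trace_mat H = 0" using odd[of 1] by (simp add: pow_mat.simps)
  ultimately obtain c where c: "char_poly H = monom 1 7 + monom c 1" "H ^\<^sub>m 7 = (- c) \<cdot>\<^sub>m H"
    using char_poly_7[OF car(1) char _ _ odd odd t8 det0] by fastforce
  have "(- c) \<cdot>\<^sub>m (H * E2) - (- c) \<cdot>\<^sub>m (E2 * H) = (- c) \<cdot>\<^sub>m (H * E2 - E2 * H)"
    using carrier_matD[OF car(1)] carrier_matD[OF car(5)] by (intro eq_matI) (auto simp: right_diff_distrib)
  then have "E2 = (- c) \<cdot>\<^sub>m (H * E2 - E2 * H)"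
    using pow unfolding c(2) by simp
  then have e: "E2 = (- c) \<cdot>\<^sub>m E2" unfolding br12 .
  have "c = - 1"
  proof (rule ccontr)
    assume "c \<noteq> - 1"
    have "E2 $$ (i, j) = 0" if "i < 7" "j < 7" for i j
    proof -
      have "E2 $$ (i, j) = - c * E2 $$ (i, j)"
        using arg_cong[OF e, of "\<lambda>M. M $$ (i, j)"] that carrier_matD[OF car(5)] by simp
      then have "E2 $$ (i, j) + c * E2 $$ (i, j) = 0"
        by (simp only: mult_minus_left eq_neg_iff_add_eq_0)
      then have "(1 + c) * E2 $$ (i, j) = 0" by (simp only: distrib_right mult_1)
      with \<open>c \<noteq> - 1\<close> show ?thesis by (auto simp: add_eq_0_iff)
    qed
    then have "E2 = 0\<^sub>m 7 7" using carrier_matD[OF car(5)] by (intro eq_matI) auto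
    with ne show False ..
  qed
  then show ?thesis unfolding c(1) by (simp add: minus_monom[symmetric])
qed

section \<open>Identities in Cayley algebras\<close>

context nonassoc_algebra
begin

lemma mul_zero_left: "mul 0 x = 0" using mult_scale_left[of 0 0 x] by simp
lemma mul_zero_right: "mul x 0 = 0" using mult_scale_right[of x 0 0] by simp
lemma mul_minus_left: "mul (- x) y = - mul x y"
  using mult_add_left[of x "- x" y] by (simp add: mul_zero_left eq_neg_iff_add_eq_0 add.commute)
lemma mul_minus_right: "mul x (- y) = - mul x y"
  using mult_add_right[of x y "- y"] by (simp add: mul_zero_right eq_neg_iff_add_eq_0 add.commute)
lemma mul_diff_left: "mul (x - y) z = mul x z - mul y z"
  using mult_add_left[of x "- y" z] by (simp add: mul_minus_left)
lemma mul_diff_right: "mul x (y - z) = mul x y - mul x z"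
  using mult_add_right[of x y "- z"] by (simp add: mul_minus_right)

lemmas mul_simps = mult_add_left mult_add_right mul_diff_left mul_diff_right mul_minus_left mul_minus_right
  mult_scale_left mult_scale_right mul_zero_left mul_zero_right

end

context cayley_algebra
begin

lemma polar_commute: "polar norm x y = polar norm y x"
  by (simp add: polar_def add.commute)

lemma norm_scale: "norm (scale c x) = c\<^sup>2 * norm x"
  using norm_quadratic by (simp add: quadratic_form_def)

lemma polar_linear:
  "Vector_Spaces.linear scale (*) (\<lambda>x. polar norm x y)" "Vector_Spaces.linear scale (*) (\<lambda>y. polar norm x y)"
  using norm_quadratic by (simp_all add: quadratic_form_def)

lemma polar_add_left: "polar norm (x + x') y = polar norm x y + polar norm x' y"
  using polar_linear(1)[of y] by (simp add: Vector_Spaces.linear_iff)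

lemma polar_scale_left: "polar norm (scale c x) y = c * polar norm x y"
  using polar_linear(1)[of y] by (simp add: Vector_Spaces.linear_iff)

lemma polar_add_right: "polar norm y (x + x') = polar norm y x + polar norm y x'"
  using polar_linear(2)[of y] by (simp add: Vector_Spaces.linear_iff)

lemma polar_scale_right: "polar norm y (scale c x) = c * polar norm y x"
  using polar_linear(2)[of y] by (simp add: Vector_Spaces.linear_iff)

lemma polar_zero_left: "polar norm 0 y = 0"
  using polar_scale_left[of 0 0 y] by simp

lemma polar_minus_left: "polar norm (- x) y = - polar norm x y"
  using polar_add_left[of x "- x" y] by (simp add: polar_zero_left eq_neg_iff_add_eq_0 add.commute)

lemma polar_diff_left: "polar norm (x - x') y = polar norm x y - polar norm x' y"
  using polar_add_left[of x "- x'" y] by (simp add: polar_minus_left)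

lemma polar_minus_right: "polar norm y (- x) = - polar norm y x"
  using polar_minus_left[of x y] by (simp add: polar_commute)

lemma polar_diff_right: "polar norm y (x - x') = polar norm y x - polar norm y x'"
  using polar_diff_left[of x x' y] by (simp add: polar_commute)

lemma polar_zero_right: "polar norm y 0 = 0"
  by (subst polar_commute) (rule polar_zero_left)

lemmas polar_simps = polar_add_left polar_add_right polar_diff_left polar_diff_right polar_minus_left
  polar_minus_right polar_scale_left polar_scale_right polar_zero_left polar_zero_right

lemma norm_add: "norm (x + y) = norm x + norm y + polar norm x y"
  by (simp add: polar_def)

lemma norm_zero: "norm 0 = 0"
  using norm_scale[of 0 0] by simp

lemma polar_self: "polar norm x x = 2 * norm x"
proof -
  have "x + x = scale 2 x" by (simp flip: scale_left_distrib[of 1 1 x, simplified])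
  then show ?thesis by (simp add: polar_def norm_scale)
qed

lemma polar_eqI: "(\<And>z. polar norm x z = polar norm y z) \<Longrightarrow> x = y"
  using norm_nondegenerate[of "x - y"] by (simp add: polar_diff_left)

text \<open>
  The locale asserts the existence of a unit without naming it.
\<close>

definition one :: 'a where "one = (SOME e. \<forall>x. mul e x = x \<and> mul x e = x)"

lemma one_mul [simp]: "mul one x = x" and mul_one [simp]: "mul x one = x"
  using someI_ex[OF unital] by (simp_all add: one_def)

lemma span_ne_UNIV:
  assumes "finite A" "card A < 8"
  shows "span A \<noteq> UNIV"
proof
  assume "span A = UNIV"
  then have "dim UNIV \<le> card A" using dim_le_card[of UNIV A] assms(1) by simp
  then show False using dim_8 assms(2) by simp
qed

lemma norm_one: "norm one = 1"
proof -
  have "\<exists>x. norm x \<noteq> 0"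
  proof (rule ccontr)
    assume "\<nexists>x. norm x \<noteq> 0"
    then have "polar norm x y = 0" for x y :: 'a by (simp add: polar_def)
    then have "x = 0" for x :: 'a using norm_nondegenerate[of x] by simp
    then have "span {} = UNIV" by auto
    with span_ne_UNIV[of "{}"] show False by simp
  qed
  then obtain x where "norm x \<noteq> 0" by blast
  with norm_mult[of one x] show ?thesis by simp
qed

lemma polar_one_one: "polar norm one one = 2"
  by (simp add: polar_self norm_one)

lemma polar_mul_left: "polar norm (mul x y) (mul x z) = norm x * polar norm y z"
  by (simp add: polar_def norm_mult algebra_simps flip: mult_add_right)

lemma polar_mul_right: "polar norm (mul x y) (mul z y) = polar norm x z * norm y"
  by (simp add: polar_def norm_mult algebra_simps flip: mult_add_left)

text \<open>
  Linearization of \<open>polar_mul_left\<close> in the left factor.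
\<close>

lemma polar_exchange:
  "polar norm (mul x y) (mul z w) + polar norm (mul z y) (mul x w) = polar norm x z * polar norm y w"
  using polar_mul_left[of "x + z" y w]
  by (simp add: mult_add_left polar_add_left polar_add_right polar_mul_left norm_add algebra_simps)

text \<open>
  The standard involution. Multiplication by \<open>conj x\<close> is adjoint to multiplication by \<open>x\<close> (\<open>polar_adjoint_left\<close>,
  \<open>polar_adjoint_right\<close>); together with nondegeneracy this gives the identities below.
\<close>

definition conj :: "'a \<Rightarrow> 'a" where "conj x = scale (polar norm x one) one - x"

lemma conj_add: "conj (x + y) = conj x + conj y"
  by (simp add: conj_def polar_add_left scale_left_distrib)
lemma conj_scale: "conj (scale c x) = scale c (conj x)"
  by (simp add: conj_def polar_scale_left scale_right_diff_distrib)
lemma polar_conj_one: "polar norm (conj x) one = polar norm x one"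
  by (simp add: conj_def polar_diff_left polar_scale_left polar_one_one)
lemma conj_conj [simp]: "conj (conj x) = x"
proof -
  have "conj (conj x) = scale (polar norm (conj x) one) one - conj x" by (rule conj_def)
  also have "\<dots> = x" unfolding polar_conj_one by (simp add: conj_def)
  finally show ?thesis .
qed

lemma polar_adjoint_left: "polar norm (mul x y) z = polar norm y (mul (conj x) z)"
  using polar_exchange[of x y one z]
  by (simp add: conj_def mul_simps polar_simps algebra_simps)

lemma polar_adjoint_right: "polar norm (mul x y) z = polar norm x (mul z (conj y))"
  using polar_exchange[of x y z one] polar_commute[of "mul z y" x] polar_commute[of one y]
  by (simp add: conj_def mul_simps polar_simps algebra_simps)

lemma polar_conj_conj: "polar norm (conj x) (conj y) = polar norm x y"
proof -
  have "polar norm (conj x) (conj y) = polar norm (mul (conj x) y) one"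
    using polar_adjoint_right[of "conj x" y one] by simp
  also have "\<dots> = polar norm y x" using polar_adjoint_left[of "conj x" y one] by simp
  finally show ?thesis by (simp add: polar_commute)
qed

lemma conj_mul_mul: "mul (conj x) (mul x y) = scale (norm x) y"
proof (rule polar_eqI)
  fix z
  have "polar norm (mul (conj x) (mul x y)) z = polar norm (mul x y) (mul x z)"
    using polar_adjoint_left[of "conj x" "mul x y" z] by simp
  then show "polar norm (mul (conj x) (mul x y)) z = polar norm (scale (norm x) y) z"
    by (simp add: polar_mul_left polar_scale_left)
qed

lemma mul_mul_conj: "mul (mul y x) (conj x) = scale (norm x) y"
proof (rule polar_eqI)
  fix z
  have "polar norm (mul (mul y x) (conj x)) z = polar norm (mul y x) (mul z x)"
    using polar_adjoint_right[of "mul y x" "conj x" z] by simp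
  then show "polar norm (mul (mul y x) (conj x)) z = polar norm (scale (norm x) y) z"
    by (simp add: polar_mul_right polar_scale_left mult.commute)
qed

lemma norm_conj: "norm (conj x) = norm x"
  by (simp add: conj_def norm_add[of _ "- x", simplified] polar_simps norm_scale norm_one
      polar_commute[of one x] power2_eq_square norm_scale[of "- 1" x, simplified])

lemma mul_conj_mul: "mul x (mul (conj x) y) = scale (norm x) y"
  using conj_mul_mul[of "conj x" y] by (simp add: norm_conj)

lemma mul_conj_linearized: "mul x (mul (conj y) z) + mul y (mul (conj x) z) = scale (polar norm x y) z"
  using mul_conj_mul[of "x + y" z]
  by (simp add: conj_add mult_add_left mult_add_right mul_conj_mul norm_add scale_left_distrib algebra_simps)

lemma mul_mul_conj_linearized: "mul (mul z (conj y)) x + mul (mul z (conj x)) y = scale (polar norm x y) z"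
  using mul_mul_conj[of z "conj (x + y)"] mul_mul_conj[of z "conj x"] mul_mul_conj[of z "conj y"]
  by (simp add: norm_conj polar_conj_conj conj_add mult_add_left mult_add_right norm_add scale_left_distrib algebra_simps)

lemma conj_self: "mul x (conj x) = scale (norm x) one" "mul (conj x) x = scale (norm x) one"
  using mul_conj_mul[of x one] conj_mul_mul[of x one] by simp_all

lemma mul_self: "mul x x = scale (polar norm x one) x - scale (norm x) one"
  using conj_self(1)[of x] by (simp add: conj_def mul_simps algebra_simps)

lemma conj_mul: "conj (mul x y) = mul (conj y) (conj x)"
proof (rule polar_eqI)
  fix z
  have "polar norm (conj (mul x y)) z = polar norm (mul x y) (conj z)"
    using polar_conj_conj[of "mul x y" "conj z"] by simp
  also have "\<dots> = polar norm x (mul (conj z) (conj y))" by (rule polar_adjoint_right)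
  also have "\<dots> = polar norm (conj y) (mul z x)"
    using polar_adjoint_left[of "conj z" "conj y" x] by (simp add: polar_commute)
  also have "\<dots> = polar norm (mul (conj y) (conj x)) z"
    using polar_adjoint_right[of "conj y" "conj x" z] by simp
  finally show "polar norm (conj (mul x y)) z = polar norm (mul (conj y) (conj x)) z" .
qed

text \<open>
  If \<open>w\<close> is orthogonal to a subalgebra \<open>B\<close> containing the unit, then this lemma and the next three give the
  products in \<open>B + B w\<close>: they are the Cayley-Dickson rules. They are stated for single elements, with just the
  orthogonality relations that their proofs need.
\<close>

lemma doubling_swap:
  assumes "polar norm w one = 0" "polar norm a w = 0"
  shows "mul a w = mul w (conj a)"
proof -
  have cw: "conj w = - w" using assms(1) by (simp add: conj_def)
  have "mul w (conj a) - mul a w = 0"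
    using mul_conj_linearized[of a w one] assms(2) unfolding cw by (simp add: mul_simps)
  then show ?thesis by simp
qed

lemma doubling_left:
  assumes w: "polar norm w one = 0" and "polar norm a w = 0" "polar norm b w = 0" "polar norm (mul b a) w = 0"
  shows "mul a (mul b w) = mul (mul b a) w"
proof -
  have cw: "conj w = - w" using w by (simp add: conj_def)
  have "mul a (mul b w) = mul a (mul w (conj b))" using doubling_swap[OF w] assms(3) by simp
  also have "\<dots> = mul w (mul (conj a) (conj b))"
    using mul_conj_linearized[of a w "conj b"] assms(2) cw by (simp add: mul_simps algebra_simps)
  also have "\<dots> = mul w (conj (mul b a))" by (simp add: conj_mul)
  also have "\<dots> = mul (mul b a) w" using doubling_swap[OF w] assms(4) by simp
  finally show ?thesis .
qed

lemma doubling_right: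
  assumes w: "polar norm w one = 0" and "polar norm b w = 0"
  shows "mul (mul a w) b = mul (mul a (conj b)) w"
proof -
  have cw: "conj w = - w" using w by (simp add: conj_def)
  then show ?thesis
    using mul_mul_conj_linearized[of a w b] assms(2) by (simp add: mul_simps algebra_simps)
qed

lemma doubling_mul:
  assumes w: "polar norm w one = 0" and aw: "polar norm a w = 0" and bw: "polar norm b w = 0"
    and abw: "polar norm (mul a b) w = 0"
  shows "mul (mul a w) (mul b w) = scale (- norm w) (mul (conj b) a)"
proof -
  have cw: "conj w = - w" using w by (simp add: conj_def)
  let ?z = "conj b"
  have "polar norm (conj a) w = 0"
    using polar_conj_conj[of "conj a" w] cw by (simp add: polar_minus_right aw)
  then have "polar norm (mul a w) one = 0"
    using polar_adjoint_left[of a w one] by (simp add: polar_commute)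
  then have caw: "conj (mul a w) = - mul a w" by (simp add: conj_def)
  have paw: "polar norm (mul a w) w = norm w * polar norm a one"
    using polar_mul_right[of a w one] by (simp add: mult.commute)
  have zw: "mul (mul a w) ?z = mul w (mul ?z (conj a))"
  proof -
    have "polar norm ?z w = 0"
      using polar_conj_conj[of ?z w] cw by (simp add: polar_minus_right bw)
    then have "mul (mul a w) ?z = mul (mul a b) w" using doubling_right[OF w] by simp
    also have "\<dots> = mul w (conj (mul a b))" using doubling_swap[OF w abw] .
    finally show ?thesis by (simp add: conj_mul)
  qed
  have ww: "mul w (mul w x) = - scale (norm w) x" for x
    using conj_mul_mul[of w x] cw by (simp add: mul_simps neg_equal_iff_equal flip: minus_equation_iff)
  have "mul (mul a w) (mul b w) = mul (mul a w) (mul w ?z)"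
    using doubling_swap[OF w bw] by simp
  also have "\<dots> = - scale (norm w * polar norm a one) ?z - mul w (mul (mul a w) ?z)"
  proof -
    have "- mul (mul a w) (mul w ?z) - mul w (mul (mul a w) ?z) = scale (norm w * polar norm a one) ?z"
      using mul_conj_linearized[of "mul a w" w ?z] by (simp add: cw caw paw mul_simps)
    from this[symmetric] show ?thesis by simp
  qed
  also have "\<dots> = scale (- norm w) (scale (polar norm a one) ?z - mul ?z (conj a))"
    unfolding zw ww by (simp add: scale_right_diff_distrib)
  also have "scale (polar norm a one) ?z - mul ?z (conj a) = mul ?z a"
    by (simp add: conj_def[of a] mul_simps)
  finally show ?thesis .
qed

text \<open>
  \<open>p\<close> behaves like an orthogonal projection. If the norm vanished on its image, that image would be orthogonal to
  everything.
\<close>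

lemma nonisotropic_image:
  assumes p: "\<And>x y. p (x + y) = p x + p y" and b: "\<And>x y. polar norm (p x) (p y) = polar norm (p x) y"
    and ne: "p x \<noteq> 0"
  shows "\<exists>x. norm (p x) \<noteq> 0"
proof (rule ccontr)
  assume "\<nexists>x. norm (p x) \<noteq> 0"
  then have "polar norm (p x) (p y) = 0" for x y by (simp add: polar_def flip: p)
  with b norm_nondegenerate[of "p x"] ne show False by simp
qed

end

section \<open>Arithmetic modulo 7\<close>

lemma of_int_char7:
  assumes "(7 :: 'f::field) = 0" "(a - b) mod 7 = 0"
  shows "(of_int a :: 'f) = of_int b"
proof -
  obtain k where "a - b = 7 * k" using assms(2) by auto
  then have "(of_int (a - b) :: 'f) = of_int (7 * k)" by simp
  then show ?thesis using assms(1) by simp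
qed

text \<open>
  Rewrite rules that bring numerals of a field of characteristic 7 into the range from \<open>-3\<close> to \<open>3\<close>. The last
  eight reduce the number with binary digits \<open>8 k + d\<close> to \<open>k + d\<close>, written with a remainder of least absolute value.
\<close>

lemma char7_numerals:
  assumes char: "(7 :: 'f::field) = 0"
  shows "(4 :: 'f) = - 3" "(5 :: 'f) = - 2" "(6 :: 'f) = - 1" "(7 :: 'f) = 0"
    "(numeral (num.Bit0 (num.Bit0 (num.Bit0 k))) :: 'f) = numeral k"
    "(numeral (num.Bit1 (num.Bit0 (num.Bit0 k))) :: 'f) = numeral k + 1"
    "(numeral (num.Bit0 (num.Bit1 (num.Bit0 k))) :: 'f) = numeral k + 2"
    "(numeral (num.Bit1 (num.Bit1 (num.Bit0 k))) :: 'f) = numeral k + 3"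
    "(numeral (num.Bit0 (num.Bit0 (num.Bit1 k))) :: 'f) = numeral k - 3"
    "(numeral (num.Bit1 (num.Bit0 (num.Bit1 k))) :: 'f) = numeral k - 2"
    "(numeral (num.Bit0 (num.Bit1 (num.Bit1 k))) :: 'f) = numeral k - 1"
    "(numeral (num.Bit1 (num.Bit1 (num.Bit1 k))) :: 'f) = numeral k"
proof -
  have *: "(of_int (7 * m + r) :: 'f) = of_int r" for m r
    using char by simp
  show "(4 :: 'f) = - 3" "(5 :: 'f) = - 2" "(6 :: 'f) = - 1" "(7 :: 'f) = 0"
    using *[of 1 "- 3"] *[of 1 "- 2"] *[of 1 "- 1"] char by simp_all
  have **: "(numeral l :: 'f) = numeral k + of_int r" if "(numeral l :: int) = 7 * m + (numeral k + r)" for l m r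
  proof -
    have "(numeral l :: 'f) = of_int (7 * m + (numeral k + r))" by (simp flip: that)
    then show ?thesis unfolding * by simp
  qed
  define x where "x = (numeral k :: int)"
  have "numeral (num.Bit0 (num.Bit0 (num.Bit0 k))) = ((x + x) + (x + x)) + ((x + x) + (x + x))"
    by (simp only: numeral_Bit0 numeral_Bit1 x_def)
  then show "(numeral (num.Bit0 (num.Bit0 (num.Bit0 k))) :: 'f) = numeral k"
    using **[of "num.Bit0 (num.Bit0 (num.Bit0 k))" "x" "0"] by (simp flip: x_def)
  have "numeral (num.Bit1 (num.Bit0 (num.Bit0 k))) = ((x + x) + (x + x)) + ((x + x) + (x + x)) + 1"
    by (simp only: numeral_Bit0 numeral_Bit1 x_def)
  then show "(numeral (num.Bit1 (num.Bit0 (num.Bit0 k))) :: 'f) = numeral k + 1"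
    using **[of "num.Bit1 (num.Bit0 (num.Bit0 k))" "x" "1"] by (simp flip: x_def)
  have "numeral (num.Bit0 (num.Bit1 (num.Bit0 k))) = ((x + x) + (x + x) + 1) + ((x + x) + (x + x) + 1)"
    by (simp only: numeral_Bit0 numeral_Bit1 x_def)
  then show "(numeral (num.Bit0 (num.Bit1 (num.Bit0 k))) :: 'f) = numeral k + 2"
    using **[of "num.Bit0 (num.Bit1 (num.Bit0 k))" "x" "2"] by (simp flip: x_def)
  have "numeral (num.Bit1 (num.Bit1 (num.Bit0 k))) = ((x + x) + (x + x) + 1) + ((x + x) + (x + x) + 1) + 1"
    by (simp only: numeral_Bit0 numeral_Bit1 x_def)
  then show "(numeral (num.Bit1 (num.Bit1 (num.Bit0 k))) :: 'f) = numeral k + 3"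
    using **[of "num.Bit1 (num.Bit1 (num.Bit0 k))" "x" "3"] by (simp flip: x_def)
  have "numeral (num.Bit0 (num.Bit0 (num.Bit1 k))) = ((x + x + 1) + (x + x + 1)) + ((x + x + 1) + (x + x + 1))"
    by (simp only: numeral_Bit0 numeral_Bit1 x_def)
  then show "(numeral (num.Bit0 (num.Bit0 (num.Bit1 k))) :: 'f) = numeral k - 3"
    using **[of "num.Bit0 (num.Bit0 (num.Bit1 k))" "x + 1" "- 3"] by (simp flip: x_def)
  have "numeral (num.Bit1 (num.Bit0 (num.Bit1 k))) = ((x + x + 1) + (x + x + 1)) + ((x + x + 1) + (x + x + 1)) + 1"
    by (simp only: numeral_Bit0 numeral_Bit1 x_def)
  then show "(numeral (num.Bit1 (num.Bit0 (num.Bit1 k))) :: 'f) = numeral k - 2"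
    using **[of "num.Bit1 (num.Bit0 (num.Bit1 k))" "x + 1" "- 2"] by (simp flip: x_def)
  have "numeral (num.Bit0 (num.Bit1 (num.Bit1 k))) = ((x + x + 1) + (x + x + 1) + 1) + ((x + x + 1) + (x + x + 1) + 1)"
    by (simp only: numeral_Bit0 numeral_Bit1 x_def)
  then show "(numeral (num.Bit0 (num.Bit1 (num.Bit1 k))) :: 'f) = numeral k - 1"
    using **[of "num.Bit0 (num.Bit1 (num.Bit1 k))" "x + 1" "- 1"] by (simp flip: x_def)
  have "numeral (num.Bit1 (num.Bit1 (num.Bit1 k))) = ((x + x + 1) + (x + x + 1) + 1) + ((x + x + 1) + (x + x + 1) + 1) + 1"
    by (simp only: numeral_Bit0 numeral_Bit1 x_def)
  then show "(numeral (num.Bit1 (num.Bit1 (num.Bit1 k))) :: 'f) = numeral k"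
    using **[of "num.Bit1 (num.Bit1 (num.Bit1 k))" "x + 1" "0"] by (simp flip: x_def)
qed

lemma char7_ne:
  assumes "(7 :: 'f::field) = 0"
  shows "(2 :: 'f) \<noteq> 0" "(3 :: 'f) \<noteq> 0"
proof -
  have "(2 :: 'f) * 4 = 7 + 1" "(3 :: 'f) * 5 = 7 + 7 + 1" by simp_all
  then show "(2 :: 'f) \<noteq> 0" "(3 :: 'f) \<noteq> 0" unfolding assms by fastforce+
qed

lemma less_7_cases: "(i::nat) < 7 \<longleftrightarrow> i = 0 \<or> i = 1 \<or> i = 2 \<or> i = 3 \<or> i = 4 \<or> i = 5 \<or> i = 6"
  by presburger

lemma all_less_7: "(\<forall>i<7::nat. P i) \<longleftrightarrow> P 0 \<and> P 1 \<and> P 2 \<and> P 3 \<and> P 4 \<and> P 5 \<and> P 6"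
  unfolding less_7_cases by blast

lemma of_nat_inj_char7:
  assumes char: "(7 :: 'f::field) = 0"
  shows "inj_on (of_nat :: nat \<Rightarrow> 'f) {..<7}"
proof -
  have "(3 :: 'f) = 1 + 2" "(3 :: 'f) = 2 + 1" "(2 :: 'f) = 1 + 1" by simp_all
  then have "(1 :: 'f) \<noteq> 3" "(2 :: 'f) \<noteq> 3" "(1 :: 'f) \<noteq> 2"
    using char7_ne[OF char] by (metis add_cancel_right_right zero_neq_one)+
  note ne = this this[symmetric] char7_ne[OF char] char7_ne(1)[OF char, symmetric] char7_ne(2)[OF char, symmetric]
  have "\<forall>i<7. \<forall>j<7. (of_nat i :: 'f) = of_nat j \<longrightarrow> i = j"
    unfolding all_less_7
    by (simp add: char7_numerals[OF char] eq_neg_iff_add_eq_0 neg_eq_iff_add_eq_0 ne)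
  then show ?thesis by (auto simp: inj_on_def)
qed

lemma of_nat_mod_char7:
  assumes "(7 :: 'f::field) = 0"
  shows "(of_nat (m mod 7) :: 'f) = of_nat m"
proof -
  have "(of_nat m :: 'f) = of_nat (7 * (m div 7) + m mod 7)" by simp
  also have "\<dots> = of_nat (m mod 7)" using assms by (simp only: of_nat_add of_nat_mult) simp
  finally show ?thesis by simp
qed

section \<open>The Cayley algebra of half densities\<close>

text \<open>
  Three times Grozman's operator \<open>2 f''' g + 3 f'' g' - 3 f' g'' - 2 f g'''\<close> maps the pair
  \<open>f = x^i\<close>, \<open>g = x^j\<close> to this multiple of \<open>x^{i+j-3}\<close>. The factor 3 makes the product of the Cayley algebra
  come out with unit coefficient on \<open>one\<close>.
\<close>

definition grozman :: "nat \<Rightarrow> nat \<Rightarrow> int" where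
  "grozman i j = 3 * (2 * int i * (int i - 1) * (int i - 2) + 3 * int i * (int i - 1) * int j
     - 3 * int i * int j * (int j - 1) - 2 * int j * (int j - 1) * (int j - 2))"

text \<open>
  The values of \<open>grozman\<close> modulo 7, as remainders of least absolute value. Off the band \<open>3 \<le> i + j \<le> 9\<close> they
  vanish, so products never leave the range of indices from 0 to 6.
\<close>

definition grozman_table :: "int list list" where
  "grozman_table =
    [[0, 0, 0, - 1, 3, - 3, 1],
     [0, 0, 3, 1, 0, - 1, - 3],
     [0, - 3, 0, 1, - 1, 0, 3],
     [1, - 1, - 1, 0, 1, 1, - 1],
     [- 3, 0, 1, - 1, 0, 3, 0],
     [3, 1, 0, - 1, - 3, 0, 0],
     [- 1, 3, - 3, 1, 0, 0, 0]]"

lemma grozman_char7: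
  assumes "(7 :: 'f::field) = 0" "i < 7" "j < 7"
  shows "(of_int (grozman i j) :: 'f) = of_int (grozman_table ! i ! j)"
proof (rule of_int_char7[OF assms(1)])
  have "\<forall>i<7. \<forall>j<7. (grozman i j - grozman_table ! i ! j) mod 7 = 0"
    by (simp add: all_less_7 grozman_def grozman_table_def)
  then show "(grozman i j - grozman_table ! i ! j) mod 7 = 0" using assms by blast
qed

context cayley_algebra
begin

text \<open>
  \<open>y i\<close> plays the part of \<open>x^i (dx)^{1/2}\<close>, and \<open>one\<close> is put at position 7 of the basis. For \<open>i + j < 3\<close> the
  index \<open>i + j - 3\<close> is truncated to 0 and for \<open>i + j > 9\<close> it exceeds 6; in both cases the coefficient is zero
  modulo 7.
\<close>

definition half_density_basis :: "(nat \<Rightarrow> 'a) \<Rightarrow> bool" where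
  "half_density_basis y \<longleftrightarrow> frame scale UNIV 8 (\<lambda>i. if i = 7 then one else y i) \<and>
     (\<forall>i<7. \<forall>j<7. mul (y i) (y j) =
        scale (if i + j = 6 then 1 else 0) one + scale (of_int (grozman i j)) (y (i + j - 3)))"

end

context split_cayley_algebra
begin

text \<open>
  Every product of an isotropic \<open>x\<close> with another factor has norm 0, and a suitable factor gives trace 1. An element
  of norm 0 and trace 1 is idempotent by the quadratic equation \<open>mul_self\<close>.
\<close>

lemma idempotent_exists:
  obtains e where "polar norm e one = 1" "norm e = 0"
proof -
  obtain x where x: "x \<noteq> 0" "norm x = 0" using norm_isotropic by blast
  then obtain c where c: "polar norm x c \<noteq> 0" using norm_nondegenerate by blast
  let ?e = "mul x (conj (scale (1 / polar norm x c) c))"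
  have "polar norm ?e one = 1"
    using polar_adjoint_right[of x "conj (scale (1 / polar norm x c) c)" one] c by (simp add: polar_scale_right)
  moreover have "norm ?e = 0" by (simp add: norm_mult x)
  ultimately show ?thesis using that by blast
qed

end

context cayley_algebra
begin

text \<open>
  The next element \<open>w\<close> of a Cayley-Dickson doubling. Some \<open>u = p x\<close> orthogonal to \<open>A\<close> has norm \<open>r \<noteq> 0\<close>. The
  element \<open>s = e + c conj e\<close> has norm \<open>c\<close>, so for \<open>c = - 1 / r\<close> the product \<open>s u\<close> has norm \<open>-1\<close>; it is still
  orthogonal to \<open>A\<close> because \<open>conj s\<close> maps \<open>A\<close> into its span.
\<close>

lemma orthogonal_norm_minus_one:
  assumes e: "polar norm e one = 1" "norm e = 0"
    and A: "finite A" "card A < 8"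
    and p: "\<And>x y. p (x + y) = p x + p y"
    and ker: "\<And>x. x - p x \<in> span A"
    and orthA: "\<And>x a. a \<in> A \<Longrightarrow> polar norm (p x) a = 0"
    and closed: "\<And>c a. a \<in> A \<Longrightarrow> mul (scale c e + conj e) a \<in> span A"
  shows "\<exists>w. (\<forall>a\<in>A. polar norm w a = 0) \<and> norm w = - 1"
proof -
  have orth: "polar norm (p x) a = 0" if "a \<in> span A" for x a
    using that
  proof (induction rule: span_induct)
    case base
    show ?case by (rule subspaceI) (simp_all add: polar_simps)
  qed (rule orthA)
  obtain x where "x \<notin> span A" using span_ne_UNIV[OF A] by blast
  then have "p x \<noteq> 0" using ker[of x] by auto
  moreover have "polar norm (p x) (p y) = polar norm (p x) y" for x y
    using orth[OF ker[of y], of x] by (simp add: polar_diff_right)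
  ultimately obtain x where x: "norm (p x) \<noteq> 0" using nonisotropic_image[of p, OF p] by blast
  define r where "r = norm (p x)"
  define c where "c = - 1 / r"
  define s where "s = e + scale c (conj e)"
  have "polar norm e (conj e) = 1"
    using e by (simp add: conj_def polar_simps polar_self)
  then have "norm s = c"
    using e by (simp add: s_def norm_add norm_scale norm_conj polar_scale_right)
  then have "norm (mul s (p x)) = - 1"
    using x by (simp add: norm_mult r_def c_def)
  moreover have "polar norm (mul s (p x)) a = 0" if a: "a \<in> A" for a
  proof -
    have "conj s = conj e + scale c e" by (simp add: s_def conj_add conj_scale)
    then have "mul (conj s) a \<in> span A" using closed[OF a, of c] by (simp add: add.commute)
    then show ?thesis using polar_adjoint_left[of s "p x" a] orth by simp
  qed
  ultimately show ?thesis by blast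
qed

text \<open>
  Starting from \<open>e\<close> and \<open>n = conj e\<close>, a first doubling by \<open>w\<close> gives the split quaternion algebra with basis
  \<open>e, n, u = e w, v = n w\<close>, a second one by \<open>z\<close> the whole algebra. In this basis the half densities are the
  explicit list below: \<open>y 3 = e - n\<close>, and the others are eigenvectors of left multiplication by \<open>y 3\<close>, which is
  how they are found up to scalars.
\<close>

lemma half_density_basis_exists:
  assumes char: "(7 :: 'f) = 0" and e: "polar norm e one = 1" "norm e = 0"
  shows "\<exists>y. half_density_basis y"
proof -
  define n where "n = conj e"
  have en1: "e + n = one" using e by (simp add: n_def conj_def)
  have ce: "conj e = n" "conj n = e" by (simp_all add: n_def)
  have nn: "norm n = 0" by (simp add: n_def norm_conj e)
  have t1: "mul e e = e" using mul_self[of e] e by simp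
  have t2: "mul e n = 0" "mul n e = 0" using conj_self[of e] e ce by simp_all
  have t3: "mul n n = n" using arg_cong[OF t1, of conj] by (simp add: conj_mul ce)
  have one: "one = e + n" using en1 by simp
  have ben: "polar norm e n = 1" "polar norm n e = 1" "polar norm e e = 0" "polar norm n n = 0"
    using e by (simp_all add: polar_commute[of n e] polar_self nn) (simp_all add: n_def conj_def polar_simps polar_self)
  note t = t1 t2 t3 ben mul_simps polar_simps ce one nn e(2)
  have "\<exists>w. (\<forall>a\<in>{e, n}. polar norm w a = 0) \<and> norm w = - 1"
  proof (rule orthogonal_norm_minus_one[OF e, of "{e, n}" "\<lambda>x. x - scale (polar norm x n) e - scale (polar norm x e) n"])
    fix x
    have "x - (x - scale (polar norm x n) e - scale (polar norm x e) n) = scale (polar norm x n) e + scale (polar norm x e) n"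
      by simp
    then show "x - (x - scale (polar norm x n) e - scale (polar norm x e) n) \<in> span {e, n}"
      by (simp add: span_add span_scale span_base)
    fix a assume "a \<in> {e, n}"
    then show "polar norm (x - scale (polar norm x n) e - scale (polar norm x e) n) a = 0"
      by (elim insertE emptyE) (simp_all add: t)
  next
    fix c a assume "a \<in> {e, n}"
    then show "mul (scale c e + conj e) a \<in> span {e, n}"
      by (elim insertE emptyE) (simp_all add: ce t1 t2 t3 mul_simps span_scale span_base)
  next
    show "card {e, n} < 8" using card_length[of "[e, n]"] by simp
  next
    fix x x' show "(x + x') - scale (polar norm (x + x') n) e - scale (polar norm (x + x') e) n
      = (x - scale (polar norm x n) e - scale (polar norm x e) n) + (x' - scale (polar norm x' n) e - scale (polar norm x' e) n)"
      by (simp add: polar_add_left scale_left_distrib)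
  qed simp_all
  then obtain w where w: "polar norm w e = 0" "polar norm w n = 0" "norm w = - 1" by auto
  have w1: "polar norm w one = 0" using w by (simp add: one polar_simps)
  have w': "polar norm e w = 0" "polar norm n w = 0" using w by (simp_all add: polar_commute)
  define u where "u = mul e w"
  define v where "v = mul n w"
  have L: "mul a (mul b w) = mul (mul b a) w" "mul (mul a w) b = mul (mul a (conj b)) w"
    "mul (mul a w) (mul b w) = mul (conj b) a"
    if "a \<in> {e, n}" "b \<in> {e, n}" for a b
    using that by (auto simp: doubling_left[OF w1] doubling_right[OF w1] doubling_mul[OF w1] t w w')
  \<comment> \<open>The multiplication table of the split quaternion algebra.\<close>
  have Q: "mul e u = u" "mul e v = 0" "mul n u = 0" "mul n v = v"
    "mul u e = 0" "mul u n = u" "mul v e = v" "mul v n = 0"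
    "mul u u = 0" "mul u v = e" "mul v u = n" "mul v v = 0"
    by (simp_all add: u_def v_def L t)
  have cuv: "conj u = - u" "conj v = - v"
    using doubling_swap[OF w1, of e] doubling_swap[OF w1, of n] w' w1
    by (simp_all add: u_def v_def conj_mul ce) (simp_all add: conj_def mul_simps)
  have nuv: "norm u = 0" "norm v = 0" by (simp_all add: u_def v_def norm_mult e nn)
  have bQ: "polar norm e u = 0" "polar norm e v = 0" "polar norm n u = 0" "polar norm n v = 0"
     "polar norm u u = 0" "polar norm v v = 0" "polar norm u v = - 1" "polar norm v u = - 1"
     "polar norm u e = 0" "polar norm v e = 0" "polar norm u n = 0" "polar norm v n = 0"
  proof -
    show "polar norm u u = 0" "polar norm v v = 0" by (simp_all add: polar_self nuv)
    show "polar norm u v = - 1" "polar norm v u = - 1" by (simp_all add: u_def v_def polar_mul_right ben w)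
    show "polar norm u e = 0" "polar norm v e = 0" "polar norm u n = 0" "polar norm v n = 0"
      unfolding u_def v_def polar_adjoint_left ce t1 t2 t3 by (simp_all add: w polar_zero_right)
    then show "polar norm e u = 0" "polar norm e v = 0" "polar norm n u = 0" "polar norm n v = 0"
      by (simp_all add: polar_commute[of e] polar_commute[of n])
  qed
  note t = t Q bQ cuv
  define p where "p = (\<lambda>x. x - scale (polar norm x n) e - scale (polar norm x e) n + scale (polar norm x v) u + scale (polar norm x u) v)"
  have "\<exists>z. (\<forall>a\<in>{e, n, u, v}. polar norm z a = 0) \<and> norm z = - 1"
  proof (rule orthogonal_norm_minus_one[OF e, of "{e, n, u, v}" p])
    fix x
    have "x - p x = scale (polar norm x n) e + scale (polar norm x e) n + scale (- polar norm x v) u + scale (- polar norm x u) v"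
      by (simp add: p_def)
    then show "x - p x \<in> span {e, n, u, v}"
      by (simp only:) (intro span_add span_scale span_base, auto)
    fix a assume "a \<in> {e, n, u, v}"
    then show "polar norm (p x) a = 0"
      by (elim insertE emptyE) (simp_all add: t p_def)
  next
    fix c a assume "a \<in> {e, n, u, v}"
    then show "mul (scale c e + conj e) a \<in> span {e, n, u, v}"
      by (elim insertE emptyE) (simp_all add: ce t1 t2 t3 Q mul_simps span_scale span_base)
  next
    show "card {e, n, u, v} < 8" using card_length[of "[e, n, u, v]"] by simp
  next
    fix x x' show "p (x + x') = p x + p x'"
      by (simp add: p_def polar_add_left scale_left_distrib)
  qed simp_all
  then obtain z where z: "polar norm z e = 0" "polar norm z n = 0" "polar norm z u = 0" "polar norm z v = 0" "norm z = - 1"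
    by auto
  have z1: "polar norm z one = 0" using z by (simp add: one polar_simps)
  have z': "polar norm e z = 0" "polar norm n z = 0" "polar norm u z = 0" "polar norm v z = 0"
    using z by (simp_all add: polar_commute)
  have L: "mul a (mul b z) = mul (mul b a) z" "mul (mul a z) b = mul (mul a (conj b)) z"
    "mul (mul a z) (mul b z) = mul (conj b) a"
    if "a \<in> {e, n, u, v}" "b \<in> {e, n, u, v}" for a b
    using that by (auto simp: doubling_left[OF z1] doubling_right[OF z1] doubling_mul[OF z1] t z z')
  define y where "y = nth [- mul v z, scale 2 v, scale 2 (mul n z), e - n, mul e z, u, scale 2 (mul u z)]"
  have table: "mul (y i) (y j) = scale (if i + j = 6 then 1 else 0) one + scale (of_int (grozman i j)) (y (i + j - 3))"
    if "i < 7" "j < 7" for i j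
  proof -
    have sc: "scale 2 x = x + x" "scale 3 x = x + x + x" for x
      using scale_left_distrib[of 1 1 x] scale_left_distrib[of 2 1 x] by simp_all
    have "\<forall>i<7. \<forall>j<7. mul (y i) (y j) = scale (if i + j = 6 then 1 else 0) one + scale (of_int (grozman_table ! i ! j)) (y (i + j - 3))"
      unfolding all_less_7
      by (intro conjI; (simp add: y_def grozman_table_def t L scale_right_diff_distrib scale_right_distrib
        char7_numerals[OF char])?; (simp add: sc)?)
    then show ?thesis using that grozman_char7[OF char that] by simp
  qed
  have bz: "polar norm a (mul b z) = 0" "polar norm (mul b z) a = 0" "polar norm (mul a z) (mul b z) = - polar norm a b"
    if "a \<in> {e, n, u, v}" "b \<in> {e, n, u, v}" for a b
  proof -
    show "polar norm (mul b z) a = 0"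
      using that polar_adjoint_left[of b z a] by (elim insertE emptyE) (simp_all add: t z)
    then show "polar norm a (mul b z) = 0" by (simp add: polar_commute)
    show "polar norm (mul a z) (mul b z) = - polar norm a b" by (simp add: polar_mul_right z)
  qed
  \<comment> \<open>The basis is dual to itself up to order and scalars; this gives its independence.\<close>
  have dual: "polar norm (if i = 7 then one else y i) (if j = 7 then one else y j)
      = (if i = 7 \<and> j = 7 then 2 else if i + j = 6 then - 2 else 0)" if "i < 8" "j < 8" for i j
  proof -
    have "\<forall>i<7. \<forall>j<7. polar norm (y i) (y j) = (if i + j = 6 then - 2 else 0)"
      unfolding all_less_7
      by (intro conjI) (simp add: y_def t bz char7_numerals[OF char])+
    moreover have "\<forall>i<7. polar norm (y i) one = 0 \<and> polar norm one (y i) = 0"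
      unfolding all_less_7
      by (intro conjI) (simp add: y_def t bz)+
    moreover have "i < 7 \<or> i = 7" "j < 7 \<or> j = 7" using that by auto
    ultimately show ?thesis using polar_one_one by auto
  qed
  have "indep_family scale 8 (\<lambda>i. if i = 7 then one else y i)"
    unfolding indep_family_def
  proof (intro allI impI)
    fix c i assume c: "(\<Sum>i<8. scale (c i) (if i = 7 then one else y i)) = 0" and i: "i < (8::nat)"
    let ?b = "\<lambda>i. if i = 7 then one else y i"
    \<comment> \<open>The position of the dual basis vector.\<close>
    define k where "k = (if i = 7 then 7 else 6 - i)"
    have "0 = polar norm (\<Sum>i<8. scale (c i) (?b i)) (?b k)"
      using c by (simp add: polar_zero_left)
    also have "\<dots> = (\<Sum>l<8. c l * polar norm (?b l) (?b k))"
      using linear_comb[OF polar_linear(1)[of "?b k"], of c ?b "{..<8}"] by simp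
    also have "\<dots> = (\<Sum>l<8. if l = i then c i * polar norm (?b i) (?b k) else 0)"
    proof (rule sum.cong[OF refl])
      fix l :: nat assume "l \<in> {..<8}"
      then show "c l * polar norm (?b l) (?b k) = (if l = i then c i * polar norm (?b i) (?b k) else 0)"
        using dual[of l k] i unfolding k_def by (auto split: if_splits)
    qed
    also have "\<dots> = c i * polar norm (?b i) (?b k)" using i by simp
    also have "polar norm (?b i) (?b k) = (if i = 7 then 2 else - 2)"
      using dual[of i k] i unfolding k_def by (auto split: if_splits)
    finally show "c i = 0" using char7_ne[OF char] by (auto split: if_splits)
  qed
  then have "frame scale UNIV 8 (\<lambda>i. if i = 7 then one else y i)"
    using frame_if_dim[OF vector_space_axioms dim_8] by simp
  then show ?thesis unfolding half_density_basis_def using table by blast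
qed

end

section \<open>The action of vector fields on half densities\<close>

text \<open>
  The scalar that appears when \<open>x^m\<close> is reduced by \<open>x^7 = \<alpha>\<close>; only \<open>m < 14\<close> occurs.
\<close>

definition wrap :: "'f::field \<Rightarrow> nat \<Rightarrow> 'f" where
  "wrap \<alpha> m = (if m < 7 then 1 else \<alpha>)"

text \<open>
  The basis \<open>x^k d/dx\<close> of the vector fields on \<open>F[x]/(x^7 - \<alpha>)\<close>. The truncated subtraction at \<open>j = k = 0\<close> is
  harmless, since the coefficient is zero there.
\<close>

definition witt_frame :: "('f::field \<Rightarrow> 'l::ab_group_add \<Rightarrow> 'l) \<Rightarrow> ('l \<Rightarrow> 'l \<Rightarrow> 'l) \<Rightarrow> 'f \<Rightarrow> (nat \<Rightarrow> 'l) \<Rightarrow> bool" where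
  "witt_frame scale bracket \<alpha> e \<longleftrightarrow> nonassoc_algebra scale bracket \<and> frame scale UNIV 7 e \<and>
     (\<forall>j<7. \<forall>k<7. bracket (e j) (e k) =
        scale ((of_nat k - of_nat j) * wrap \<alpha> (j + k - 1)) (e ((j + k - 1) mod 7)))"

text \<open>
  The Lie derivative of \<open>x^i (dx)^{1/2}\<close> along \<open>x^k d/dx\<close>, with \<open>4 = 1/2\<close> modulo 7.
\<close>

definition density_action :: "('f::field \<Rightarrow> 'c::ab_group_add \<Rightarrow> 'c) \<Rightarrow> 'f \<Rightarrow> (nat \<Rightarrow> 'c) \<Rightarrow> nat \<Rightarrow> nat \<Rightarrow> 'c" where
  "density_action scale \<alpha> y k i = scale (of_nat (i + 4 * k) * wrap \<alpha> (i + k - 1)) (y ((i + k - 1) mod 7))"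

context nonassoc_algebra
begin

lemma derivations_commutator:
  assumes "d \<in> derivations scale mul" "d' \<in> derivations scale mul"
  shows "commutator d d' \<in> derivations scale mul"
  using assms vector_space_axioms
  by (simp add: derivations_def commutator_def Vector_Spaces.linear_iff mul_simps
      scale_right_diff_distrib)

lemma derivations_scale:
  assumes "d \<in> derivations scale mul"
  shows "(\<lambda>x. scale c (d x)) \<in> derivations scale mul"
  using assms vector_space_axioms
  by (simp add: derivations_def Vector_Spaces.linear_iff scale_right_distrib mult_scale_left mult_scale_right mult.commute)

lemma derivations_sum:
  assumes "\<And>i. i \<in> A \<Longrightarrow> d i \<in> derivations scale mul"
  shows "(\<lambda>x. \<Sum>i\<in>A. d i x) \<in> derivations scale mul"
proof -
  have l: "mul (\<Sum>i\<in>B. f i) y = (\<Sum>i\<in>B. mul (f i) y)" "mul y (\<Sum>i\<in>B. f i) = (\<Sum>i\<in>B. mul y (f i))" for B f y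
    by (induction B rule: infinite_finite_induct) (simp_all add: mul_simps)
  show ?thesis
    using assms vector_space_axioms
    by (simp add: derivations_def Vector_Spaces.linear_iff sum.distrib l scale_sum_right)
qed

end

context cayley_algebra
begin

text \<open>
  The commutators are those of the Lie derivatives. As \<open>[E_0, E_{k+1}] = (k + 1) E_k\<close>, the operators \<open>E_0\<close> and
  \<open>E_6\<close> generate all others, so that the Leibniz rule has to be checked on basis vectors only for these two.
\<close>

lemma density_action_derivations:
  assumes char: "(7 :: 'f) = 0" and y: "half_density_basis y"
  shows "\<exists>E. (\<forall>k<7. E k \<in> derivations scale mul) \<and>
    (\<forall>k. \<forall>i<7. E k (y i) = density_action scale \<alpha> y k i) \<and>
    (\<forall>j<7. \<forall>k<7. commutator (E j) (E k) =
        (\<lambda>x. scale ((of_nat k - of_nat j) * wrap \<alpha> (j + k - 1)) (E ((j + k - 1) mod 7) x)))"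
proof -
  define b where "b = (\<lambda>i. if i = 7 then one else y i)"
  have fr: "frame scale UNIV 8 b"
    and tab: "\<And>i j. i < 7 \<Longrightarrow> j < 7 \<Longrightarrow>
      mul (y i) (y j) = scale (if i + j = 6 then 1 else 0) one + scale (of_int (grozman_table ! i ! j)) (y (i + j - 3))"
    using y grozman_char7[OF char] by (auto simp: half_density_basis_def b_def)
  interpret frame scale UNIV 8 b by fact
  define E where "E = (\<lambda>k x. \<Sum>i<8. scale (coord x i) (if i = 7 then 0 else density_action scale \<alpha> y k i))"
  have lin: "Vector_Spaces.linear scale scale (E k)" for k
    unfolding E_def by (rule linear_comb_map[OF fr vector_space_axioms])
  then have E_add: "E k (x + x') = E k x + E k x'" and E_scale: "E k (scale c x) = scale c (E k x)" for k x x' c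
    by (simp_all add: Vector_Spaces.linear_iff)
  have E_b: "E k (b i) = (if i = 7 then 0 else density_action scale \<alpha> y k i)" if i: "i < 8" for k i
  proof -
    have "E k (b i) = (\<Sum>l<8. if l = i then (if i = 7 then 0 else density_action scale \<alpha> y k i) else 0)"
      unfolding E_def by (rule sum.cong) (auto simp: coord_basis[OF i])
    then show ?thesis using i by simp
  qed
  have E_y: "E k (y i) = density_action scale \<alpha> y k i" if "i < 7" for k i
    using E_b[of i k] that by (simp add: b_def)
  have E_one: "E k one = 0" for k
    using E_b[of 7 k] by (simp add: b_def)
  have E_zero: "E k 0 = 0" for k using E_scale[of k 0 0] by simp
  have E_minus: "E k (- x) = - E k x" for k x using E_scale[of k "- 1" x] by simp
  have E_diff: "E k (x - x') = E k x - E k x'" for k x x' using E_add[of k x "- x'"] by (simp add: E_minus)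
    have sc: "scale 2 x = x + x" "scale 3 x = x + x + x" "scale (\<alpha> * 2) x = scale \<alpha> x + scale \<alpha> x"
        "scale (\<alpha> * 3) x = scale \<alpha> x + scale \<alpha> x + scale \<alpha> x" for x
      using scale_left_distrib[of 1 1 x] scale_left_distrib[of 2 1 x]
        scale_left_distrib[of \<alpha> \<alpha> x] scale_left_distrib[of "\<alpha> + \<alpha>" \<alpha> x] by (simp_all add: mult.commute[of \<alpha>])
    \<comment> \<open>Simplification of scalar multiples produces such sums of equal vectors.\<close>
    have seven: "x + (x + (x + (x + (x + (x + x))))) = 0" for x :: 'a
    proof -
      have "scale 3 x + scale 3 x + x = scale 7 x" using scale_left_distrib[of 3 3 x] scale_left_distrib[of 6 1 x] by simp
      then show ?thesis using char by (simp add: sc add.assoc)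
    qed
  have comm: "commutator (E j) (E k) = (\<lambda>x. scale ((of_nat k - of_nat j) * wrap \<alpha> (j + k - 1)) (E ((j + k - 1) mod 7) x))"
    if "j < 7" "k < 7" for j k
  proof
    fix x
    show "commutator (E j) (E k) x = scale ((of_nat k - of_nat j) * wrap \<alpha> (j + k - 1)) (E ((j + k - 1) mod 7) x)"
    proof (rule frame_linear_eqI[OF fr, where s' = scale and f = "commutator (E j) (E k)"
        and g = "\<lambda>x. scale ((of_nat k - of_nat j) * wrap \<alpha> (j + k - 1)) (E ((j + k - 1) mod 7) x)"])
    show "Vector_Spaces.linear scale scale (commutator (E j) (E k))"
      using vector_space_axioms by (simp add: Vector_Spaces.linear_iff commutator_def E_add E_scale scale_right_diff_distrib)
    show "Vector_Spaces.linear scale scale (\<lambda>x. scale ((of_nat k - of_nat j) * wrap \<alpha> (j + k - 1)) (E ((j + k - 1) mod 7) x))"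
      using vector_space_axioms by (simp add: Vector_Spaces.linear_iff E_add E_scale scale_right_distrib mult.commute)
    have *: "\<forall>j<7. \<forall>k<7. \<forall>i<7. commutator (E j) (E k) (y i)
       = scale ((of_nat k - of_nat j) * wrap \<alpha> (j + k - 1)) (E ((j + k - 1) mod 7) (y i))"
      unfolding all_less_7
      by (intro conjI; simp add: commutator_def E_y E_scale E_zero density_action_def wrap_def
          del: One_nat_def scale_one scale_zero_left scale_minus_left flip: scale_left_diff_distrib;
        (simp add: char7_numerals[OF char] algebra_simps One_nat_def[symmetric] del: One_nat_def)?;
        (simp add: sc eq_neg_iff_add_eq_0 neg_eq_iff_add_eq_0 algebra_simps seven)?)
    fix i :: nat assume "i < 8"
    then consider "i < 7" | "i = 7" by linarith
    then show "commutator (E j) (E k) (b i) = scale ((of_nat k - of_nat j) * wrap \<alpha> (j + k - 1)) (E ((j + k - 1) mod 7) (b i))"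
      by cases (use * that in \<open>auto simp: b_def commutator_def E_one E_zero\<close>)
    qed
  qed
  have leib: "E k (mul x x') = mul (E k x) x' + mul x (E k x')" if "k = 0 \<or> k = 6" for k x x'
  proof (rule frame_bilinear_eqI[OF fr, where s' = scale and f = "\<lambda>x x'. E k (mul x x')" and g = "\<lambda>x x'. mul (E k x) x' + mul x (E k x')"])
    have *: "\<forall>i<7. \<forall>j<7. E k (mul (y i) (y j)) = mul (E k (y i)) (y j) + mul (y i) (E k (y j))"
      using that unfolding all_less_7
      by (elim disjE; intro conjI; simp add: E_add E_scale E_one E_zero E_minus E_diff E_y tab grozman_table_def
          density_action_def wrap_def mul_simps scale_right_distrib scale_right_diff_distrib char7_numerals[OF char] del: One_nat_def;
         (simp add: sc eq_neg_iff_add_eq_0 neg_eq_iff_add_eq_0 algebra_simps seven)?)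
    show "E k (mul (b i) (b j)) = mul (E k (b i)) (b j) + mul (b i) (E k (b j))" if "i < 8" "j < 8" for i j
    proof -
      have "i < 7 \<or> i = 7" "j < 7 \<or> j = 7" using that by auto
      then show ?thesis
        using * by (elim disjE) (simp_all add: b_def E_one mul_simps)
    qed
  qed (use vector_space_axioms in \<open>simp_all add: Vector_Spaces.linear_iff E_add E_scale mul_simps scale_right_distrib\<close>)
  have der: "E k \<in> derivations scale mul" if "k = 0 \<or> k = 6" for k
    using leib[OF that] lin[of k] by (simp add: derivations_def)
  have down: "E k \<in> derivations scale mul" if k: "Suc k < 7" and d: "E (Suc k) \<in> derivations scale mul" for k
  proof -
    have ne: "(of_nat (Suc k) :: 'f) \<noteq> 0"
    proof -
      have "\<forall>k<7. k < 6 \<longrightarrow> (of_nat (Suc k) :: 'f) \<noteq> 0"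
        unfolding all_less_7 by (simp add: char7_numerals[OF char] char7_ne[OF char])
      then show ?thesis using k by auto
    qed
    have "commutator (E 0) (E (Suc k)) = (\<lambda>x. scale (of_nat (Suc k)) (E k x))"
      using comm[of 0 "Suc k"] k by (simp add: wrap_def)
    then have "(\<lambda>x. scale (1 / of_nat (Suc k)) (commutator (E 0) (E (Suc k)) x)) = E k"
      using ne by simp
    then show ?thesis
      using derivations_scale[OF derivations_commutator[OF der d], of 0 "1 / of_nat (Suc k)"] by simp
  qed
  have "E k \<in> derivations scale mul" if "k \<le> 6" for k
    using that
  proof (induction rule: inc_induct)
    case base
    show ?case by (rule der) simp
  next
    case (step m)
    have "Suc m < 7" using step.hyps by simp
    then show ?case by (rule down) (rule step.IH)
  qed
  then have der_all: "E k \<in> derivations scale mul" if "k < 7" for k using that by simp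
  show ?thesis
  proof (intro exI[of _ E] conjI allI impI)
    fix k i j :: nat
    show "E k \<in> derivations scale mul" if "k < 7" by (rule der_all) fact
    show "E k (y i) = density_action scale \<alpha> y k i" if "i < 7" by (rule E_y) fact
    show "commutator (E j) (E k) = (\<lambda>x. scale ((of_nat k - of_nat j) * wrap \<alpha> (j + k - 1)) (E ((j + k - 1) mod 7) x))"
      if "j < 7" "k < 7" by (rule comm) fact+
  qed
qed

lemma lie_embedding_exists:
  assumes char: "(7 :: 'f) = 0" and y: "half_density_basis y"
    and e: "witt_frame scaleL bracketL \<alpha> e"
  shows "\<exists>\<iota>. lie_embedding_in_Der scaleL bracketL scale mul \<iota>"
proof -
  from density_action_derivations[OF char y, of \<alpha>] obtain E where
    der: "\<And>k. k < 7 \<Longrightarrow> E k \<in> derivations scale mul"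
    and E_y: "\<And>k i. i < 7 \<Longrightarrow> E k (y i) = density_action scale \<alpha> y k i"
    and comm: "\<And>j k. j < 7 \<Longrightarrow> k < 7 \<Longrightarrow> commutator (E j) (E k) =
        (\<lambda>x. scale ((of_nat k - of_nat j) * wrap \<alpha> (j + k - 1)) (E ((j + k - 1) mod 7) x))"
    by blast
  interpret L: nonassoc_algebra scaleL bracketL using e by (simp add: witt_frame_def)
  interpret L: frame scaleL UNIV 7 e using e by (simp add: witt_frame_def)
  have br: "bracketL (e j) (e k) = scaleL ((of_nat k - of_nat j) * wrap \<alpha> (j + k - 1)) (e ((j + k - 1) mod 7))"
    if "j < 7" "k < 7" for j k
    using e that by (simp add: witt_frame_def)
  define \<iota> where "\<iota> = (\<lambda>x a. \<Sum>k<7. scale (L.coord x k) (E k a))"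
  have \<iota>_add: "\<iota> (x + x') a = \<iota> x a + \<iota> x' a" for x x' a
    by (simp add: \<iota>_def L.coord_add scale_left_distrib sum.distrib)
  have \<iota>_scale: "\<iota> (scaleL c x) a = scale c (\<iota> x a)" for c x a
    by (simp add: \<iota>_def L.coord_scale scale_sum_right)
  have \<iota>_e: "\<iota> (e k) = E k" if "k < 7" for k
  proof
    fix a
    have "\<iota> (e k) a = (\<Sum>l<7. if l = k then E k a else 0)"
      unfolding \<iota>_def by (rule sum.cong) (auto simp: L.coord_basis[OF that])
    then show "\<iota> (e k) a = E k a" using that by simp
  qed
  have \<iota>_der: "\<iota> x \<in> derivations scale mul" for x
    unfolding \<iota>_def by (intro derivations_sum derivations_scale der) simp
  then have \<iota>_lin: "\<iota> x (a + a') = \<iota> x a + \<iota> x a'" "\<iota> x (scale c a) = scale c (\<iota> x a)" for x a a' c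
    by (simp_all add: derivations_def Vector_Spaces.linear_iff)
  have bracket: "\<iota> (bracketL x x') a = commutator (\<iota> x) (\<iota> x') a" for x x' a
  proof (rule frame_bilinear_eqI[OF L.frame_axioms, where s' = scale and f = "\<lambda>x x'. \<iota> (bracketL x x') a" and g = "\<lambda>x x'. commutator (\<iota> x) (\<iota> x') a"])
    fix i j :: nat assume ij: "i < 7" "j < 7"
    show "\<iota> (bracketL (e i) (e j)) a = commutator (\<iota> (e i)) (\<iota> (e j)) a"
      using ij by (simp add: br \<iota>_scale \<iota>_e comm)
  qed (use vector_space_axioms L.vector_space_axioms in \<open>simp_all add: Vector_Spaces.linear_iff commutator_def
      L.mult_add_left L.mult_add_right L.mult_scale_left L.mult_scale_right \<iota>_add \<iota>_scale \<iota>_lin algebra_simps scale_right_diff_distrib\<close>)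
  have inj: "inj \<iota>"
  proof (rule injI)
    fix x x' assume eq: "\<iota> x = \<iota> x'"
    define c where "c = (\<lambda>k. L.coord x k - L.coord x' k)"
    have c: "(\<Sum>k<7. scale (c k) (E k a)) = 0" for a
      using fun_cong[OF eq, of a] by (simp add: \<iota>_def c_def scale_left_diff_distrib sum_subtractf)
    have fr: "frame scale UNIV 8 (\<lambda>i. if i = 7 then one else y i)"
      using y by (simp add: half_density_basis_def)
    interpret C: frame scale UNIV 8 "\<lambda>i. if i = 7 then one else y i" by (rule fr)
    have sum7: "(\<Sum>k<7. g k) = g 0 + g 1 + g 2 + g 3 + g 4 + g 5 + g (6::nat)" for g :: "nat \<Rightarrow> 'a"
      by (simp add: eval_nat_numeral)
    have sum8: "(\<Sum>k<8. g k) = g 0 + g 1 + g 2 + g 3 + g 4 + g 5 + g 6 + g (7::nat)" for g :: "nat \<Rightarrow> 'a"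
      by (simp add: eval_nat_numeral)
    \<comment> \<open>The coordinates of the image of \<open>y 0\<close>, which do not involve \<open>c 0\<close> as \<open>E_0\<close> kills \<open>y 0\<close>.\<close>
    define d where "d = nth [c 1 * 4, c 2, c 3 * 5, c 4 * 2, c 5 * 6, c 6 * 3, 0, 0]"
    have "(\<Sum>i<8. scale (d i) (if i = 7 then one else y i)) = 0"
      using c[of "y 0"] unfolding sum7 sum8
      by (simp add: E_y density_action_def wrap_def d_def char7_numerals[OF char])
    then have d0: "d i = 0" if "i < 8" for i
      using indep_familyD[OF C.frame_indep] that by blast
    have c1: "c 1 = 0" "c 2 = 0" "c 3 = 0" "c 4 = 0" "c 5 = 0" "c 6 = 0"
      using d0[of 0] d0[of 1] d0[of 2] d0[of 3] d0[of 4] d0[of 5] char7_ne[OF char]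
      by (simp_all add: d_def char7_numerals[OF char])
    have "y 0 \<noteq> 0"
    proof
      assume "y 0 = 0"
      then show False using C.coord_basis[of 0 0] by simp
    qed
    then have "c 0 = 0"
      using c[of "y 1"] unfolding sum7 by (simp add: c1 c1[simplified] E_y density_action_def wrap_def)
    with c1 have "c k = 0" if "k < 7" for k using that by (auto simp: less_7_cases)
    then show "x = x'" by (intro L.coord_eqI) (simp_all add: c_def)
  qed
  show ?thesis
    unfolding lie_embedding_in_Der_def
    using \<iota>_der inj \<iota>_add \<iota>_scale bracket by (intro exI[of _ \<iota>]) (auto simp: fun_eq_iff)
qed

end

section \<open>Derivations of Cayley algebras\<close>

lemma eigenvectors_sum_zero:
  fixes scale :: "'f::field \<Rightarrow> 'a::ab_group_add \<Rightarrow> 'a" and l :: "nat \<Rightarrow> 'f"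
  assumes "Vector_Spaces.linear scale scale f"
    and inj: "inj_on l {..<n}"
    and eig: "\<And>i. i < n \<Longrightarrow> f (w i) = scale (l i) (w i)"
    and s0: "(\<Sum>i<n. w i) = 0" and i: "i < n"
  shows "w i = 0"
proof -
  interpret Vector_Spaces.linear scale scale f by fact
  show ?thesis
    using inj eig s0 i
  proof (induction n arbitrary: w i)
    case (Suc n)
    define w' where "w' = (\<lambda>i. scale (l i - l n) (w i))"
    have "(\<Sum>i<Suc n. scale (l i) (w i)) = f (\<Sum>i<Suc n. w i)"
      unfolding sum by (rule Groups_Big.sum.cong) (simp_all add: Suc.prems(2))
    also have "\<dots> = 0" using Suc.prems(3) by (simp add: zero)
    finally have "(\<Sum>i<Suc n. scale (l i) (w i)) - scale (l n) (\<Sum>i<Suc n. w i) = 0"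
      using Suc.prems(3) by simp
    then have "(\<Sum>i<Suc n. w' i) = 0"
      unfolding w'_def by (simp only: vs1.scale_sum_right sum_subtractf[symmetric] vs1.scale_left_diff_distrib)
    then have "(\<Sum>i<n. w' i) = 0" by (simp add: w'_def)
    moreover have "f (w' i) = scale (l i) (w' i)" if "i < n" for i
      using Suc.prems(2)[of i] that by (simp add: w'_def scale mult.commute)
    moreover have "inj_on l {..<n}" using Suc.prems(1) by (auto simp: inj_on_def)
    ultimately have w': "w' i = 0" if "i < n" for i using Suc.IH[of w'] that by blast
    have z: "w i = 0" if "i < n" for i
    proof -
      have "l i \<noteq> l n" using Suc.prems(1) that by (auto simp: inj_on_def)
      then show ?thesis using w'[OF that] by (simp add: w'_def)
    qed
    show ?case
      using z Suc.prems(3,4) by (cases "i = n") auto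
  qed simp
qed

lemma eigenvectors_independent:
  fixes scale :: "'f::field \<Rightarrow> 'a::ab_group_add \<Rightarrow> 'a" and l :: "nat \<Rightarrow> 'f"
  assumes lin: "Vector_Spaces.linear scale scale f"
    and inj: "inj_on l {..<n}"
    and eig: "\<And>i. i < n \<Longrightarrow> f (w i) = scale (l i) (w i)" and ne: "\<And>i. i < n \<Longrightarrow> w i \<noteq> 0"
  shows "indep_family scale n w"
  unfolding indep_family_def
proof (intro allI impI)
  interpret Vector_Spaces.linear scale scale f by fact
  fix c i assume c: "(\<Sum>i<n. scale (c i) (w i)) = 0" and i: "i < n"
  have "scale (c i) (w i) = 0"
    by (rule eigenvectors_sum_zero[OF lin inj _ c i]) (simp add: scale eig mult.commute)
  then show "c i = 0" using ne[OF i] by simp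
qed

context cayley_algebra
begin

lemma derivation_add: "d \<in> derivations scale mul \<Longrightarrow> d (x + y) = d x + d y"
  and derivation_scale: "d \<in> derivations scale mul \<Longrightarrow> d (scale c x) = scale c (d x)"
  and derivation_mul: "d \<in> derivations scale mul \<Longrightarrow> d (mul x y) = mul (d x) y + mul x (d y)"
  and derivation_linear: "d \<in> derivations scale mul \<Longrightarrow> Vector_Spaces.linear scale scale d"
  by (simp_all add: derivations_def Vector_Spaces.linear_iff)

lemma derivation_zero: "d \<in> derivations scale mul \<Longrightarrow> d 0 = 0"
  using derivation_scale[of d 0 0] by simp

lemma derivation_minus: "d \<in> derivations scale mul \<Longrightarrow> d (- x) = - d x"
  using derivation_scale[of d "- 1" x] by simp

lemma derivation_diff: "d \<in> derivations scale mul \<Longrightarrow> d (x - y) = d x - d y"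
  using derivation_add[of d x "- y"] by (simp add: derivation_minus)

lemma derivation_one:
  assumes "d \<in> derivations scale mul"
  shows "d one = 0"
  using derivation_mul[OF assms, of one one] by simp

lemma one_nonzero: "one \<noteq> 0"
  using norm_one by (auto simp: norm_zero)

lemma anticommutator:
  "mul x y + mul y x = scale (polar norm x one) y + scale (polar norm y one) x - scale (polar norm x y) one"
  using mul_self[of "x + y"] mul_self[of x] mul_self[of y]
  by (simp add: mul_simps polar_simps norm_add scale_left_distrib scale_right_distrib algebra_simps)

text \<open>
  Applying \<open>d\<close> to the quadratic equation \<open>mul_self\<close> shows that \<open>polar norm (d x) one\<close> times \<open>x\<close> is a multiple
  of \<open>one\<close>. If this scalar were nonzero, \<open>x\<close> would be a multiple of \<open>one\<close> and \<open>d x\<close> would vanish.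
\<close>

lemma derivation_isotropic:
  assumes d: "d \<in> derivations scale mul"
  shows "polar norm (d x) one = 0 \<and> polar norm x (d x) = 0"
proof -
  have "d (mul x x) = scale (polar norm x one) (d x)"
    unfolding mul_self using d
    by (simp add: derivation_diff derivation_scale derivation_one)
  then have "mul x (d x) + mul (d x) x = scale (polar norm x one) (d x)"
    using derivation_mul[OF d, of x x] by (simp add: add.commute)
  then have eq: "scale (polar norm (d x) one) x = scale (polar norm x (d x)) one"
    unfolding anticommutator by simp
  have t: "polar norm (d x) one = 0"
  proof (rule ccontr)
    assume ne: "polar norm (d x) one \<noteq> 0"
    have "x = scale (1 / polar norm (d x) one) (scale (polar norm (d x) one) x)" using ne by simp
    also have "\<dots> = scale (polar norm x (d x) / polar norm (d x) one) one" unfolding eq by simp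
    finally have "d x = 0"
      using derivation_scale[OF d, of "polar norm x (d x) / polar norm (d x) one" one] derivation_one[OF d] by simp
    with ne show False by (simp add: polar_zero_left)
  qed
  with eq one_nonzero show ?thesis by simp
qed

lemma derivation_skew:
  assumes d: "d \<in> derivations scale mul"
  shows "polar norm (d x) y = - polar norm x (d y)"
proof -
  have "polar norm (x + y) (d (x + y)) = 0" "polar norm x (d x) = 0" "polar norm y (d y) = 0"
    using derivation_isotropic[OF d] by simp_all
  then have "polar norm x (d y) + polar norm y (d x) = 0"
    by (simp add: derivation_add[OF d] polar_simps add.commute)
  then show ?thesis by (simp add: polar_commute[of "d x"] eq_neg_iff_add_eq_0 add.commute)
qed

lemma derivation_trace_zero:
  assumes d: "d \<in> derivations scale mul"
  shows "polar norm (d x) one = 0"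
  using derivation_isotropic[OF d] by simp

text \<open>
  The multiplication table determines the norm: traces are read off from squares by \<open>mul_self\<close>, polar forms
  from anticommutators.
\<close>

lemma half_density_basis_polar:
  assumes char: "(7 :: 'f) = 0" and y: "half_density_basis y" and ij: "i < 7" "j < 7"
  shows "polar norm (y i) one = 0" "polar norm (y i) (y j) = (if i + j = 6 then - 2 else 0)"
proof -
  have fr: "frame scale UNIV 8 (\<lambda>i. if i = 7 then one else y i)"
    and tab: "\<And>i j. i < 7 \<Longrightarrow> j < 7 \<Longrightarrow>
      mul (y i) (y j) = scale (if i + j = 6 then 1 else 0) one + scale (of_int (grozman_table ! i ! j)) (y (i + j - 3))"
    using y grozman_char7[OF char] by (auto simp: half_density_basis_def)
  interpret C: frame scale UNIV 8 "\<lambda>i. if i = 7 then one else y i" by (rule fr)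
  have t: "polar norm (y i) one = 0" if i: "i < 7" for i
  proof -
    have "grozman_table ! i ! i = 0"
    proof -
      have "\<forall>i<7. grozman_table ! i ! i = 0" unfolding all_less_7 by (simp add: grozman_table_def)
      then show ?thesis using i by blast
    qed
    then have "scale (if i + i = 6 then 1 else 0) one = scale (polar norm (y i) one) (y i) - scale (norm (y i)) one"
      using mul_self[of "y i"] tab[OF i i] by simp
    then have "scale (polar norm (y i) one) (y i) = scale (norm (y i) + (if i + i = 6 then 1 else 0)) one"
      by (simp add: scale_left_distrib)
    then have "C.coord (scale (polar norm (y i) one) (y i)) i = C.coord (scale (norm (y i) + (if i + i = 6 then 1 else 0)) one) i"
      by simp
    then show ?thesis
      using C.coord_basis[of i i] C.coord_basis[of 7 i] i by (simp add: C.coord_scale)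
  qed
  show "polar norm (y i) one = 0" by (rule t) fact
  have sc: "scale 2 one = one + one"
    using scale_left_distrib[of 1 1 one] by simp
  have "\<forall>i<7. \<forall>j<7. mul (y i) (y j) + mul (y j) (y i) = scale (if i + j = 6 then 2 else 0) one"
    unfolding all_less_7
    by (intro conjI; simp add: tab grozman_table_def sc)
  then have "scale (if i + j = 6 then 2 else 0) one = scale (- polar norm (y i) (y j)) one"
    using ij t by (simp add: anticommutator)
  then have "(if i + j = 6 then 2 else 0) = - polar norm (y i) (y j)"
    by (rule scale_right_imp_eq[OF one_nonzero])
  then have "polar norm (y i) (y j) = - (if i + j = 6 then 2 else 0)" by simp
  then show "polar norm (y i) (y j) = (if i + j = 6 then - 2 else 0)" by auto
qed

lemma trace_zero_frame:
  assumes char: "(7 :: 'f) = 0" and y: "half_density_basis y"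
  shows "frame scale {x. polar norm x one = 0} 7 y"
proof -
  have fr: "frame scale UNIV 8 (\<lambda>i. if i = 7 then one else y i)"
    using y by (simp add: half_density_basis_def)
  interpret C: frame scale UNIV 8 "\<lambda>i. if i = 7 then one else y i" by (rule fr)
  have sum8: "(\<Sum>i<8. scale (c i) (if i = 7 then one else y i)) = (\<Sum>i<7. scale (c i) (y i)) + scale (c 7) one" for c
  proof -
    have "{..<8::nat} = insert 7 {..<7}" by auto
    then show ?thesis by (simp add: add.commute)
  qed
  have pol: "polar norm (\<Sum>i<7. scale (c i) (y i)) one = 0" for c
    using linear_comb[OF polar_linear(1)[of one], of c y "{..<7}"] half_density_basis_polar(1)[OF char y]
    by simp
  show ?thesis
  proof unfold_locales
    fix x
    show "x \<in> {x. polar norm x one = 0} \<longleftrightarrow> (\<exists>c. x = (\<Sum>i<7. scale (c i) (y i)))"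
    proof
      assume x: "x \<in> {x. polar norm x one = 0}"
      have eq: "x = (\<Sum>i<7. scale (C.coord x i) (y i)) + scale (C.coord x 7) one"
        using C.sum_coord[of x] sum8[of "C.coord x"] by simp
      have "polar norm x one = C.coord x 7 * 2"
        by (subst eq) (simp add: polar_add_left pol polar_scale_left polar_one_one)
      then have "C.coord x 7 = 0" using x char7_ne[OF char] by simp
      then have "x = (\<Sum>i<7. scale (C.coord x i) (y i))" using eq by simp
      then show "\<exists>c. x = (\<Sum>i<7. scale (c i) (y i))" by blast
    qed (auto simp: pol)
  next
    show "indep_family scale 7 y"
      unfolding indep_family_def
    proof (intro allI impI)
      fix c i assume "(\<Sum>i<7. scale (c i) (y i)) = 0" and i: "i < (7::nat)"
      then have "(\<Sum>i<8. scale (if i = 7 then 0 else c i) (if i = 7 then one else y i)) = 0"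
        using sum8[of "\<lambda>i. if i = 7 then 0 else c i"] by simp
      from indep_familyD[OF C.frame_indep this, of i] i show "c i = 0" by simp
    qed
  qed
qed

end

section \<open>Weights of the toral element\<close>

text \<open>
  The images \<open>E k\<close> of the basis \<open>x^k d/dx\<close> under an embedding into the derivations. Injectivity of the embedding
  enters only through \<open>E 2 \<noteq> 0\<close>.
\<close>

locale witt_action = cayley_algebra scale mul norm
  for scale :: "'f::field \<Rightarrow> 'a::ab_group_add \<Rightarrow> 'a" and mul :: "'a \<Rightarrow> 'a \<Rightarrow> 'a" and norm :: "'a \<Rightarrow> 'f" +
  fixes \<alpha> :: 'f and E :: "nat \<Rightarrow> 'a \<Rightarrow> 'a" and y :: "nat \<Rightarrow> 'a"
  assumes char: "(7 :: 'f) = 0" and y: "half_density_basis y"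
    and E_der: "k < 7 \<Longrightarrow> E k \<in> derivations scale mul"
    and E_comm: "j < 7 \<Longrightarrow> k < 7 \<Longrightarrow> commutator (E j) (E k) =
        (\<lambda>x. scale ((of_nat k - of_nat j) * wrap \<alpha> (j + k - 1)) (E ((j + k - 1) mod 7) x))"
    and E2_nonzero: "\<exists>x. E 2 x \<noteq> 0"
begin

lemma E_bracket:
  "E 1 (E 2 x) = E 2 (E 1 x) + E 2 x" "E 1 (E 0 x) = E 0 (E 1 x) - E 0 x" "E 1 (E 3 x) = E 3 (E 1 x) + scale 2 (E 3 x)"
  "E 0 (E 2 x) = E 2 (E 0 x) + scale 2 (E 1 x)" "E 0 (E 3 x) = E 3 (E 0 x) + scale 3 (E 2 x)"
  "E 2 (E 3 x) = E 3 (E 2 x) + E 4 x" "E 2 (E 4 x) = E 4 (E 2 x) + scale 2 (E 5 x)"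
  "E 2 (E 5 x) = E 5 (E 2 x) + scale 3 (E 6 x)" "E 2 (E 6 x) = E 6 (E 2 x) + scale (4 * \<alpha>) (E 0 x)"
proof -
  have *: "E j (E k x) = E k (E j x) + scale ((of_nat k - of_nat j) * wrap \<alpha> (j + k - 1)) (E ((j + k - 1) mod 7) x)"
    if "j < 7" "k < 7" for j k
    using fun_cong[OF E_comm[OF that], of x] by (simp add: commutator_def diff_eq_eq add.commute)
  show "E 1 (E 2 x) = E 2 (E 1 x) + E 2 x" "E 1 (E 0 x) = E 0 (E 1 x) - E 0 x" "E 1 (E 3 x) = E 3 (E 1 x) + scale 2 (E 3 x)"
    using *[of 1 2] *[of 1 0] *[of 1 3] by (simp_all add: wrap_def numeral_2_eq_2)
  show "E 0 (E 2 x) = E 2 (E 0 x) + scale 2 (E 1 x)" "E 0 (E 3 x) = E 3 (E 0 x) + scale 3 (E 2 x)"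
    using *[of 0 2] *[of 0 3] by (simp_all add: wrap_def)
  show "E 2 (E 3 x) = E 3 (E 2 x) + E 4 x" "E 2 (E 4 x) = E 4 (E 2 x) + scale 2 (E 5 x)"
    "E 2 (E 5 x) = E 5 (E 2 x) + scale 3 (E 6 x)" "E 2 (E 6 x) = E 6 (E 2 x) + scale (4 * \<alpha>) (E 0 x)"
    using *[of 2 3] *[of 2 4] *[of 2 5] *[of 2 6] by (simp_all add: wrap_def)
qed

lemma E_simps:
  assumes "k < 7"
  shows "E k (x + x') = E k x + E k x'" "E k (scale c x) = scale c (E k x)" "E k (x - x') = E k x - E k x'"
    "E k (- x) = - E k x" "E k 0 = 0" "E k one = 0" "polar norm (E k x) one = 0"
    "E k (mul x x') = mul (E k x) x' + mul x (E k x')" "polar norm (E k x) x' = - polar norm x (E k x')"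
    "Vector_Spaces.linear scale scale (E k)"
proof -
  note d = E_der[OF assms]
  show "E k (x + x') = E k x + E k x'" "E k (scale c x) = scale c (E k x)" "E k (x - x') = E k x - E k x'"
    "E k (- x) = - E k x" "E k 0 = 0" "E k one = 0"
    by (fact derivation_add[OF d] derivation_scale[OF d] derivation_diff[OF d] derivation_minus[OF d]
        derivation_zero[OF d] derivation_one[OF d])+
  show "polar norm (E k x) one = 0" "E k (mul x x') = mul (E k x) x' + mul x (E k x')"
    "polar norm (E k x) x' = - polar norm x (E k x')" "Vector_Spaces.linear scale scale (E k)"
    by (fact derivation_trace_zero[OF d] derivation_mul[OF d] derivation_skew[OF d] derivation_linear[OF d])+
qed

abbreviation V :: "'a set" where "V \<equiv> {x. polar norm x one = 0}"

text \<open>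
  On the image of \<open>E 2\<close> one has \<open>E_1 E_2 = E_2 (E_1 + 1)\<close>, and \<open>(E_1 + 1)^7 = E_1^7 + 1\<close> in characteristic 7.
\<close>

lemma E1_power_E2: "(E 1 ^^ 7) (E 2 x) = E 2 ((E 1 ^^ 7) x) + E 2 x"
proof -
  define t where "t = (\<lambda>j. E 2 ((E 1 ^^ j) x))"
  have step: "E 1 (t j) = t (Suc j) + t j" for j
    by (simp only: t_def E_bracket funpow.simps o_def)
  have gen: "(E 1 ^^ n) (t 0) = (\<Sum>j\<le>n. scale (of_nat (n choose j)) (t j))" for n
  proof (induction n)
    case (Suc n)
    have "(E 1 ^^ Suc n) (t 0) = E 1 (\<Sum>j\<le>n. scale (of_nat (n choose j)) (t j))" by (simp only: funpow.simps o_def Suc)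
    also have "\<dots> = (\<Sum>j\<le>n. scale (of_nat (n choose j)) (t (Suc j) + t j))"
      using linear_comb[OF E_simps(10)[of 1], of "\<lambda>j. of_nat (n choose j)" t "{..n}"] by (simp add: step[simplified])
    also have "\<dots> = (\<Sum>j\<le>n. scale (of_nat (n choose j)) (t (Suc j))) + (\<Sum>j\<le>n. scale (of_nat (n choose j)) (t j))"
      by (simp add: scale_right_distrib sum.distrib)
    also have "(\<Sum>j\<le>n. scale (of_nat (n choose j)) (t j)) = (\<Sum>j\<le>Suc n. scale (of_nat (n choose j)) (t j))"
      by (simp add: binomial_eq_0)
    also have "\<dots> = t 0 + (\<Sum>j\<le>n. scale (of_nat (n choose Suc j)) (t (Suc j)))"
      by (subst sum.atMost_Suc_shift) simp
    finally have "(E 1 ^^ Suc n) (t 0)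
        = t 0 + (\<Sum>j\<le>n. scale (of_nat (n choose j)) (t (Suc j)) + scale (of_nat (n choose Suc j)) (t (Suc j)))"
      by (simp add: sum.distrib)
    also have "\<dots> = t 0 + (\<Sum>j\<le>n. scale (of_nat (Suc n choose Suc j)) (t (Suc j)))"
      by (simp add: scale_left_distrib)
    also have "\<dots> = (\<Sum>j\<le>Suc n. scale (of_nat (Suc n choose j)) (t j))"
      by (subst sum.atMost_Suc_shift) simp
    finally show ?case .
  qed simp
  have "(E 1 ^^ 7) (t 0) = (\<Sum>j\<le>7. scale (of_nat (7 choose j)) (t j))" by (rule gen)
  also have "\<dots> = (\<Sum>j\<in>{0, 7}. scale (of_nat (7 choose j)) (t j))"
  proof (rule sum.mono_neutral_right)
    show "\<forall>j\<in>{..7} - {0, 7}. scale (of_nat (7 choose j)) (t j) = 0"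
    proof
      fix j :: nat assume j: "j \<in> {..7} - {0, 7}"
      have "prime (7::nat)" by simp
      then have "7 dvd (7 choose j)" using j by (intro dvd_choose_prime) auto
      then obtain m where "(7 choose j) = 7 * m" by (rule dvdE)
      then show "scale (of_nat (7 choose j)) (t j) = 0" using char by simp
    qed
  qed auto
  finally show ?thesis by (simp add: t_def add.commute)
qed

lemma V_frame: "frame scale V 7 y"
  by (rule trace_zero_frame[OF char y])

text \<open>
  Every element of the prime field is a root of \<open>X^7 - X\<close>, the characteristic polynomial of the matrix of \<open>E 1\<close>
  on \<open>V\<close> by \<open>char_poly_toral\<close>.
\<close>

lemma weight_vector_exists:
  assumes "c < 7"
  shows "\<exists>u\<in>V. u \<noteq> 0 \<and> E 1 u = scale (of_nat c) u"
proof -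
  interpret B: frame scale V 7 y by (rule V_frame)
  define rep where "rep = (\<lambda>f. mat 7 7 (\<lambda>(i, j). B.coord (f (y j)) i))"
  have rep_carrier [simp]: "rep f \<in> carrier_mat 7 7" for f by (simp add: rep_def)
  have rep_apply: "B.coord (f x) i = (\<Sum>j<7. rep f $$ (i, j) * B.coord x j)"
    if f: "Vector_Spaces.linear scale scale f" "\<And>x. x \<in> V \<Longrightarrow> f x \<in> V" and x: "x \<in> V" and i: "i < 7" for f x i
  proof -
    have yV: "y j \<in> V" if "j < 7" for j using B.basis_in[OF that] .
    have "f x = (\<Sum>j<7. scale (B.coord x j) (f (y j)))"
      by (rule B.linear_frame_expansion[OF f(1) x])
    also have "\<dots> = (\<Sum>j<7. scale (B.coord x j) (\<Sum>l<7. scale (B.coord (f (y j)) l) (y l)))"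
      by (rule sum.cong[OF refl]) (simp only: B.sum_coord[OF f(2)[OF yV]] lessThan_iff)
    also have "\<dots> = (\<Sum>j<7. \<Sum>l<7. scale (B.coord x j * B.coord (f (y j)) l) (y l))"
      by (simp add: scale_sum_right)
    also have "\<dots> = (\<Sum>l<7. scale (\<Sum>j<7. B.coord x j * B.coord (f (y j)) l) (y l))"
      by (subst sum.swap) (simp add: scale_sum_left)
    finally have "B.coord (f x) i = (\<Sum>j<7. B.coord x j * B.coord (f (y j)) i)"
      using B.coord_comb[OF i] by simp
    also have "\<dots> = (\<Sum>j<7. rep f $$ (i, j) * B.coord x j)"
      using i by (intro sum.cong) (simp_all add: rep_def mult.commute)
    finally show ?thesis .
  qed
  have lin: "Vector_Spaces.linear scale scale (E k)" "\<And>x. E k x \<in> V" if "k < 7" for k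
    using E_simps[OF that] by simp_all
  have rep_comp: "rep (\<lambda>x. f (g x)) = rep f * rep g"
    if f: "Vector_Spaces.linear scale scale f" "\<And>x. x \<in> V \<Longrightarrow> f x \<in> V"
      and g: "\<And>x. x \<in> V \<Longrightarrow> g x \<in> V" for f g
  proof (rule eq_matI)
    fix i j assume "i < dim_row (rep f * rep g)" "j < dim_col (rep f * rep g)"
    then have ij: "i < 7" "j < 7" by (auto simp: rep_def)
    have "rep (\<lambda>x. f (g x)) $$ (i, j) = B.coord (f (g (y j))) i" using ij by (simp add: rep_def)
    also have "\<dots> = (\<Sum>l<7. rep f $$ (i, l) * B.coord (g (y j)) l)"
      using rep_apply[OF f g[OF B.basis_in[OF ij(2)]] ij(1)] .
    also have "\<dots> = (\<Sum>l<7. rep f $$ (i, l) * rep g $$ (l, j))"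
      using ij by (intro sum.cong) (simp_all add: rep_def)
    also have "\<dots> = (rep f * rep g) $$ (i, j)"
      using ij by (simp add: scalar_prod_def atLeast0LessThan rep_def)
    finally show "rep (\<lambda>x. f (g x)) $$ (i, j) = (rep f * rep g) $$ (i, j)" .
  qed (auto simp: rep_def)
  have rep_comb: "rep f - rep g = c \<cdot>\<^sub>m rep h"
    if "\<And>x. x \<in> V \<Longrightarrow> f x \<in> V" "\<And>x. x \<in> V \<Longrightarrow> h x \<in> V" "\<And>x. x \<in> V \<Longrightarrow> g x \<in> V"
      "\<And>x. f x = g x + scale c (h x)" for f g h c
  proof (rule eq_matI)
    fix i j assume "i < dim_row (c \<cdot>\<^sub>m rep h)" "j < dim_col (c \<cdot>\<^sub>m rep h)"
    then have ij: "i < 7" "j < 7" by (auto simp: rep_def)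
    have "B.coord (f (y j)) i = B.coord (g (y j)) i + c * B.coord (h (y j)) i"
      using that(2,3)[OF B.basis_in[OF ij(2)]]
      by (simp only: that(4) B.coord_add B.scale_in B.coord_scale)
    then show "(rep f - rep g) $$ (i, j) = (c \<cdot>\<^sub>m rep h) $$ (i, j)" using ij by (simp add: rep_def)
  qed (auto simp: rep_def)
  have pow_V: "(E 1 ^^ m) x \<in> V" if "x \<in> V" for m x
    using that lin(2)[of 1] by (cases m) auto
  have rep_pow: "rep (E 1 ^^ m) = rep (E 1) ^\<^sub>m m" for m
  proof (induction m)
    case 0
    show ?case by (rule eq_matI) (auto simp: rep_def B.coord_basis)
  next
    case (Suc m)
    have "rep (E 1 ^^ Suc m) = rep (\<lambda>x. E 1 ((E 1 ^^ m) x))" by (simp only: funpow.simps o_def)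
    also have "\<dots> = rep (E 1) * rep (E 1 ^^ m)"
      by (rule rep_comp[OF lin(1) lin(2)]) (simp, simp, rule pow_V)
    finally show ?case unfolding Suc mult_pow_mat[OF rep_carrier] .
  qed
  define G where "G = mat 7 7 (\<lambda>(i, j). polar norm (y i) (y j))"
  \<comment> \<open>The Gram matrix \<open>G\<close> is antidiagonal with entries \<open>-2\<close>.\<close>
  define G' where "G' = mat 7 7 (\<lambda>(i, j). if i + j = 6 then - 1 / 2 else (0::'f))"
  have G_eq: "G = mat 7 7 (\<lambda>(i, j). if i + j = 6 then - 2 else 0)"
    unfolding G_def by (rule cong_mat) (simp_all add: half_density_basis_polar[OF char y])
  have anti: "mat 7 7 (\<lambda>(i, j). if i + j = 6 then a else 0) * mat 7 7 (\<lambda>(i, j). if i + j = 6 then b else 0) = 1\<^sub>m 7"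
    if "a * b = 1" for a b :: 'f
  proof (rule eq_matI)
    fix i j assume "i < dim_row (1\<^sub>m 7 :: 'f mat)" "j < dim_col (1\<^sub>m 7 :: 'f mat)"
    then have ij: "i < 7" "j < 7" by auto
    have "(mat 7 7 (\<lambda>(i, j). if i + j = 6 then a else 0) * mat 7 7 (\<lambda>(i, j). if i + j = 6 then b else 0)) $$ (i, j)
        = (\<Sum>k<7. (if i + k = 6 then a else 0) * (if k + j = 6 then b else 0))"
      using ij by (simp add: scalar_prod_def atLeast0LessThan)
    also have "\<dots> = (\<Sum>k<7. if k = 6 - i then (if i = j then 1 else 0) else 0)"
      using ij that by (intro sum.cong) auto
    also have "\<dots> = (if i = j then 1 else 0)"
    proof -
      have "6 - i \<in> {..<7::nat}" by auto
      then show ?thesis by (simp only: sum.delta finite_lessThan if_True)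
    qed
    also have "\<dots> = 1\<^sub>m 7 $$ (i, j)" using ij by simp
    finally show "(mat 7 7 (\<lambda>(i, j). if i + j = 6 then a else 0) * mat 7 7 (\<lambda>(i, j). if i + j = 6 then b else 0)) $$ (i, j)
        = 1\<^sub>m 7 $$ (i, j)" .
  qed auto
  have inv: "G * G' = 1\<^sub>m 7" "G' * G = 1\<^sub>m 7"
    unfolding G_eq G'_def by (rule anti, use char7_ne[OF char] in simp)+
  have skew: "G * rep (E 1) = - (transpose_mat (rep (E 1)) * G)"
  proof (rule eq_matI)
    fix i j assume "i < dim_row (- (transpose_mat (rep (E 1)) * G))" "j < dim_col (- (transpose_mat (rep (E 1)) * G))"
    then have ij: "i < 7" "j < 7" by (auto simp: rep_def G_def)
    have "(G * rep (E 1)) $$ (i, j) = (\<Sum>k<7. B.coord (E 1 (y j)) k * polar norm (y i) (y k))"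
      using ij by (simp add: scalar_prod_def atLeast0LessThan rep_def G_def mult.commute)
    also have "\<dots> = polar norm (y i) (E 1 (y j))"
      using linear_comb[OF polar_linear(2)[of "y i"], of "B.coord (E 1 (y j))" y "{..<7}"]
        B.sum_coord[OF lin(2)[of 1 "y j"]] by simp
    also have "\<dots> = - polar norm (E 1 (y i)) (y j)" using E_simps(9)[of 1] by simp
    also have "polar norm (E 1 (y i)) (y j) = (\<Sum>k<7. B.coord (E 1 (y i)) k * polar norm (y k) (y j))"
      using linear_comb[OF polar_linear(1)[of "y j"], of "B.coord (E 1 (y i))" y "{..<7}"]
        B.sum_coord[OF lin(2)[of 1 "y i"]] by simp
    also have "\<dots> = (transpose_mat (rep (E 1)) * G) $$ (i, j)"
      using ij by (simp add: scalar_prod_def atLeast0LessThan rep_def G_def)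
    finally show "(G * rep (E 1)) $$ (i, j) = (- (transpose_mat (rep (E 1)) * G)) $$ (i, j)"
      using ij by (simp add: rep_def G_def)
  qed (auto simp: rep_def G_def)
  have E2V: "rep (E 2) \<noteq> 0\<^sub>m 7 7"
  proof
    assume z: "rep (E 2) = 0\<^sub>m 7 7"
    have V0: "E 2 x = 0" if "x \<in> V" for x
    proof (rule B.coord_eqI)
      show "B.coord (E 2 x) i = B.coord 0 i" if "i < 7" for i
        using rep_apply[OF lin(1)[of 2] lin(2)[of 2] \<open>x \<in> V\<close> that] z that by simp
    qed (use lin(2)[of 2 x] B.zero_in in auto)
    have "E 2 x = 0" for x
    proof -
      define x' where "x' = x - scale (polar norm x one / 2) one"
      have "x' \<in> V" using char7_ne[OF char] by (simp add: x'_def polar_simps polar_one_one)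
      then have "E 2 x' = 0" by (rule V0)
      then show ?thesis by (simp add: x'_def E_simps)
    qed
    with E2_nonzero show False by blast
  qed
  have rep_bracket: "rep (E j) * rep (E k) - rep (E k) * rep (E j) = c \<cdot>\<^sub>m rep (E m)"
    if jkm: "j < 7" "k < 7" "m < 7" and br: "\<And>x. E j (E k x) = E k (E j x) + scale c (E m x)" for j k m c
  proof -
    have "rep (\<lambda>x. E j (E k x)) - rep (\<lambda>x. E k (E j x)) = c \<cdot>\<^sub>m rep (E m)"
      by (rule rep_comb[OF _ _ _ br]) (rule lin(2), rule jkm)+
    then show ?thesis
      unfolding rep_comp[OF lin(1)[OF jkm(1)] lin(2)[OF jkm(1)] lin(2)[OF jkm(2)]]
        rep_comp[OF lin(1)[OF jkm(2)] lin(2)[OF jkm(2)] lin(2)[OF jkm(1)]] .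
  qed
  have E2E: "rep (E 1) * rep (E 2) - rep (E 2) * rep (E 1) = 1 \<cdot>\<^sub>m rep (E 2)"
  proof (rule rep_bracket)
    show "E 1 (E 2 x) = E 2 (E 1 x) + scale 1 (E 2 x)" for x
      unfolding E_bracket(1) scale_one ..
  qed simp_all
  have E02: "rep (E 0) * rep (E 2) - rep (E 2) * rep (E 0) = 2 \<cdot>\<^sub>m rep (E 1)"
    by (rule rep_bracket[OF _ _ _ E_bracket(4)]) simp_all
  have E03: "rep (E 0) * rep (E 3) - rep (E 3) * rep (E 0) = 3 \<cdot>\<^sub>m rep (E 2)"
    by (rule rep_bracket[OF _ _ _ E_bracket(5)]) simp_all
  have powlin: "Vector_Spaces.linear scale scale (E 1 ^^ m)" for m
  proof (induction m)
    case 0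
    show ?case using vector_space_axioms by (simp add: Vector_Spaces.linear_iff)
  next
    case (Suc m)
    then show ?case using lin(1)[of 1] by (simp add: Vector_Spaces.linear_iff)
  qed
  have Epow: "rep (E 1) ^\<^sub>m 7 * rep (E 2) - rep (E 2) * rep (E 1) ^\<^sub>m 7 = 1 \<cdot>\<^sub>m rep (E 2)"
  proof -
    have "rep (\<lambda>x. (E 1 ^^ 7) (E 2 x)) - rep (\<lambda>x. E 2 ((E 1 ^^ 7) x)) = 1 \<cdot>\<^sub>m rep (E 2)"
    proof (rule rep_comb)
      show "(E 1 ^^ 7) (E 2 x) \<in> V" for x by (rule pow_V[OF lin(2)]) simp
      show "E 2 x \<in> V" "E 2 ((E 1 ^^ 7) x) \<in> V" for x by (rule lin(2), simp)+
      show "(E 1 ^^ 7) (E 2 x) = E 2 ((E 1 ^^ 7) x) + scale 1 (E 2 x)" for x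
        unfolding E1_power_E2 scale_one ..
    qed
    moreover have "rep (\<lambda>x. (E 1 ^^ 7) (E 2 x)) = rep (E 1 ^^ 7) * rep (E 2)"
      by (rule rep_comp[OF powlin pow_V lin(2)]) simp_all
    moreover have "rep (\<lambda>x. E 2 ((E 1 ^^ 7) x)) = rep (E 2) * rep (E 1 ^^ 7)"
      by (rule rep_comp[OF lin(1) lin(2) pow_V]) simp_all
    ultimately show ?thesis by (simp only: rep_pow)
  qed
  have one_smult: "1 \<cdot>\<^sub>m rep (E 2) = rep (E 2)" by (rule eq_matI) auto
  have "char_poly (rep (E 1)) = monom 1 7 - monom 1 1"
  proof (rule char_poly_toral[of "rep (E 1)" G G' "rep (E 0)" "rep (E 2)" "rep (E 3)"])
    show "G \<in> carrier_mat 7 7" "G' \<in> carrier_mat 7 7" by (simp_all add: G_def G'_def)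
    show "rep (E 1) * rep (E 2) - rep (E 2) * rep (E 1) = rep (E 2)" using E2E unfolding one_smult .
    show "rep (E 1) ^\<^sub>m 7 * rep (E 2) - rep (E 2) * rep (E 1) ^\<^sub>m 7 = rep (E 2)" using Epow unfolding one_smult .
  qed (fact char inv skew E02 E03 E2V | rule rep_carrier)+
  moreover have "\<forall>c<7. (of_nat c :: 'f) ^ 7 = of_nat c"
    unfolding all_less_7 by (simp add: char7_numerals[OF char])
  ultimately have "poly (char_poly (rep (E 1))) (of_nat c) = 0"
    using assms by (simp add: poly_monom)
  then have "eigenvalue (rep (E 1)) (of_nat c)"
    using eigenvalue_root_char_poly[of "rep (E 1)" 7] by simp
  then obtain v where v: "v \<in> carrier_vec 7" "v \<noteq> 0\<^sub>v 7" "rep (E 1) *\<^sub>v v = of_nat c \<cdot>\<^sub>v v"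
    unfolding eigenvalue_def eigenvector_def by (auto simp: rep_def)
  define u where "u = (\<Sum>i<7. scale (v $ i) (y i))"
  have uV: "u \<in> V" unfolding u_def by (rule B.comb_in)
  have cu: "B.coord u i = v $ i" if "i < 7" for i
    unfolding u_def by (rule B.coord_comb[OF that])
  have "u \<noteq> 0"
  proof
    assume "u = 0"
    then have "v $ i = 0" if "i < 7" for i using cu[OF that] by simp
    then have "v = 0\<^sub>v 7" using v(1) by (intro eq_vecI) auto
    with v(2) show False ..
  qed
  moreover have "E 1 u = scale (of_nat c) u"
  proof (rule B.coord_eqI)
    fix i :: nat assume i: "i < 7"
    have "B.coord (E 1 u) i = (\<Sum>j<7. rep (E 1) $$ (i, j) * v $ j)"
      using rep_apply[OF lin(1)[of 1] lin(2)[of 1] uV i] by (simp add: cu)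
    also have "\<dots> = (rep (E 1) *\<^sub>v v) $ i"
      using i v(1) by (simp add: scalar_prod_def atLeast0LessThan rep_def)
    also have "\<dots> = of_nat c * B.coord u i" unfolding v(3) using i v(1) by (simp add: cu)
    finally show "B.coord (E 1 u) i = B.coord (scale (of_nat c) u) i"
      by (simp only: B.coord_scale[OF uV])
  qed (use lin(2)[of 1 u] B.scale_in[OF uV] in auto)
  ultimately show ?thesis using uV by blast
qed

end

section \<open>The action is the action on half densities\<close>

context witt_action
begin

lemmas E_lin = E_simps(1-8)

definition weight_vector :: "nat \<Rightarrow> 'a" where
  "weight_vector c = (SOME u. u \<in> V \<and> u \<noteq> 0 \<and> E 1 u = scale (of_nat c) u)"

lemma weight_vector:
  assumes "c < 7"
  shows "weight_vector c \<in> V" "weight_vector c \<noteq> 0" "E 1 (weight_vector c) = scale (of_nat c) (weight_vector c)"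
proof -
  have "\<exists>u. u \<in> V \<and> u \<noteq> 0 \<and> E 1 u = scale (of_nat c) u"
    using weight_vector_exists[OF assms] by blast
  from someI_ex[OF this] show "weight_vector c \<in> V" "weight_vector c \<noteq> 0"
    "E 1 (weight_vector c) = scale (of_nat c) (weight_vector c)"
    unfolding weight_vector_def by blast+
qed

lemma eigenbasis:
  assumes l: "inj_on l {..<7}" and w: "\<And>i. i < 7 \<Longrightarrow> w i \<in> V" "\<And>i. i < 7 \<Longrightarrow> w i \<noteq> 0"
    "\<And>i. i < 7 \<Longrightarrow> E 1 (w i) = scale (l i) (w i)"
  shows "frame scale V 7 w"
proof (rule frame_exchange[OF V_frame w(1)])
  show "indep_family scale 7 w"
    by (rule eigenvectors_independent[OF E_simps(10)[of 1] l w(3) w(2)]) simp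
qed

text \<open>
  The seven weights are distinct and \<open>V\<close> has dimension 7, so all weight spaces are lines.
\<close>

lemma weight_space:
  assumes x: "x \<in> V" "E 1 x = scale l x" and c: "l = of_nat c" "c < 7"
    and x': "x' \<in> V" "x' \<noteq> 0" "E 1 x' = scale l x'"
  shows "\<exists>a. x = scale a x'"
proof -
  define w where "w = (\<lambda>i. if i = c then x' else weight_vector i)"
  interpret W: frame scale V 7 w
  proof (rule eigenbasis[OF of_nat_inj_char7[OF char]])
    fix i :: nat assume "i < 7"
    then show "w i \<in> V" "w i \<noteq> 0" "E 1 (w i) = scale (of_nat i) (w i)"
      using weight_vector[of i] x' c by (auto simp: w_def)
  qed
  have co: "W.coord x i = 0" if i: "i < 7" "i \<noteq> c" for i
  proof -
    have ew: "E 1 (w k) = scale (of_nat k) (w k)" if "k < 7" for k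
      using weight_vector(3)[OF that] x' c by (auto simp: w_def)
    have "E 1 x = (\<Sum>k<7. scale (W.coord x k) (E 1 (w k)))"
      by (rule W.linear_frame_expansion[OF E_simps(10) x(1)]) simp
    also have "\<dots> = (\<Sum>k<7. scale (W.coord x k * of_nat k) (w k))"
      by (rule sum.cong[OF refl]) (simp only: ew lessThan_iff scale_scale)
    finally have "l * W.coord x i = W.coord x i * of_nat i"
      using W.coord_comb[OF i(1), of "\<lambda>k. W.coord x k * of_nat k"] W.coord_scale[OF x(1), of l i] x(2) by simp
    moreover have "(of_nat i :: 'f) \<noteq> of_nat c"
      using inj_onD[OF of_nat_inj_char7[OF char], of i c] i c by auto
    ultimately show ?thesis using c(1) by (simp add: mult.commute)
  qed
  have wc: "w c = x'" by (simp add: w_def)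
  have "x = (\<Sum>i<7. scale (W.coord x i) (w i))" by (rule W.sum_coord[OF x(1), symmetric])
  also have "\<dots> = (\<Sum>i<7. if i = c then scale (W.coord x c) x' else 0)"
    by (rule sum.cong[OF refl]) (auto simp: co wc)
  also have "\<dots> = scale (W.coord x c) x'" using c by simp
  finally show ?thesis by blast
qed

lemma weight_orthogonal:
  assumes "E 1 x = scale l x" "E 1 x' = scale l' x'" "l + l' \<noteq> 0"
  shows "polar norm x x' = 0"
proof -
  have "l * polar norm x x' = - (l' * polar norm x x')"
    using E_simps(9)[of 1 x x'] assms by (simp add: polar_simps)
  then have "(l + l') * polar norm x x' = 0" by (simp add: distrib_right)
  with assms(3) show ?thesis by simp
qed

lemma polar_nonzero_V:
  assumes "x \<in> V" "x \<noteq> 0"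
  shows "\<exists>x'\<in>V. polar norm x x' \<noteq> 0"
proof -
  obtain z where z: "polar norm x z \<noteq> 0" using norm_nondegenerate assms(2) by blast
  define z' where "z' = z - scale (polar norm z one / 2) one"
  have "z' \<in> V" using char7_ne[OF char] by (simp add: z'_def polar_simps polar_one_one)
  moreover have "polar norm x z' = polar norm x z" using assms(1) by (simp add: z'_def polar_simps)
  ultimately show ?thesis using z by metis
qed

text \<open>
  \<open>x\<close> is orthogonal to all weight spaces but that of weight \<open>- l\<close>, and the form is nondegenerate on \<open>V\<close>.
\<close>

lemma weight_dual_nonzero:
  assumes x: "x \<in> V" "x \<noteq> 0" "E 1 x = scale l x" and x': "x' \<in> V" "x' \<noteq> 0" "E 1 x' = scale (- l) x'"
    and c: "- l = of_nat c" "c < 7"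
  shows "polar norm x x' \<noteq> 0"
proof
  assume z: "polar norm x x' = 0"
  interpret W: frame scale V 7 weight_vector
    by (rule eigenbasis[OF of_nat_inj_char7[OF char]]) (use weight_vector in auto)
  have p: "polar norm x (weight_vector i) = 0" if i: "i < 7" for i
  proof (cases "i = c")
    case True
    obtain a where "weight_vector c = scale a x'"
      using weight_space[of "weight_vector c" "- l" c x'] weight_vector[OF c(2)] c x' by auto
    then show ?thesis using True z by (simp add: polar_simps)
  next
    case False
    then have "(of_nat i :: 'f) \<noteq> of_nat c"
      using inj_onD[OF of_nat_inj_char7[OF char], of i c] i c by auto
    then have "l + of_nat i \<noteq> 0" using c(1) by (metis add_eq_0_iff)
    then show ?thesis using weight_orthogonal[OF x(3) weight_vector(3)[OF i]] by simp
  qed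
  have "polar norm x v = 0" if "v \<in> V" for v
    using W.linear_frame_expansion[OF polar_linear(2)[of x] that] p by simp
  with polar_nonzero_V[OF x(1,2)] show False by blast
qed

text \<open>
  The vector of weight 3 has the weight of \<open>x^6 (dx)^{1/2}\<close>, and \<open>d/dx\<close> maps \<open>x^{6-m}\<close> to \<open>(6 - m) x^{5-m}\<close>;
  the factors \<open>1 / (6 - m)\<close> are chosen accordingly.
\<close>

definition lowered :: "nat \<Rightarrow> 'a" where
  "lowered m = rec_nat (weight_vector 3) (\<lambda>m x. scale (1 / of_nat (6 - m)) (E 0 x)) m"

lemma lowered_0: "lowered 0 = weight_vector 3"
  and lowered_Suc: "lowered (Suc m) = scale (1 / of_nat (6 - m)) (E 0 (lowered m))"
  by (simp_all add: lowered_def)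

lemma of_nat_nonzero_char7: "0 < m \<Longrightarrow> m < 7 \<Longrightarrow> (of_nat m :: 'f) \<noteq> 0"
  using inj_onD[OF of_nat_inj_char7[OF char], of m 0] by auto

text \<open>
  The image has weight 4, which is \<open>-3\<close>. So it is a multiple of a vector that pairs nontrivially with the vector
  of weight 3, whereas \<open>E 2 x\<close> is orthogonal to \<open>x\<close>.
\<close>

lemma raise_top: "E 2 (weight_vector 3) = 0"
proof -
  note [simp del] = One_nat_def and [simp] = One_nat_def[symmetric]
  let ?x = "weight_vector 3"
  note w3 = weight_vector[of 3, simplified] and w4 = weight_vector[of 4, simplified]
  have E1x: "E 1 ?x = scale 3 ?x" using weight_vector(3)[of 3] by simp
  have "E 1 (E 2 ?x) = scale 3 (E 2 ?x) + E 2 ?x"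
    using E_bracket(1)[of ?x] E_simps(2)[of 2 3 ?x] unfolding E1x by simp
  also have "\<dots> = scale 4 (E 2 ?x)" using scale_left_distrib[of 3 1 "E 2 ?x"] by simp
  finally have "E 1 (E 2 ?x) = scale 4 (E 2 ?x)" .
  then have "\<exists>a. E 2 ?x = scale a (weight_vector 4)"
    by (intro weight_space[where l = 4 and c = 4]) (use w4 E_simps(7)[of 2 ?x] in simp_all)
  then obtain a where a: "E 2 ?x = scale a (weight_vector 4)" ..
  have "polar norm (E 2 ?x) ?x = 0"
    using derivation_isotropic[OF E_der, of 2 ?x] by (simp add: polar_commute)
  then have "a * polar norm (weight_vector 4) ?x = 0" by (simp add: a polar_simps)
  moreover have "polar norm ?x (weight_vector 4) \<noteq> 0"
    by (rule weight_dual_nonzero[where l = 3 and c = 4]) (use w3 w4 in \<open>simp_all add: char7_numerals[OF char]\<close>)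
  ultimately show ?thesis using a by (simp add: polar_commute)
qed

text \<open>
  As for representations of \<open>sl_2\<close>: the action of \<open>E 2\<close> on the lowered vectors follows by induction from
  \<open>[E_0, E_2] = 2 E_1\<close> and \<open>raise_top\<close>. In particular no lowered vector vanishes, as \<open>E 2\<close> leads back up.
\<close>

lemma lowered_props:
  assumes "m < 7"
  shows "lowered m \<in> V" "lowered m \<noteq> 0" "E 1 (lowered m) = scale (3 - of_nat m) (lowered m)"
    "m < 6 \<Longrightarrow> E 0 (lowered m) = scale (of_nat (6 - m)) (lowered (Suc m))"
    "E 2 (lowered m) = (if m = 0 then 0 else scale (of_nat (7 - m)) (lowered (m - 1)))"
proof -
  note [simp del] = One_nat_def and [simp] = One_nat_def[symmetric]
  have E0: "E 0 (lowered m) = scale (of_nat (6 - m)) (lowered (Suc m))" if "m < 6" for m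
    using of_nat_nonzero_char7[of "6 - m"] that by (simp add: lowered_Suc)
  show "m < 6 \<Longrightarrow> E 0 (lowered m) = scale (of_nat (6 - m)) (lowered (Suc m))" by (rule E0)
  have wt: "E 1 (lowered m) = scale (3 - of_nat m) (lowered m)" for m
  proof (induction m)
    case 0
    show ?case using weight_vector(3)[of 3] by (simp add: lowered_0)
  next
    case (Suc m)
    have "E 1 (E 0 (lowered m)) = scale (3 - of_nat m) (E 0 (lowered m)) - E 0 (lowered m)"
      by (simp only: E_bracket(2) Suc) (simp add: E_lin)
    also have "\<dots> = scale (3 - of_nat (Suc m)) (E 0 (lowered m))"
      using scale_left_diff_distrib[of "3 - of_nat m" 1 "E 0 (lowered m)"] by (simp add: diff_diff_eq add.commute)
    finally show ?case
      by (simp add: lowered_Suc E_lin mult.commute del: of_nat_Suc)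
  qed
  then show "E 1 (lowered m) = scale (3 - of_nat m) (lowered m)" .
  show "lowered m \<in> V"
    using weight_vector(1)[of 3] by (cases m) (simp_all add: lowered_0 lowered_Suc polar_simps E_lin)
  have E2: "E 2 (lowered m) = (if m = 0 then 0 else scale (of_nat (7 - m)) (lowered (m - 1)))" if "m < 7" for m
    using that
  proof (induction m)
    case 0
    show ?case by (simp add: lowered_0 raise_top)
  next
    case (Suc m)
    define a :: 'f where "a = of_nat (6 - m)"
    have a: "a \<noteq> 0" using of_nat_nonzero_char7[of "6 - m"] Suc.prems by (simp add: a_def)
    \<comment> \<open>Everything is expressed by \<open>a = 6 - m\<close>, as in characteristic 7 the numbers then combine to \<open>a^2\<close>.\<close>
    have am: "of_nat m = 6 - a" "(of_nat (7 - m) :: 'f) = a + 1"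
    proof -
      have "m + (6 - m) = 6" "7 - m = (6 - m) + 1" using Suc.prems by auto
      then have "(of_nat m :: 'f) + of_nat (6 - m) = of_nat 6" "(of_nat (7 - m) :: 'f) = of_nat ((6 - m) + 1)"
        by (simp_all only: of_nat_add[symmetric])
      then show "of_nat m = 6 - a" "(of_nat (7 - m) :: 'f) = a + 1" by (simp_all add: a_def eq_diff_eq)
    qed
    have "E 0 (E 2 (lowered m)) = scale ((a + 1) * (a + 1)) (lowered m)"
    proof (cases m)
      case 0
      have "(a + 1) * (a + 1) = 0" using char by (simp add: a_def 0)
      then show ?thesis by (simp add: 0 lowered_0 raise_top E_lin)
    next
      case (Suc m')
      then have "6 - m' = 7 - m" by simp
      then show ?thesis using Suc.IH Suc.prems E0[of m'] Suc am by (simp add: E_lin add.commute)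
    qed
    then have "E 2 (E 0 (lowered m)) = scale ((a + 1) * (a + 1)) (lowered m) - scale 2 (E 1 (lowered m))"
      using E_bracket(4)[of "lowered m"] by (simp add: eq_diff_eq)
    also have "\<dots> = scale ((a + 1) * (a + 1) - 2 * (3 - of_nat m)) (lowered m)"
      by (simp only: wt scale_scale scale_left_diff_distrib[of _ "2 * (3 - of_nat m)"])
    also have "(a + 1) * (a + 1) - 2 * (3 - of_nat m) = a * a + 7" by (simp add: am algebra_simps)
    finally have "E 2 (E 0 (lowered m)) = scale (a * a) (lowered m)" using char by simp
    then show ?case using a by (simp add: lowered_Suc E_lin flip: a_def)
  qed
  then show "E 2 (lowered m) = (if m = 0 then 0 else scale (of_nat (7 - m)) (lowered (m - 1)))" using assms by simp
  show "lowered m \<noteq> 0"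
    using assms
  proof (induction m)
    case 0
    show ?case using weight_vector(2)[of 3] by (simp add: lowered_0)
  next
    case (Suc m)
    have "E 2 (lowered (Suc m)) = scale (of_nat (6 - m)) (lowered m)" using E2[of "Suc m"] Suc.prems by simp
    moreover have "scale (of_nat (6 - m)) (lowered m) \<noteq> 0"
      using Suc of_nat_nonzero_char7[of "6 - m"] by simp
    ultimately show ?case using E_simps(5)[of 2] by auto
  qed
qed

text \<open>
  Reversed numbering, so that \<open>z i\<close> corresponds to \<open>x^i (dx)^{1/2}\<close>.
\<close>

definition z :: "nat \<Rightarrow> 'a" where "z i = lowered (6 - i)"

lemma z_props:
  assumes "i < 7"
  shows "z i \<in> V" "z i \<noteq> 0" "E 1 (z i) = scale (of_nat (i + 4)) (z i)"
    "0 < i \<Longrightarrow> E 0 (z i) = scale (of_nat i) (z (i - 1))"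
    "i < 6 \<Longrightarrow> E 2 (z i) = scale (of_nat (i + 1)) (z (i + 1))"
    "E 2 (z 6) = 0"
proof -
  have m: "6 - i < 7" using assms by simp
  show "z i \<in> V" "z i \<noteq> 0" using lowered_props[OF m] by (simp_all add: z_def)
  have "(6 - i) + i = 6" using assms by simp
  then have "(of_nat (6 - i) :: 'f) + of_nat i = of_nat 6" by (simp only: of_nat_add[symmetric])
  then have "(of_nat (6 - i) :: 'f) = 6 - of_nat i" by (simp add: eq_diff_eq)
  moreover have "(3 :: 'f) - (6 - of_nat i) = of_nat (i + 4) - 7" by simp
  ultimately have "(3 :: 'f) - of_nat (6 - i) = of_nat (i + 4)" using char by simp
  then show "E 1 (z i) = scale (of_nat (i + 4)) (z i)" using lowered_props(3)[OF m] by (simp only: z_def)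
  show "E 0 (z i) = scale (of_nat i) (z (i - 1))" if "0 < i"
  proof -
    have "6 - (6 - i) = i" "Suc (6 - i) = 6 - (i - 1)" using assms that by auto
    then show ?thesis using lowered_props(4)[OF m] that assms by (simp add: z_def)
  qed
  show "E 2 (z i) = scale (of_nat (i + 1)) (z (i + 1))" if "i < 6"
  proof -
    have "7 - (6 - i) = i + 1" "6 - i - 1 = 6 - (i + 1)" "6 - i \<noteq> 0" using that by auto
    then show ?thesis using lowered_props(5)[OF m] by (simp only: z_def if_False)
  qed
  show "E 2 (z 6) = 0" using lowered_props(5)[of 0] by (simp add: z_def)
qed

lemma z_frame: "frame scale V 7 z"
proof (rule eigenbasis[where l = "\<lambda>i. of_nat (i + 4)"])
  show "inj_on (\<lambda>i. of_nat (i + 4) :: 'f) {..<7}"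
    using of_nat_inj_char7[OF char] by (auto simp: inj_on_def)
qed (use z_props in auto)

lemma z_polar_nonzero: "polar norm (z 0) (z 6) \<noteq> 0"
proof (rule weight_dual_nonzero[where l = 4 and c = 3])
  show "E 1 (z 0) = scale 4 (z 0)" using z_props(3)[of 0] by simp
  have "(of_nat (6 + 4) :: 'f) = - 4" by (simp add: char7_numerals[OF char])
  then show "E 1 (z 6) = scale (- 4) (z 6)" using z_props(3)[of 6] by (simp only:)
qed (use z_props[of 0] z_props[of 6] in \<open>simp_all add: char7_numerals[OF char]\<close>)

text \<open>
  Off the antidiagonal the weights do not cancel. Along the antidiagonal the value is constant because \<open>E 0\<close> is skew.
\<close>

lemma z_polar:
  assumes "i < 7" "j < 7"
  shows "polar norm (z i) (z j) = (if i + j = 6 then polar norm (z 0) (z 6) else 0)"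
proof -
  have off: "polar norm (z i) (z j) = 0" if "i < 7" "j < 7" "i + j \<noteq> 6" for i j
  proof (rule weight_orthogonal[OF z_props(3) z_props(3)])
    have "\<forall>i<7. \<forall>j<7. i + j \<noteq> 6 \<longrightarrow> (of_nat (i + 4) + of_nat (j + 4) :: 'f) \<noteq> 0"
      unfolding all_less_7 by (simp add: char7_numerals[OF char] char7_ne[OF char])
    then show "(of_nat (i + 4) + of_nat (j + 4) :: 'f) \<noteq> 0" using that by blast
  qed (use that in auto)
  have on: "polar norm (z i) (z (6 - i)) = polar norm (z 0) (z 6)" if "i \<le> 6" for i
    using that
  proof (induction i)
    case (Suc i)
    have e: "E 0 (z (Suc i)) = scale (of_nat (Suc i)) (z i)" using z_props(4)[of "Suc i"] Suc.prems by simp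
    have e': "E 0 (z (6 - i)) = scale (of_nat (6 - i)) (z (6 - Suc i))"
      using z_props(4)[of "6 - i"] Suc.prems by simp
    have "(Suc i) + (6 - i) = 7" using Suc.prems by simp
    then have "(of_nat (Suc i) :: 'f) + of_nat (6 - i) = of_nat 7" by (simp only: of_nat_add[symmetric])
    then have s: "(of_nat (6 - i) :: 'f) = - of_nat (Suc i)" using char by (metis eq_neg_iff_add_eq_0 add.commute of_nat_numeral)
    have "of_nat (Suc i) * polar norm (z i) (z (6 - i)) = of_nat (Suc i) * polar norm (z (Suc i)) (z (6 - Suc i))"
      using E_simps(9)[of 0 "z (Suc i)" "z (6 - i)"] unfolding e e' s by (simp add: polar_simps del: of_nat_Suc)
    then show ?case using Suc of_nat_nonzero_char7[of "Suc i"] by (simp del: of_nat_Suc)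
  qed simp
  show ?thesis
  proof (cases "i + j = 6")
    case True
    then have "j = 6 - i" "i \<le> 6" by auto
    then show ?thesis using on[of i] True by simp
  qed (use off[OF assms] in simp)
qed

text \<open>
  The weight of \<open>E 0 (z 0)\<close> is that of \<open>z 6\<close>, which pairs nontrivially with \<open>z 0\<close>, but \<open>E 0 (z 0)\<close> is
  orthogonal to \<open>z 0\<close>.
\<close>

lemma E0_z0: "E 0 (z 0) = 0"
proof -
  note [simp del] = One_nat_def and [simp] = One_nat_def[symmetric]
  have E1z: "E 1 (z 0) = scale 4 (z 0)" using z_props(3)[of 0] by simp
  have "E 1 (E 0 (z 0)) = scale 4 (E 0 (z 0)) - E 0 (z 0)"
    using E_bracket(2)[of "z 0"] E_simps(2)[of 0 4 "z 0"] unfolding E1z by simp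
  also have "\<dots> = scale 3 (E 0 (z 0))" using scale_left_diff_distrib[of 4 1 "E 0 (z 0)"] by simp
  finally have "E 1 (E 0 (z 0)) = scale 3 (E 0 (z 0))" .
  moreover have "(of_nat (6 + 4) :: 'f) = 3" by (simp add: char7_numerals[OF char])
  ultimately have "\<exists>a. E 0 (z 0) = scale a (z 6)"
    by (intro weight_space[where l = 3 and c = 3]) (use z_props(1-3)[of 6] E_simps(7)[of 0 "z 0"] in simp_all)
  then obtain a where a: "E 0 (z 0) = scale a (z 6)" ..
  have "polar norm (E 0 (z 0)) (z 0) = 0"
    using derivation_isotropic[OF E_der, of 0 "z 0"] by (simp add: polar_commute)
  then show ?thesis using a z_polar_nonzero by (simp add: polar_simps polar_commute)
qed

lemma E3_z: "\<exists>f. \<forall>i<7. E 3 (z i) = scale (f i) (z ((i + 2) mod 7))"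
proof -
  have "\<exists>a. E 3 (z i) = scale a (z ((i + 2) mod 7))" if i: "i < 7" for i
  proof (rule weight_space[where c = "(i + 6) mod 7" and l = "of_nat (i + 6)"])
    have "E 1 (E 3 (z i)) = scale (of_nat (i + 4)) (E 3 (z i)) + scale 2 (E 3 (z i))"
      unfolding E_bracket(3) z_props(3)[OF i] by (simp only: E_simps(2)[of 3, simplified])
    also have "\<dots> = scale (of_nat (i + 4) + 2) (E 3 (z i))" by (simp only: scale_left_distrib)
    also have "(of_nat (i + 4) + 2 :: 'f) = of_nat (i + 6)" by (simp add: add.assoc)
    finally show "E 1 (E 3 (z i)) = scale (of_nat (i + 6)) (E 3 (z i))" .
    note mod7 = of_nat_mod_char7[OF char]
    then show "(of_nat (i + 6) :: 'f) = of_nat ((i + 6) mod 7)" by (rule sym)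
    have "(of_nat ((i + 2) mod 7 + 4) :: 'f) = of_nat (i + 6)"
      using mod7[of "i + 2"] by (simp only: of_nat_add) simp
    then show "E 1 (z ((i + 2) mod 7)) = scale (of_nat (i + 6)) (z ((i + 2) mod 7))"
      using z_props(3)[of "(i + 2) mod 7"] by (simp only: mod_less_divisor zero_less_numeral)
  qed (use z_props[of "(i + 2) mod 7"] in \<open>simp_all add: E_lin\<close>)
  then show ?thesis by metis
qed

text \<open>
  \<open>E 0\<close>, \<open>E 1\<close> and \<open>E 2\<close> are known on the basis, and \<open>E 3\<close> is known by weights up to the scalars \<open>f i\<close>. The
  relation \<open>[E_0, E_3] = 3 E_2\<close> determines these up to a single one, which is written as \<open>\<phi>\<close>: the action is
  that on half densities for the parameter \<open>\<phi>\<close>. As \<open>E 2\<close> and \<open>E 3\<close> generate \<open>E 4, E 5, E 6\<close>, the parameter is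
  then identified by \<open>[E_2, E_6] = 4 \<alpha> E_0\<close>.
\<close>

lemma E_z: "k < 7 \<Longrightarrow> i < 7 \<Longrightarrow> E k (z i) = density_action scale \<alpha> z k i"
proof -
  note [simp del] = One_nat_def and [simp] = One_nat_def[symmetric]
  obtain f where f: "\<And>i. i < 7 \<Longrightarrow> E 3 (z i) = scale (f i) (z ((i + 2) mod 7))" using E3_z by blast
  note num = char7_numerals[OF char]
  have ne: "z i \<noteq> 0" if "i < 7" for i by (rule z_props(2)[OF that])
  have e0: "E 0 (z 0) = 0" "E 0 (z 1) = z 0" "E 0 (z 2) = scale 2 (z 1)" "E 0 (z 3) = scale 3 (z 2)"
    "E 0 (z 4) = scale 4 (z 3)" "E 0 (z 5) = scale 5 (z 4)" "E 0 (z 6) = scale 6 (z 5)"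
    using z_props(4)[of 1] z_props(4)[of 2] z_props(4)[of 3] z_props(4)[of 4] z_props(4)[of 5] z_props(4)[of 6]
    by (simp_all add: E0_z0)
  have e2: "E 2 (z 0) = z 1" "E 2 (z 1) = scale 2 (z 2)" "E 2 (z 2) = scale 3 (z 3)" "E 2 (z 3) = scale 4 (z 4)"
    "E 2 (z 4) = scale 5 (z 5)" "E 2 (z 5) = scale 6 (z 6)" "E 2 (z 6) = 0"
    using z_props(5)[of 0] z_props(5)[of 1] z_props(5)[of 2] z_props(5)[of 3] z_props(5)[of 4] z_props(5)[of 5] z_props(6)[of 0]
    by simp_all
  have e3: "E 3 (z 0) = scale (f 0) (z 2)" "E 3 (z 1) = scale (f 1) (z 3)" "E 3 (z 2) = scale (f 2) (z 4)"
    "E 3 (z 3) = scale (f 3) (z 5)" "E 3 (z 4) = scale (f 4) (z 6)" "E 3 (z 5) = scale (f 5) (z 0)" "E 3 (z 6) = scale (f 6) (z 1)"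
    using f[of 0] f[of 1] f[of 2] f[of 3] f[of 4] f[of 5] f[of 6] by simp_all
  have cancel: "a = b" if "scale a (z i) = scale b (z i)" "i < 7" for a b i
    using scale_right_imp_eq[OF ne[OF that(2)] that(1)] .
  \<comment> \<open>Both sides of \<open>[E_0, E_3] = 3 E_2\<close> on each basis vector; the equation at \<open>z 5\<close> has \<open>f 5\<close> with coefficient 0.\<close>
  have r: "f 0 * 2 = 3" "f 1 * 3 = f 0 + 3 * 2" "f 2 * 4 = 2 * f 1 + 3 * 3" "f 3 * 5 = 3 * f 2 + 3 * 4"
    "f 4 * 6 = 4 * f 3 + 3 * 5" "f 6 = 6 * f 5"
  proof -
    show "f 0 * 2 = 3" using E_bracket(5)[of "z 0"] cancel[of "f 0 * 2" 1 3] by (simp add: e0 e2 e3 E_lin)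
    have "scale (f 1 * 3) (z 2) = scale (f 0 + 3 * 2) (z 2)"
      using E_bracket(5)[of "z 1"] by (simp add: e0 e2 e3 E_lin scale_left_distrib)
    then show "f 1 * 3 = f 0 + 3 * 2" by (rule cancel) simp
    have "scale (f 2 * 4) (z 3) = scale (2 * f 1 + 3 * 3) (z 3)"
      using E_bracket(5)[of "z 2"] by (simp add: e0 e2 e3 E_lin scale_left_distrib)
    then show "f 2 * 4 = 2 * f 1 + 3 * 3" by (rule cancel) simp
    have "scale (f 3 * 5) (z 4) = scale (3 * f 2 + 3 * 4) (z 4)"
      using E_bracket(5)[of "z 3"] by (simp add: e0 e2 e3 E_lin scale_left_distrib)
    then show "f 3 * 5 = 3 * f 2 + 3 * 4" by (rule cancel) simp
    have "scale (f 4 * 6) (z 5) = scale (4 * f 3 + 3 * 5) (z 5)"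
      using E_bracket(5)[of "z 4"] by (simp add: e0 e2 e3 E_lin scale_left_distrib)
    then show "f 4 * 6 = 4 * f 3 + 3 * 5" by (rule cancel) simp
    have "scale (f 6) (z 0) = scale (6 * f 5) (z 0)"
      using E_bracket(5)[of "z 6"] by (simp add: e0 e2 e3 E_lin)
    then show "f 6 = 6 * f 5" by (rule cancel) simp
  qed
  \<comment> \<open>Chosen so that \<open>f 5 = 3 \<phi>\<close>, the value for half densities with parameter \<open>\<phi>\<close>.\<close>
  define \<phi> where "\<phi> = - 2 * f 5"
  have inv2: "x = b * 4" if "x * 2 = b" for x b :: 'f
  proof -
    have "b * 4 = x * (7 + 1)" using that by auto
    then show ?thesis using char by simp
  qed
  have inv3: "x = b * 5" if "x * 3 = b" for x b :: 'f
  proof -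
    have "b * 5 = x * (7 + 7 + 1)" using that by auto
    then show ?thesis using char by simp
  qed
  have inv4: "x = b * 2" if "x * 4 = b" for x b :: 'f
  proof -
    have "b * 2 = x * (7 + 1)" using that by auto
    then show ?thesis using char by simp
  qed
  have inv5: "x = b * 3" if "x * 5 = b" for x b :: 'f
  proof -
    have "b * 3 = x * (7 + 7 + 1)" using that by auto
    then show ?thesis using char by simp
  qed
  have inv6: "x = b * 6" if "x * 6 = b" for x b :: 'f
  proof -
    have "b * 6 = x * (7 + 7 + 7 + 7 + 7 + 1)" using that by auto
    then show ?thesis using char by simp
  qed
  have f0: "f 0 = 5" using inv2[OF r(1)] by (simp add: num)
  have f1: "f 1 = 6" using inv3[OF r(2)] by (simp add: f0 num)
  have f2: "f 2 = 0" using inv4[OF r(3)] by (simp add: f1 num)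
  have f3: "f 3 = 1" using inv5[OF r(4)] by (simp add: f2 num)
  have f4: "f 4 = 2" using inv6[OF r(5)] by (simp add: f3 num)
  have f5: "f 5 = 3 * \<phi>" by (simp add: \<phi>_def num)
  have f6: "f 6 = 4 * \<phi>" using r(6) by (simp add: \<phi>_def num)
  note e3 = e3[unfolded f0 f1 f2 f3 f4 f5 f6]
  have b: "E 4 x = E 2 (E 3 x) - E 3 (E 2 x)" "E 5 x = scale 4 (E 2 (E 4 x) - E 4 (E 2 x))"
    "E 6 x = scale 5 (E 2 (E 5 x) - E 5 (E 2 x))" for x
  proof -
    show "E 4 x = E 2 (E 3 x) - E 3 (E 2 x)" using E_bracket(6)[of x] by simp
    have "scale 4 (E 2 (E 4 x) - E 4 (E 2 x)) = scale 8 (E 5 x)" using E_bracket(7)[of x] by simp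
    then show "E 5 x = scale 4 (E 2 (E 4 x) - E 4 (E 2 x))" by (simp add: num)
    have "scale 5 (E 2 (E 5 x) - E 5 (E 2 x)) = scale 15 (E 6 x)" using E_bracket(8)[of x] by simp
    then show "E 6 x = scale 5 (E 2 (E 5 x) - E 5 (E 2 x))" by (simp add: num)
  qed
  have act3: "\<forall>i<7. E 3 (z i) = density_action scale \<phi> z 3 i"
    unfolding all_less_7 using e3 by (simp add: density_action_def wrap_def num)
  have act0: "\<forall>i<7. E 0 (z i) = density_action scale \<phi> z 0 i"
    unfolding all_less_7 using e0 by (simp add: density_action_def wrap_def num)
  have act2: "\<forall>i<7. E 2 (z i) = density_action scale \<phi> z 2 i"
    unfolding all_less_7 using e2 by (simp add: density_action_def wrap_def num)
  have act1: "\<forall>i<7. E 1 (z i) = density_action scale \<phi> z 1 i"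
    using z_props(3) by (simp add: density_action_def wrap_def)
  note del = One_nat_def scale_one scale_zero_left scale_minus_left
  have act4: "\<forall>i<7. E 4 (z i) = density_action scale \<phi> z 4 i"
    using act2 act3 unfolding all_less_7
    by (simp add: b(1) density_action_def wrap_def E_lin del: del flip: scale_left_diff_distrib)
       (simp add: num algebra_simps)
  have act5: "\<forall>i<7. E 5 (z i) = density_action scale \<phi> z 5 i"
    using act2 act4 unfolding all_less_7
    by (simp add: b(2) density_action_def wrap_def E_lin del: del flip: scale_left_diff_distrib)
       (simp add: num algebra_simps)
  have act6: "\<forall>i<7. E 6 (z i) = density_action scale \<phi> z 6 i"
    using act2 act5 unfolding all_less_7
    by (simp add: b(3) density_action_def wrap_def E_lin del: del flip: scale_left_diff_distrib)
       (simp add: num algebra_simps)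
  have "scale (4 * \<phi>) (E 0 (z 3)) = scale (4 * \<alpha>) (E 0 (z 3))"
  proof -
    have "E 2 (E 6 (z 3)) - E 6 (E 2 (z 3)) = scale (4 * \<phi>) (E 0 (z 3))"
      using act0 act2 act6 unfolding all_less_7
      by (simp add: density_action_def wrap_def E_lin num mult.commute)
    moreover have "E 2 (E 6 (z 3)) - E 6 (E 2 (z 3)) = scale (4 * \<alpha>) (E 0 (z 3))"
      unfolding E_bracket(9) by (rule add_diff_cancel_left')
    ultimately show ?thesis by (rule trans[OF sym])
  qed
  then have "scale (4 * \<phi> * 3) (z 2) = scale (4 * \<alpha> * 3) (z 2)" by (simp add: e0)
  then have "4 * \<phi> * 3 = 4 * \<alpha> * 3" by (rule cancel) simp
  then have "\<phi> = \<alpha>" using char7_ne[OF char] by (simp add: num)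
  then have "\<forall>k<7. \<forall>i<7. E k (z i) = density_action scale \<alpha> z k i"
    using act0 act1 act2 act3 act4 act5 act6 by (subst all_less_7) blast
  then show "k < 7 \<Longrightarrow> i < 7 \<Longrightarrow> E k (z i) = density_action scale \<alpha> z k i" by blast
qed

end

section \<open>Products of weight vectors and conjugacy of embeddings\<close>

lemma grozman_table_zero:
  assumes "i < 7" "j < 7" "\<not> (3 \<le> i + j \<and> i + j \<le> 9)"
  shows "grozman_table ! i ! j = 0"
proof -
  have "\<forall>i<7. \<forall>j<7. \<not> (3 \<le> i + j \<and> i + j \<le> 9) \<longrightarrow> grozman_table ! i ! j = 0"
    unfolding all_less_7 by (simp add: grozman_table_def)
  then show ?thesis using assms by blast
qed

context cayley_algebra
begin

text \<open>
  On elements of trace zero, \<open>polar norm (x x') v\<close> is an alternating trilinear form; this lemma and the next are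
  its two generating antisymmetries.
\<close>

lemma triple_swap12:
  assumes "polar norm x one = 0" "polar norm x' one = 0" "polar norm v one = 0"
  shows "polar norm (mul x x') v = - polar norm (mul x' x) v"
proof -
  have "polar norm (mul x x' + mul x' x) v = 0"
    unfolding anticommutator using assms by (simp add: polar_simps polar_commute[of one v])
  then show ?thesis by (simp add: polar_add_left eq_neg_iff_add_eq_0)
qed

lemma triple_swap23:
  assumes "polar norm x one = 0"
  shows "polar norm (mul x x') v = - polar norm (mul x v) x'"
  using polar_adjoint_left[of x x' v] assms
  by (simp add: conj_def mul_simps polar_simps polar_commute[of x'])

end

context witt_action
begin

definition triple :: "nat \<Rightarrow> nat \<Rightarrow> nat \<Rightarrow> 'f" where
  "triple i j k = polar norm (mul (z i) (z j)) (z k)"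

lemma z_one: "i < 7 \<Longrightarrow> polar norm (z i) one = 0"
  using z_props(1)[of i] by simp

text \<open>
  The alternating form vanishes on triples whose weights do not cancel, that is unless \<open>i + j + k = 2\<close> modulo 7.
  For pairwise distinct indices this leaves \<open>i + j + k = 9\<close>, and then invariance under \<open>E 0\<close> expresses all
  values by that at \<open>(1, 3, 5)\<close>.
\<close>

lemma triple_table:
  assumes "i < 7" "j < 7" "k < 7"
  shows "triple i j k = (if i + j + k = 9 then triple 1 3 5 * of_int (grozman_table ! i ! j) else 0)"
proof -
  note [simp del] = One_nat_def and [simp] = One_nat_def[symmetric]
  note num = char7_numerals[OF char]
  have swap12: "triple i j k = - triple j i k" if "i < 7" "j < 7" "k < 7" for i j k
    unfolding triple_def by (rule triple_swap12) (use that z_one in auto)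
  have swap23: "triple i j k = - triple i k j" if "i < 7" "j < 7" "k < 7" for i j k
    unfolding triple_def by (rule triple_swap23) (use that z_one in auto)
  have self: "a = 0" if "a = - a" for a :: 'f
  proof -
    have "a + a = 0" using that by (simp only: eq_neg_iff_add_eq_0)
    then have "2 * a = 0" by (simp only: mult_2)
    then show ?thesis using char7_ne[OF char] by simp
  qed
  have rep: "triple i i k = 0" "triple i k k = 0" "triple i k i = 0" if "i < 7" "k < 7" for i k
  proof -
    show a: "triple i i k = 0" using self[OF swap12[of i i k]] that by simp
    show "triple i k k = 0" using self[OF swap23[of i k k]] that by simp
    show "triple i k i = 0" using swap23[of i k i] a that by simp
  qed
  have weight: "triple i j k = 0" if "i < 7" "j < 7" "k < 7" "(i + j + k) mod 7 \<noteq> 2" for i j k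
  proof -
    have l: "E 1 (mul (z i) (z j)) = scale (of_nat (i + 4) + of_nat (j + 4)) (mul (z i) (z j))"
      using z_props(3)[OF that(1)] z_props(3)[OF that(2)]
      by (simp only: E_simps(8)[of 1, simplified] mul_simps scale_left_distrib)
    note mod7 = of_nat_mod_char7[OF char]
    have "(of_nat (i + 4) + of_nat (j + 4) + of_nat (k + 4) :: 'f) \<noteq> 0"
    proof
      assume "(of_nat (i + 4) + of_nat (j + 4) + of_nat (k + 4) :: 'f) = 0"
      then have "(of_nat ((i + 4) + (j + 4) + (k + 4)) :: 'f) = 0" unfolding of_nat_add .
      moreover have "(i + 4) + (j + 4) + (k + 4) = i + j + k + 12" by simp
      ultimately have "(of_nat (i + j + k + 12) :: 'f) = 0" by (simp only:)
      then have "(of_nat ((i + j + k + 12) mod 7) :: 'f) = of_nat 0" unfolding mod7 of_nat_0 .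
      then have "(i + j + k + 12) mod 7 = 0"
      proof (rule inj_onD[OF of_nat_inj_char7[OF char]])
        show "(i + j + k + 12) mod 7 \<in> {..<7}" unfolding lessThan_iff by (rule mod_less_divisor) (rule zero_less_numeral)
        show "0 \<in> {..<7::nat}" unfolding lessThan_iff by (rule zero_less_numeral)
      qed
      then obtain q where "i + j + k + 12 = 7 * q" by (metis dvdE mod_eq_0_iff_dvd)
      then have "i + j + k = 2 + 7 * (q - 2)" by arith
      then have "(i + j + k) mod 7 = 2" by (simp only: mod_mult_self2) simp
      with that(4) show False ..
    qed
    then show ?thesis
      unfolding triple_def using weight_orthogonal[OF l z_props(3)[OF that(3)]] by simp
  qed
  have lower: "E 0 (z i) = scale (of_nat i) (z (i - 1))" if "i < 7" for i
    using z_props(4)[OF that] E0_z0 by (cases "i = 0") auto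
  have inv: "of_nat i * triple (i - 1) j k + of_nat j * triple i (j - 1) k + of_nat k * triple i j (k - 1) = 0"
    if "i < 7" "j < 7" "k < 7" for i j k
    using E_simps(9)[of 0 "mul (z i) (z j)" "z k"]
    by (simp add: triple_def E_simps(8) lower that mul_simps polar_simps)
  have tr: "triple 1 4 4 = 0" "triple 2 2 5 = 0" by (rule rep; simp)+
  have a: "triple 0 4 5 = 3 * triple 1 3 5"
    using inv[of 1 4 5] tr by (simp add: num eq_neg_iff_add_eq_0 algebra_simps)
  have b: "triple 0 3 6 = - triple 1 3 5"
  proof -
    have "- (3 * triple 0 3 6) - triple 0 4 5 = 0" using inv[of 0 4 6] by (simp add: num)
    moreover have "3 * (triple 0 3 6 + triple 1 3 5) = - (- (3 * triple 0 3 6) - triple 0 4 5)"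
      by (simp add: a algebra_simps)
    ultimately have "3 * (triple 0 3 6 + triple 1 3 5) = 0" by (simp only: minus_zero)
    then have "triple 0 3 6 + triple 1 3 5 = 0" using char7_ne(2)[OF char] by (simp only: mult_eq_0_iff) simp
    then show ?thesis by (simp only: eq_neg_iff_add_eq_0)
  qed
  have c: "triple 1 2 6 = 3 * triple 1 3 5"
  proof -
    have "3 * triple 1 2 6 = 2 * triple 1 3 5"
      using inv[of 1 3 6] by (simp add: b num algebra_simps)
    then have "5 * (3 * triple 1 2 6) = 5 * (2 * triple 1 3 5)" by (simp only:)
    then have "15 * triple 1 2 6 = 10 * triple 1 3 5" by simp
    then show ?thesis by (simp add: num)
  qed
  have d: "triple 2 3 4 = triple 1 3 5"
  proof -
    have "2 * triple 1 3 5 - 2 * triple 2 3 4 = 0"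
      using inv[of 2 3 5] tr by (simp add: num)
    then show ?thesis using char7_ne[OF char] by simp
  qed
  note perms =
    swap23[of 1 5 3] swap12[of 3 1 5] swap23[of 3 5 1] swap12[of 5 1 3] swap12[of 5 3 1] swap23[of 2 4 3]
    swap12[of 3 2 4] swap23[of 3 4 2] swap12[of 4 2 3] swap12[of 4 3 2] swap23[of 0 5 4] swap12[of 4 0 5]
    swap23[of 4 5 0] swap12[of 5 0 4] swap12[of 5 4 0] swap23[of 0 6 3] swap12[of 3 0 6] swap23[of 3 6 0]
    swap12[of 6 0 3] swap12[of 6 3 0] swap23[of 1 6 2] swap12[of 2 1 6] swap23[of 2 6 1] swap12[of 6 1 2]
    swap12[of 6 2 1]
  have "\<forall>i<7. \<forall>j<7. \<forall>k<7. triple i j k = (if i + j + k = 9 then triple 1 3 5 * of_int (grozman_table ! i ! j) else 0)"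
    unfolding all_less_7
    by (simp add: rep weight grozman_table_def perms a b c d)
  then show ?thesis using assms by blast
qed

text \<open>
  The basis \<open>one, z 0, \<dots>, z 6\<close> is dual to itself up to order and scalars.
\<close>

lemma z_expansion:
  "x = scale (polar norm x one / 2) one + (\<Sum>k<7. scale (polar norm x (z (6 - k)) / polar norm (z 0) (z 6)) (z k))"
proof -
  let ?\<beta> = "polar norm (z 0) (z 6)"
  interpret Z: frame scale V 7 z by (rule z_frame)
  let ?s = "\<Sum>k<7. scale (polar norm x (z (6 - k)) / ?\<beta>) (z k)"
  define w where "w = x - (scale (polar norm x one / 2) one + ?s)"
  have sV: "?s \<in> V" by (rule Z.comb_in)
  have wV: "w \<in> V"
    using sV char7_ne[OF char] by (simp add: w_def polar_simps polar_one_one)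
  have "polar norm w (z m) = 0" if m: "m < 7" for m
  proof -
    have "polar norm ?s (z m) = (\<Sum>k<7. polar norm x (z (6 - k)) / ?\<beta> * polar norm (z k) (z m))"
      by (rule linear_comb[OF polar_linear(1)])
    also have "\<dots> = (\<Sum>k<7. if k = 6 - m then polar norm x (z m) else 0)"
    proof (rule sum.cong[OF refl])
      fix k :: nat assume "k \<in> {..<7}"
      then have k: "k < 7" by simp
      have "k + m = 6 \<longleftrightarrow> k = 6 - m" using m by auto
      then show "polar norm x (z (6 - k)) / ?\<beta> * polar norm (z k) (z m) = (if k = 6 - m then polar norm x (z m) else 0)"
        using z_polar[OF k m] z_polar_nonzero m by simp
    qed
    also have "\<dots> = polar norm x (z m)"
    proof -
      have "6 - m \<in> {..<7::nat}" by auto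
      then show ?thesis by (simp only: sum.delta finite_lessThan if_True)
    qed
    finally have "polar norm ?s (z m) = polar norm x (z m)" .
    then show ?thesis using z_one[OF m] by (simp add: w_def polar_simps polar_commute[of one])
  qed
  then have "polar norm w v = 0" if "v \<in> V" for v
    using Z.linear_frame_expansion[OF polar_linear(2)[of w] that] by simp
  then have "w = 0" using polar_nonzero_V[OF wV] by blast
  then show ?thesis by (simp add: w_def)
qed

text \<open>
  By the table of the trilinear form, the products of the \<open>z i\<close> are the required ones up to a factor \<open>\<tau>\<close> on
  the part of trace zero and a factor \<open>- \<beta> / 2\<close> on the unit. Left multiplication by \<open>z 3\<close> has square
  \<open>- norm (z 3) = - \<beta> / 2\<close> and \<open>z 6\<close> as an eigenvector of eigenvalue \<open>- \<tau>\<close>, so that \<open>\<tau>^2 = - \<beta> / 2\<close>.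
  Division of all \<open>z i\<close> by \<open>\<tau>\<close> therefore normalizes both factors.
\<close>

lemma adapted_basis_exists:
  "\<exists>v. half_density_basis v \<and> (\<forall>k<7. \<forall>i<7. E k (v i) = density_action scale \<alpha> v k i)"
proof -
  define \<beta> where "\<beta> = polar norm (z 0) (z 6)"
  \<comment> \<open>The table has the entry 1 at \<open>(1, 3, 5)\<close>, so this scalar compares the products with the table.\<close>
  define \<tau> where "\<tau> = triple 1 3 5 / \<beta>"
  have \<beta>: "\<beta> \<noteq> 0" using z_polar_nonzero by (simp add: \<beta>_def)
  have prod: "mul (z i) (z j) = scale (if i + j = 6 then - \<beta> / 2 else 0) one
      + scale (\<tau> * of_int (grozman_table ! i ! j)) (z (i + j - 3))" if ij: "i < 7" "j < 7" for i j
  proof -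
    have "polar norm (mul (z i) (z j)) one = - polar norm (z i) (z j)"
      using polar_adjoint_left[of "z i" "z j" one] z_one[OF ij(1)]
      by (simp add: conj_def polar_simps polar_commute)
    then have o: "polar norm (mul (z i) (z j)) one / 2 = (if i + j = 6 then - \<beta> / 2 else 0)"
      using z_polar[OF ij] by (simp add: \<beta>_def)
    have "(\<Sum>k<7. scale (polar norm (mul (z i) (z j)) (z (6 - k)) / \<beta>) (z k))
        = (\<Sum>k<7. if k = i + j - 3 then scale (\<tau> * of_int (grozman_table ! i ! j)) (z (i + j - 3)) else 0)"
    proof (rule sum.cong[OF refl])
      fix k :: nat assume "k \<in> {..<7}"
      then have k: "k < 7" "6 - k < 7" by auto
      have "polar norm (mul (z i) (z j)) (z (6 - k))
          = (if i + j + (6 - k) = 9 then triple 1 3 5 * of_int (grozman_table ! i ! j) else 0)"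
        using triple_table[OF ij k(2)] by (simp only: triple_def)
      moreover have "i + j + (6 - k) = 9 \<longleftrightarrow> k = i + j - 3 \<and> 3 \<le> i + j"
        using k by arith
      ultimately show "scale (polar norm (mul (z i) (z j)) (z (6 - k)) / \<beta>) (z k)
          = (if k = i + j - 3 then scale (\<tau> * of_int (grozman_table ! i ! j)) (z (i + j - 3)) else 0)"
        using grozman_table_zero[OF ij] by (auto simp: \<tau>_def)
    qed
    also have "\<dots> = scale (\<tau> * of_int (grozman_table ! i ! j)) (z (i + j - 3))"
    proof (cases "i + j - 3 < 7")
      case False
      then have "\<not> (3 \<le> i + j \<and> i + j \<le> 9)" by auto
      then show ?thesis using grozman_table_zero[OF ij] by simp
    qed simp
    finally show ?thesis
      using z_expansion[of "mul (z i) (z j)"] o by (simp add: \<beta>_def)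
  qed
  have \<tau>2: "\<tau> * \<tau> = - \<beta> / 2"
  proof -
    have z36: "mul (z 3) (z 6) = scale (- \<tau>) (z 6)"
      using prod[of 3 6] by (simp add: grozman_table_def)
    have c3: "conj (z 3) = - z 3" using z_one[of 3] by (simp add: conj_def)
    have "scale (- (\<tau> * \<tau>)) (z 6) = mul (conj (z 3)) (mul (z 3) (z 6))"
      by (simp add: z36 c3 mul_simps)
    also have "\<dots> = scale (norm (z 3)) (z 6)" by (rule conj_mul_mul)
    finally have eq: "scale (- (\<tau> * \<tau>)) (z 6) = scale (norm (z 3)) (z 6)" .
    have "z 6 \<noteq> 0" by (rule z_props(2)) simp
    then have "- (\<tau> * \<tau>) = norm (z 3)" using eq by (rule scale_right_imp_eq)
    then have "\<tau> * \<tau> = - norm (z 3)" by (metis minus_minus)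
    moreover have "2 * norm (z 3) = \<beta>"
      using z_polar[of 3 3] polar_self[of "z 3"] by (simp add: \<beta>_def)
    then have "norm (z 3) = \<beta> / 2" using char7_ne[OF char] by (simp add: eq_divide_eq mult.commute)
    ultimately show ?thesis by simp
  qed
  then have \<tau>: "\<tau> \<noteq> 0" using \<beta> char7_ne[OF char] by auto
  define v where "v = (\<lambda>i. scale (1 / \<tau>) (z i))"
  have vz: "density_action scale \<alpha> v k i = scale (1 / \<tau>) (density_action scale \<alpha> z k i)" for k i
    by (simp add: density_action_def v_def mult.commute)
  have fr: "frame scale V 7 v"
  proof (rule eigenbasis[where l = "\<lambda>i. of_nat (i + 4)"])
    show "inj_on (\<lambda>i. of_nat (i + 4) :: 'f) {..<7}"
      using of_nat_inj_char7[OF char] by (auto simp: inj_on_def)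
    fix i :: nat assume i: "i < 7"
    show "v i \<in> V" "v i \<noteq> 0" "E 1 (v i) = scale (of_nat (i + 4)) (v i)"
      using z_props[OF i] \<tau> E_simps(2)[of 1] by (simp_all add: v_def polar_simps mult.commute)
  qed
  interpret F: frame scale V 7 v by (rule fr)
  have "frame scale UNIV 8 (\<lambda>i. if i = 7 then one else v i)"
  proof (rule frame_if_dim[OF vector_space_axioms dim_8])
    show "indep_family scale 8 (\<lambda>i. if i = 7 then one else v i)"
      unfolding indep_family_def
    proof (intro allI impI)
      fix c i assume s: "(\<Sum>i<8. scale (c i) (if i = 7 then one else v i)) = 0" and i: "i < (8::nat)"
      have "{..<8::nat} = insert 7 {..<7}" by auto
      then have s': "scale (c 7) one + (\<Sum>i<7. scale (c i) (v i)) = 0" using s by simp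
      have "(\<Sum>i<7. scale (c i) (v i)) \<in> V" by (rule F.comb_in)
      then have "polar norm (scale (c 7) one + (\<Sum>i<7. scale (c i) (v i))) one = c 7 * 2"
        by (simp add: polar_simps polar_one_one)
      then have c7: "c 7 = 0" unfolding s' using char7_ne[OF char] by (simp add: polar_zero_left)
      then have "(\<Sum>i<7. scale (c i) (v i)) = 0" using s' by simp
      then have "c i = 0" if "i < 7" using indep_familyD[OF F.frame_indep _ that] by blast
      then show "c i = 0" using c7 i by (cases "i = 7") auto
    qed
  qed simp
  moreover have "mul (v i) (v j) = scale (if i + j = 6 then 1 else 0) one + scale (of_int (grozman i j)) (v (i + j - 3))"
    if ij: "i < 7" "j < 7" for i j
  proof -
    have "mul (v i) (v j) = scale (1 / (\<tau> * \<tau>)) (mul (z i) (z j))"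
      by (simp add: v_def mul_simps)
    also have "\<dots> = scale (1 / (\<tau> * \<tau>) * (if i + j = 6 then \<tau> * \<tau> else 0)) one
        + scale (1 / (\<tau> * \<tau>) * (\<tau> * of_int (grozman_table ! i ! j))) (z (i + j - 3))"
      unfolding prod[OF ij] \<tau>2[symmetric] by (simp add: scale_right_distrib)
    also have "1 / (\<tau> * \<tau>) * (if i + j = 6 then \<tau> * \<tau> else 0) = (if i + j = 6 then 1 else 0)"
      using \<tau> by simp
    also have "scale (1 / (\<tau> * \<tau>) * (\<tau> * of_int (grozman_table ! i ! j))) (z (i + j - 3))
        = scale (of_int (grozman i j)) (v (i + j - 3))"
      using \<tau> by (simp add: v_def grozman_char7[OF char ij])
    finally show ?thesis .
  qed
  moreover have "E k (v i) = density_action scale \<alpha> v k i" if "k < 7" "i < 7" for k i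
    using E_z[OF that] E_simps(2)[OF that(1)] by (simp add: vz) (simp add: v_def)
  ultimately show ?thesis
    unfolding half_density_basis_def by blast
qed

end

context cayley_algebra
begin

lemma embedding_adapted_basis:
  assumes char: "(7 :: 'f) = 0" and y: "half_density_basis y"
    and e: "witt_frame scaleL bracketL \<alpha> e"
    and \<iota>: "lie_embedding_in_Der scaleL bracketL scale mul \<iota>"
  shows "\<exists>v. half_density_basis v \<and> (\<forall>k<7. \<forall>i<7. \<iota> (e k) (v i) = density_action scale \<alpha> v k i)"
proof -
  interpret L: frame scaleL UNIV 7 e using e by (simp add: witt_frame_def)
  have br: "bracketL (e j) (e k) = scaleL ((of_nat k - of_nat j) * wrap \<alpha> (j + k - 1)) (e ((j + k - 1) mod 7))"
    if "j < 7" "k < 7" for j k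
    using e that by (simp add: witt_frame_def)
  have i: "\<And>x. \<iota> x \<in> derivations scale mul" "inj \<iota>" "\<And>c x. \<iota> (scaleL c x) = (\<lambda>a. scale c (\<iota> x a))"
    "\<And>x x'. \<iota> (bracketL x x') = commutator (\<iota> x) (\<iota> x')"
    using \<iota> by (auto simp: lie_embedding_in_Der_def)
  interpret witt_action scale mul norm \<alpha> "\<lambda>k. \<iota> (e k)" y
  proof unfold_locales
    show "commutator (\<iota> (e j)) (\<iota> (e k))
        = (\<lambda>x. scale ((of_nat k - of_nat j) * wrap \<alpha> (j + k - 1)) (\<iota> (e ((j + k - 1) mod 7)) x))"
      if "j < 7" "k < 7" for j k
      using br[OF that] i(3,4) by metis
    show "\<exists>x. \<iota> (e 2) x \<noteq> 0"
    proof (rule ccontr)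
      assume "\<nexists>x. \<iota> (e 2) x \<noteq> 0"
      then have "\<iota> (e 2) = \<iota> 0"
        using i(3)[of 0 0] by (auto simp: fun_eq_iff)
      then have "e 2 = 0" using i(2) by (simp add: inj_eq)
      then show False using L.coord_basis[of 2 2] by simp
    qed
  qed (use char y i(1) in auto)
  show ?thesis by (rule adapted_basis_exists)
qed

text \<open>
  Both bases have the same multiplication table.
\<close>

lemma half_density_bases_automorphism:
  assumes char: "(7 :: 'f) = 0" and v: "half_density_basis v" and w: "half_density_basis w"
  shows "\<exists>\<phi>. algebra_automorphism scale mul \<phi> \<and> (\<forall>i<7. \<phi> (v i) = w i) \<and> \<phi> one = one"
proof -
  define b where "b = (\<lambda>(v :: nat \<Rightarrow> 'a) i. if i = 7 then one else v i)"
  have frv: "frame scale UNIV 8 (b v)" and frw: "frame scale UNIV 8 (b w)"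
    using v w by (simp_all add: half_density_basis_def b_def)
  have tabv: "\<And>i j. i < 7 \<Longrightarrow> j < 7 \<Longrightarrow>
      mul (v i) (v j) = scale (if i + j = 6 then 1 else 0) one + scale (of_int (grozman_table ! i ! j)) (v (i + j - 3))"
    and tabw: "\<And>i j. i < 7 \<Longrightarrow> j < 7 \<Longrightarrow>
      mul (w i) (w j) = scale (if i + j = 6 then 1 else 0) one + scale (of_int (grozman_table ! i ! j)) (w (i + j - 3))"
    using v w grozman_char7[OF char] by (auto simp: half_density_basis_def)
  define m where "m = (\<lambda>v w x. \<Sum>i<8. scale (frame.coord scale 8 (b v) x i) (b w i))"
  have lin: "Vector_Spaces.linear scale scale (m v w)" if "frame scale UNIV 8 (b v)" for v w
    unfolding m_def by (rule linear_comb_map[OF that vector_space_axioms])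
  have m_b: "m v w (b v i) = b w i" if fr: "frame scale UNIV 8 (b v)" and i: "i < 8" for v w i
  proof -
    interpret B: frame scale UNIV 8 "b v" by (rule fr)
    have "m v w (b v i) = (\<Sum>l<8. if l = i then b w i else 0)"
      unfolding m_def by (rule sum.cong) (auto simp: B.coord_basis[OF i])
    then show ?thesis using i by simp
  qed
  have inv: "m w v (m v w x) = x" if fr: "frame scale UNIV 8 (b v)" "frame scale UNIV 8 (b w)" for v w x
  proof (rule frame_linear_eqI[OF fr(1), where f = "\<lambda>x. m w v (m v w x)" and g = "\<lambda>x. x" and s' = scale])
    show "Vector_Spaces.linear scale scale (\<lambda>x. m w v (m v w x))"
      using lin[OF fr(1), of w] lin[OF fr(2), of v] by (simp add: Vector_Spaces.linear_iff)
    show "Vector_Spaces.linear scale scale (\<lambda>x. x)"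
      using vector_space_axioms by (simp add: Vector_Spaces.linear_iff)
  qed (use m_b fr in simp)
  let ?\<phi> = "m v w"
  have add: "?\<phi> (x + x') = ?\<phi> x + ?\<phi> x'" and sc: "?\<phi> (scale c x) = scale c (?\<phi> x)" for x x' c
    using lin[OF frv, of w] by (simp_all add: Vector_Spaces.linear_iff)
  have one: "?\<phi> one = one" using m_b[OF frv, of 7 w] by (simp add: b_def)
  have vw: "?\<phi> (v i) = w i" if "i < 7" for i using m_b[OF frv, of i w] that by (simp add: b_def)
  have bij: "bij ?\<phi>"
    by (rule o_bij[of "m w v"]) (use inv[OF frv frw] inv[OF frw frv] in \<open>auto simp: fun_eq_iff\<close>)
  have mult: "?\<phi> (mul x x') = mul (?\<phi> x) (?\<phi> x')" for x x'
  proof (rule frame_bilinear_eqI[OF frv, where f = "\<lambda>x x'. ?\<phi> (mul x x')" and g = "\<lambda>x x'. mul (?\<phi> x) (?\<phi> x')" and s' = scale])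
    have *: "?\<phi> (mul (v i) (v j)) = mul (w i) (w j)" if ij: "i < 7" "j < 7" for i j
    proof (cases "i + j - 3 < 7")
      case True
      then show ?thesis using ij by (simp add: tabv tabw add sc one vw)
    next
      case False
      then have "\<not> (3 \<le> i + j \<and> i + j \<le> 9)" by auto
      then have "grozman_table ! i ! j = 0" by (rule grozman_table_zero[OF ij])
      then show ?thesis using ij by (simp add: tabv tabw add sc one)
    qed
    show "?\<phi> (mul (b v i) (b v j)) = mul (?\<phi> (b v i)) (?\<phi> (b v j))" if "i < 8" "j < 8" for i j
    proof -
      have "i < 7 \<or> i = 7" "j < 7 \<or> j = 7" using that by auto
      then show ?thesis using * by (elim disjE) (simp_all add: b_def one vw)
    qed
  qed (use vector_space_axioms in \<open>simp_all add: Vector_Spaces.linear_iff add sc mul_simps\<close>)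
  show ?thesis
    unfolding algebra_automorphism_def using lin[OF frv] bij mult vw one by blast
qed

text \<open>
  Each embedding has an adapted half density basis, on which it acts by the same formulas. The automorphism that
  matches the two bases therefore intertwines the embeddings.
\<close>

lemma lie_embeddings_conjugate:
  assumes char: "(7 :: 'f) = 0" and y: "half_density_basis y"
    and e: "witt_frame scaleL bracketL \<alpha> e"
    and \<iota>: "lie_embedding_in_Der scaleL bracketL scale mul \<iota>" "lie_embedding_in_Der scaleL bracketL scale mul \<iota>'"
  shows "\<exists>\<phi>. algebra_automorphism scale mul \<phi> \<and> (\<forall>x. \<iota>' x = \<phi> \<circ> \<iota> x \<circ> inv_into UNIV \<phi>)"
proof -
  interpret L: frame scaleL UNIV 7 e using e by (simp add: witt_frame_def)
  obtain v where v: "half_density_basis v" "\<And>k i. k < 7 \<Longrightarrow> i < 7 \<Longrightarrow> \<iota> (e k) (v i) = density_action scale \<alpha> v k i"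
    using embedding_adapted_basis[OF char y e \<iota>(1)] by blast
  obtain w where w: "half_density_basis w" "\<And>k i. k < 7 \<Longrightarrow> i < 7 \<Longrightarrow> \<iota>' (e k) (w i) = density_action scale \<alpha> w k i"
    using embedding_adapted_basis[OF char y e \<iota>(2)] by blast
  obtain \<phi> where \<phi>: "algebra_automorphism scale mul \<phi>" "\<And>i. i < 7 \<Longrightarrow> \<phi> (v i) = w i" "\<phi> one = one"
    using half_density_bases_automorphism[OF char v(1) w(1)] by blast
  have bij: "bij \<phi>" and lin: "Vector_Spaces.linear scale scale \<phi>"
    using \<phi>(1) by (auto simp: algebra_automorphism_def)
  have \<phi>_simps: "\<phi> (x + x') = \<phi> x + \<phi> x'" "\<phi> (scale c x) = scale c (\<phi> x)" "\<phi> 0 = 0" for x x' c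
  proof -
    show "\<phi> (x + x') = \<phi> x + \<phi> x'" and s: "\<phi> (scale c x) = scale c (\<phi> x)" for c x
      using lin by (simp_all add: Vector_Spaces.linear_iff)
    show "\<phi> 0 = 0" using s[of 0 0] by simp
  qed
  have emb: "\<And>x a. \<iota> x (a + a') = \<iota> x a + \<iota> x a'" "\<And>x a. \<iota> x (scale c a) = scale c (\<iota> x a)" "\<iota> x one = 0"
      "\<iota> (x + x') a = \<iota> x a + \<iota> x' a" "\<iota> (scaleL c x) a = scale c (\<iota> x a)"
    if "lie_embedding_in_Der scaleL bracketL scale mul \<iota>" for \<iota> x x' a a' c
  proof -
    have d: "\<iota> x \<in> derivations scale mul" for x using that by (simp add: lie_embedding_in_Der_def)
    show "\<And>x a. \<iota> x (a + a') = \<iota> x a + \<iota> x a'" "\<And>x a. \<iota> x (scale c a) = scale c (\<iota> x a)" "\<iota> x one = 0"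
      using d by (simp_all add: derivation_add derivation_scale derivation_one)
    show "\<iota> (x + x') a = \<iota> x a + \<iota> x' a" "\<iota> (scaleL c x) a = scale c (\<iota> x a)"
      using that by (simp_all add: lie_embedding_in_Der_def)
  qed
  note e1 = emb[OF \<iota>(1)] and e2 = emb[OF \<iota>(2)]
  have fr: "frame scale UNIV 8 (\<lambda>i. if i = 7 then one else v i)"
    using v(1) by (simp add: half_density_basis_def)
  have on_e: "\<phi> (\<iota> (e k) a) = \<iota>' (e k) (\<phi> a)" if k: "k < 7" for k a
  proof (rule frame_linear_eqI[OF fr, where f = "\<lambda>a. \<phi> (\<iota> (e k) a)" and g = "\<lambda>a. \<iota>' (e k) (\<phi> a)" and s' = scale])
    fix i :: nat assume "i < 8"
    then consider "i = 7" | "i < 7" by linarith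
    then show "\<phi> (\<iota> (e k) (if i = 7 then one else v i)) = \<iota>' (e k) (\<phi> (if i = 7 then one else v i))"
    proof cases
      case 2
      then show ?thesis
        using v(2)[OF k 2] w(2)[OF k 2] \<phi>(2)[OF 2] \<phi>(2)[of "(i + k - 1) mod 7"]
        by (simp add: density_action_def \<phi>_simps)
    qed (simp add: e1 e2 \<phi> \<phi>_simps)
  qed (use vector_space_axioms in \<open>simp_all add: Vector_Spaces.linear_iff \<phi>_simps e1 e2\<close>)
  have inter: "\<phi> (\<iota> x a) = \<iota>' x (\<phi> a)" for x a
    by (rule frame_linear_eqI[OF L.frame_axioms, where f = "\<lambda>x. \<phi> (\<iota> x a)" and g = "\<lambda>x. \<iota>' x (\<phi> a)" and s' = scale])
      (use vector_space_axioms L.vector_space_axioms on_e in \<open>simp_all add: Vector_Spaces.linear_iff \<phi>_simps e1 e2\<close>)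
  have "\<iota>' x = \<phi> \<circ> \<iota> x \<circ> inv_into UNIV \<phi>" for x
  proof
    fix a
    have "\<phi> (inv_into UNIV \<phi> a) = a" using bij by (simp add: bij_is_surj surj_f_inv_f)
    then show "\<iota>' x a = (\<phi> \<circ> \<iota> x \<circ> inv_into UNIV \<phi>) a" by (simp add: inter)
  qed
  with \<phi>(1) show ?thesis by blast
qed

end

section \<open>Vector fields on the truncated line\<close>

lemma X7_dvd_iff: "[:0, 1:] ^ 7 dvd p \<longleftrightarrow> (\<forall>i<7. poly.coeff p i = (0::'f::field))"
proof -
  have "[:0, 1:] ^ 7 = (monom 1 7 :: 'f poly)" by (simp add: monom_altdef)
  then show ?thesis by (simp only: monom_1_dvd_iff')
qed

text \<open>
  The cut-off at 7 makes the coefficient depend on the class only.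
\<close>

lift_definition tcoeff :: "'f::field trunc7 \<Rightarrow> nat \<Rightarrow> 'f" is "\<lambda>p i. if i < 7 then poly.coeff p i else 0"
  by (auto simp: X7_dvd_iff fun_eq_iff)

lift_definition tvar :: "'f::field trunc7" is "[:0, 1:]" .

lemma tcoeff_ge: "7 \<le> i \<Longrightarrow> tcoeff f i = 0"
  by transfer simp

lemma trunc7_eqI: "(\<And>i. i < 7 \<Longrightarrow> tcoeff f i = tcoeff g i) \<Longrightarrow> f = g"
  by transfer (simp add: X7_dvd_iff)

lemma tcoeff_add: "tcoeff (f + g) i = tcoeff f i + tcoeff g i"
  by transfer simp

lemma tcoeff_scale: "tcoeff (scale_trunc7 c f) i = c * tcoeff f i"
  by transfer simp

lemma tcoeff_zero: "tcoeff 0 i = 0"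
  by transfer simp

lemma tcoeff_one: "tcoeff 1 i = (if i = 0 then 1 else 0)"
  by transfer simp

lemma tcoeff_mult: "n < 7 \<Longrightarrow> tcoeff (f * g) n = (\<Sum>i\<le>n. tcoeff f i * tcoeff g (n - i))"
  by transfer (auto simp: coeff_mult intro!: sum.cong)

lemma tcoeff_mult_0: "tcoeff (f * g) 0 = tcoeff f 0 * tcoeff g 0"
  using tcoeff_mult[of 0 f g] by simp

lemma tcoeff_sum: "tcoeff (\<Sum>a\<in>A. f a) i = (\<Sum>a\<in>A. tcoeff (f a) i)"
  by (induction A rule: infinite_finite_induct) (simp_all add: tcoeff_zero tcoeff_add)

lemma tcoeff_var_power: "i < 7 \<Longrightarrow> tcoeff (tvar ^ i) n = (if n = i then 1 else 0)"
proof (induction i arbitrary: n)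
  case 0
  show ?case by (simp add: tcoeff_one)
next
  case (Suc i)
  have v: "tcoeff (tvar :: 'a trunc7) k = (if k = 1 then 1 else 0)" for k
    by transfer (auto simp: coeff_pCons split: nat.split)
  show ?case
  proof (cases "n < 7")
    case True
    have "tcoeff (tvar ^ Suc i :: 'a trunc7) n = (\<Sum>k\<le>n. if k = 1 then (if n - 1 = i then 1 else 0) else 0)"
      unfolding power_Suc tcoeff_mult[OF True] using Suc by (intro sum.cong) (auto simp: v)
    also have "\<dots> = (if n = Suc i then 1 else 0)" by (cases n) auto
    finally show ?thesis .
  next
    case False
    then show ?thesis using Suc.prems by (simp add: tcoeff_ge)
  qed
qed

lemma tcoeff_var_sum: "n < 7 \<Longrightarrow> tcoeff (\<Sum>i<7. scale_trunc7 (c i) (tvar ^ i)) n = c n"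
proof -
  assume n: "n < 7"
  have "tcoeff (\<Sum>i<7. scale_trunc7 (c i) (tvar ^ i)) n = (\<Sum>i<7. if i = n then c n else 0)"
    unfolding tcoeff_sum by (rule sum.cong) (auto simp: tcoeff_scale tcoeff_var_power)
  then show ?thesis using n by simp
qed

lemma trunc7_expansion: "f = (\<Sum>i<7. scale_trunc7 (tcoeff f i) (tvar ^ i))"
  by (rule trunc7_eqI) (simp add: tcoeff_var_sum)

lemma trunc7_frame: "frame scale_trunc7 UNIV 7 (\<lambda>i. tvar ^ i)"
proof unfold_locales
  show "indep_family scale_trunc7 7 (\<lambda>i. tvar ^ i :: 'a trunc7)"
    unfolding indep_family_def
  proof (intro allI impI)
    fix c :: "nat \<Rightarrow> 'a" and i :: nat
    assume "(\<Sum>i<7. scale_trunc7 (c i) (tvar ^ i)) = 0" "i < 7"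
    then show "c i = 0" using tcoeff_var_sum[of i c] by (simp add: tcoeff_zero)
  qed
  show "(x \<in> UNIV) = (\<exists>c. x = (\<Sum>i<7. scale_trunc7 (c i) (tvar ^ i)))" for x :: "'a trunc7"
    using trunc7_expansion[of x] by auto
qed

text \<open>
  The formula by coefficients makes sense in every characteristic; in characteristic 7 it is the derivation induced
  by the derivative of polynomials (\<open>tderiv_mult\<close>).
\<close>

definition tderiv :: "'f::field trunc7 \<Rightarrow> 'f trunc7" where
  "tderiv f = (\<Sum>i<7. scale_trunc7 (of_nat (Suc i) * tcoeff f (Suc i)) (tvar ^ i))"

lemma tcoeff_tderiv: "n < 7 \<Longrightarrow> tcoeff (tderiv f) n = of_nat (Suc n) * tcoeff f (Suc n)"
  unfolding tderiv_def by (rule tcoeff_var_sum)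

lemma tderiv_add: "tderiv (f + g) = tderiv f + tderiv g"
  by (rule trunc7_eqI) (simp add: tcoeff_tderiv tcoeff_add distrib_left del: of_nat_Suc)

lemma tderiv_scale: "tderiv (scale_trunc7 c f) = scale_trunc7 c (tderiv f)"
  by (rule trunc7_eqI) (simp add: tcoeff_tderiv tcoeff_scale mult.left_commute del: of_nat_Suc)

lemma tderiv_one: "tderiv 1 = 0"
  by (rule trunc7_eqI) (simp add: tcoeff_tderiv tcoeff_one tcoeff_zero del: of_nat_Suc)

lemma tderiv_zero: "tderiv 0 = 0"
  using tderiv_scale[of 0 0] by simp

lemma tderiv_var: "tderiv tvar = 1"
proof (rule trunc7_eqI)
  fix i :: nat assume "i < 7"
  moreover have "tcoeff (tvar :: 'a trunc7) k = (if k = 1 then 1 else 0)" for k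
    using tcoeff_var_power[of 1 k, where 'a = 'a] by simp
  ultimately show "tcoeff (tderiv (tvar :: 'a trunc7)) i = tcoeff 1 i"
    by (simp add: tcoeff_tderiv tcoeff_one)
qed

lemma tderiv_mult:
  fixes f g :: "'f::field trunc7"
  assumes char: "(7 :: 'f) = 0"
  shows "tderiv (f * g) = tderiv f * g + f * tderiv g"
proof -
  have a: "tderiv (abs_trunc7 p) = abs_trunc7 (pderiv p)" for p :: "'f poly"
  proof (rule trunc7_eqI)
    fix i :: nat assume i: "i < 7"
    have "Suc i < 7 \<or> Suc i = 7" using i by auto
    then show "tcoeff (tderiv (abs_trunc7 p)) i = tcoeff (abs_trunc7 (pderiv p)) i"
    proof
      assume "Suc i < 7"
      then show ?thesis using i by (simp add: tcoeff_tderiv tcoeff.abs_eq coeff_pderiv del: of_nat_Suc)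
    next
      assume s: "Suc i = 7"
      then have "(of_nat (Suc i) :: 'f) = 0" using char by simp
      then show ?thesis using i by (simp add: tcoeff_tderiv tcoeff.abs_eq coeff_pderiv del: of_nat_Suc)
    qed
  qed
  obtain p q where "f = abs_trunc7 p" "g = abs_trunc7 q"
    by (metis Quotient_abs_rep[OF Quotient_trunc7])
  then show ?thesis
    by (simp add: a times_trunc7.abs_eq plus_trunc7.abs_eq pderiv_mult algebra_simps)
qed

lemma tderiv_eq_0_iff:
  fixes f :: "'f::field trunc7"
  assumes char: "(7 :: 'f) = 0"
  shows "tderiv f = 0 \<longleftrightarrow> f = scale_trunc7 (tcoeff f 0) 1"
proof
  assume d: "tderiv f = 0"
  show "f = scale_trunc7 (tcoeff f 0) 1"
  proof (rule trunc7_eqI)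
    fix i :: nat assume i: "i < 7"
    show "tcoeff f i = tcoeff (scale_trunc7 (tcoeff f 0) 1) i"
    proof (cases i)
      case (Suc k)
      have "of_nat (Suc k) * tcoeff f (Suc k) = 0"
        using tcoeff_tderiv[of k f] d i Suc by (simp add: tcoeff_zero)
      moreover have "(of_nat (Suc k) :: 'f) \<noteq> 0"
      proof -
        have "\<forall>m<7. 0 < m \<longrightarrow> (of_nat m :: 'f) \<noteq> 0"
          unfolding all_less_7 by (simp add: char7_numerals[OF char] char7_ne[OF char])
        then show ?thesis using i Suc by (simp del: of_nat_Suc)
      qed
      ultimately show ?thesis using Suc by (simp add: tcoeff_scale tcoeff_one)
    qed (simp add: tcoeff_scale tcoeff_one)
  qed
next
  assume "f = scale_trunc7 (tcoeff f 0) 1"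
  then show "tderiv f = 0" by (metis tderiv_scale tderiv_one trunc7.scale_zero_right)
qed

lemma var_power_7: "tvar ^ 7 = (0 :: 'f::field trunc7)"
proof (rule trunc7_eqI)
  fix i :: nat assume i: "i < 7"
  have "tvar ^ 7 = (tvar * tvar ^ 6 :: 'f trunc7)" by (simp flip: power_Suc)
  moreover have "tcoeff (tvar * tvar ^ 6 :: 'f trunc7) i = 0"
    unfolding tcoeff_mult[OF i]
  proof (rule sum.neutral, rule ballI)
    fix k assume "k \<in> {..i}"
    then show "tcoeff (tvar :: 'f trunc7) k * tcoeff (tvar ^ 6) (i - k) = 0"
      using tcoeff_var_power[of 1 k, where 'a = 'f] i by (auto simp: tcoeff_var_power)
  qed
  ultimately show "tcoeff (tvar ^ 7 :: 'f trunc7) i = tcoeff 0 i" by (simp add: tcoeff_zero)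
qed

text \<open>
  The Frobenius map is additive and kills \<open>tvar\<close>.
\<close>

lemma trunc7_power_7:
  fixes f :: "'f::field trunc7"
  assumes char: "(7 :: 'f) = 0"
  shows "f ^ 7 = scale_trunc7 (tcoeff f 0 ^ 7) 1"
proof -
  define c :: "'f trunc7" where "c = scale_trunc7 (tcoeff f 0) 1"
  define g where "g = (\<Sum>i<6. scale_trunc7 (tcoeff f (Suc i)) (tvar ^ i))"
  have seven: "(7 :: 'f trunc7) = 0"
  proof -
    have "scale_trunc7 (of_nat n) 1 = (of_nat n :: 'f trunc7)" for n
      by (induction n) (simp_all add: trunc7.scale_left_distrib)
    from this[of 7] show ?thesis using char by simp
  qed
  have "f = (\<Sum>i<7. scale_trunc7 (tcoeff f i) (tvar ^ i))" by (rule trunc7_expansion)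
  also have "\<dots> = c + tvar * g"
  proof -
    have "{..<7::nat} = {..<Suc 6}" by auto
    then have "(\<Sum>i<7. scale_trunc7 (tcoeff f i) (tvar ^ i)) = (\<Sum>i<Suc 6. scale_trunc7 (tcoeff f i) (tvar ^ i))"
      by (simp only:)
    also have "\<dots> = c + (\<Sum>i<6. scale_trunc7 (tcoeff f (Suc i)) (tvar ^ Suc i))"
      by (subst sum.lessThan_Suc_shift) (simp add: c_def)
    also have "(\<Sum>i<6. scale_trunc7 (tcoeff f (Suc i)) (tvar ^ Suc i)) = tvar * g"
      by (simp add: g_def sum_distrib_left scale_trunc7_mult)
    finally show ?thesis .
  qed
  finally have f: "f = c + tvar * g" .
  have fresh: "(a + b) ^ 7 = a ^ 7 + b ^ 7" for a b :: "'f trunc7"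
  proof -
    have "(a + b) ^ 7 = a ^ 7 + b ^ 7 + 7 * (a * b * (a ^ 5 + 3 * a ^ 4 * b + 5 * a ^ 3 * b ^ 2 + 5 * a ^ 2 * b ^ 3 + 3 * a * b ^ 4 + b ^ 5))"
      by (simp add: eval_nat_numeral algebra_simps)
    then show ?thesis unfolding seven by simp
  qed
  have "f ^ 7 = c ^ 7 + tvar ^ 7 * g ^ 7"
    by (subst f) (simp add: fresh power_mult_distrib)
  also have "\<dots> = c ^ 7" by (simp add: var_power_7)
  also have "\<dots> = scale_trunc7 (tcoeff f 0 ^ 7) 1"
  proof -
    have "scale_trunc7 a 1 ^ n = (scale_trunc7 (a ^ n) 1 :: 'f trunc7)" for a n
      by (induction n) (simp_all add: scale_trunc7_mult)
    then show ?thesis by (simp add: c_def)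
  qed
  finally show ?thesis .
qed

lemma trunc7_unit:
  fixes f :: "'f::field trunc7"
  assumes char: "(7 :: 'f) = 0" and "tcoeff f 0 \<noteq> 0"
  shows "\<exists>g. f * g = 1"
proof
  have "f * f ^ 6 = f ^ 7" by (simp flip: power_Suc)
  then have "f * f ^ 6 = scale_trunc7 (tcoeff f 0 ^ 7) 1"
    by (simp only: trunc7_power_7[OF char])
  then show "f * scale_trunc7 (1 / tcoeff f 0 ^ 7) (f ^ 6) = 1"
    using assms(2) by (simp add: scale_trunc7_mult)
qed

text \<open>
  The commutator of the vector fields \<open>u d/dX\<close> and \<open>v d/dX\<close>.
\<close>

definition vf_bracket :: "'f::field trunc7 \<Rightarrow> 'f trunc7 \<Rightarrow> 'f trunc7" where
  "vf_bracket u v = u * tderiv v - v * tderiv u"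

lemma vf_bracket_bilinear:
  "vf_bracket (u + u') v = vf_bracket u v + vf_bracket u' v"
  "vf_bracket u (v + v') = vf_bracket u v + vf_bracket u v'"
  "vf_bracket (scale_trunc7 c u) v = scale_trunc7 c (vf_bracket u v)"
  "vf_bracket u (scale_trunc7 c v) = scale_trunc7 c (vf_bracket u v)"
  by (simp_all add: vf_bracket_def tderiv_add tderiv_scale scale_trunc7_mult trunc7.scale_right_diff_distrib algebra_simps)

lemma vf_bracket_linear:
  "Vector_Spaces.linear scale_trunc7 scale_trunc7 (\<lambda>u. vf_bracket u v)"
  "Vector_Spaces.linear scale_trunc7 scale_trunc7 (vf_bracket v)"
  by (simp_all add: linear_scale_trunc7_iff vf_bracket_bilinear)

text \<open>
  Multiplications satisfy the hypothesis, so that \<open>R f = S f - S 1 * f\<close> does as well, and \<open>R 1 = 0\<close>. Brackets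
  with 1 are derivatives; thus \<open>2 R(f') = (R f)'\<close>, and if \<open>R\<close> kills \<open>X^{n-1}\<close> then \<open>R(X^n)\<close> is a constant. The
  bracket with \<open>X\<close> multiplies this constant by \<open>2 n - 1\<close> and gives zero. This settles all \<open>n\<close> but 4,
  where \<open>2 n - 1 = 7\<close>; there \<open>X^4 = [X^2, X^3]\<close> helps. The cases \<open>n = 1, 2\<close> have to be treated together, as
  \<open>[X, X] = 0\<close>.
\<close>

lemma vf_half_derivation:
  fixes S :: "'f::field trunc7 \<Rightarrow> 'f trunc7"
  assumes char: "(7 :: 'f) = 0"
    and lin: "Vector_Spaces.linear scale_trunc7 scale_trunc7 S"
    and half: "\<And>u v. 2 * S (vf_bracket u v) = vf_bracket (S u) v + vf_bracket u (S v)"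
  shows "S f = S 1 * f"
proof -
  define R where "R = (\<lambda>f. S f - S 1 * f)"
  have Slin: "S (f + g) = S f + S g" "S (scale_trunc7 c f) = scale_trunc7 c (S f)" for f g c
    using lin by (simp_all add: linear_scale_trunc7_iff)
  have Rlin: "R (f + g) = R f + R g" "R (scale_trunc7 c f) = scale_trunc7 c (R f)" for f g c
    by (simp_all add: R_def Slin scale_trunc7_mult trunc7.scale_right_diff_distrib algebra_simps)
  have Rhalf: "2 * R (vf_bracket u v) = vf_bracket (R u) v + vf_bracket u (R v)" for u v
  proof -
    have td: "tderiv (f - g) = tderiv f - tderiv g" for f g :: "'f trunc7"
      using tderiv_add[of "f - g" g] by (simp add: eq_diff_eq)
    show ?thesis
      using half[of u v]
      by (simp add: R_def vf_bracket_def td tderiv_mult[OF char] algebra_simps)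
  qed
  note num = char7_numerals[OF char]
  have R1: "R 1 = 0" by (simp add: R_def)
  have sc: "scale_trunc7 2 f = 2 * f" "scale_trunc7 3 f = 3 * f" for f :: "'f trunc7"
    using trunc7.scale_left_distrib[of 1 1 f] trunc7.scale_left_distrib[of 2 1 f] by (simp_all add: algebra_simps)
  have one_bracket: "vf_bracket 1 v = tderiv v" for v :: "'f trunc7" by (simp add: vf_bracket_def tderiv_one)
  have D: "2 * R (tderiv v) = tderiv (R v)" for v
    using Rhalf[of 1 v] by (simp add: R1 one_bracket vf_bracket_def tderiv_one tderiv_zero)
  have powd: "tderiv (tvar ^ n) = scale_trunc7 (of_nat n) (tvar ^ (n - 1) :: 'f trunc7)" for n
  proof (induction n)
    case (Suc n)
    have "tderiv (tvar ^ Suc n) = tvar ^ n + scale_trunc7 (of_nat n) (tvar * tvar ^ (n - 1) :: 'f trunc7)"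
      by (simp add: tderiv_mult[OF char] tderiv_var Suc scale_trunc7_mult)
    also have "scale_trunc7 (of_nat n) (tvar * tvar ^ (n - 1)) = scale_trunc7 (of_nat n) (tvar ^ n :: 'f trunc7)"
      by (cases n) simp_all
    finally show ?case by (simp add: trunc7.scale_left_distrib)
  qed (simp add: tderiv_one)
  have br: "vf_bracket (tvar ^ m) (tvar ^ n) = scale_trunc7 (of_nat n - of_nat m) (tvar ^ (m + n - 1) :: 'f trunc7)"
    if "0 < m" "0 < n" for m n
  proof -
    have "n + m - 1 = m + (n - 1)" "n + (m - 1) = m + (n - 1)" "m + n - 1 = m + (n - 1)" using that by auto
    then show ?thesis
      by (simp add: vf_bracket_def powd scale_trunc7_mult trunc7.scale_left_diff_distrib flip: power_add)
  qed
  define c where "c = (\<lambda>n. tcoeff (R (tvar ^ n)) 0)"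
  have const: "R (tvar ^ n) = scale_trunc7 (c n) 1" if "R (tvar ^ (n - 1)) = 0" for n
  proof -
    have "tderiv (R (tvar ^ n)) = 0"
      using D[of "tvar ^ n"] that by (simp add: powd Rlin)
    then show ?thesis using tderiv_eq_0_iff[OF char] by (simp add: c_def)
  qed
  have z1: "R (tvar ^ 1) = scale_trunc7 (c 1) 1" by (rule const) (simp add: R1)
  have cb: "vf_bracket (scale_trunc7 a 1) v = scale_trunc7 a (tderiv v)" "vf_bracket v (scale_trunc7 a 1) = - scale_trunc7 a (tderiv v)"
    for a and v :: "'f trunc7"
    by (simp_all add: vf_bracket_def tderiv_scale tderiv_one scale_trunc7_mult)
  \<comment> \<open>The bracket of \<open>tvar\<close> and \<open>tvar ^ 2\<close> involves both constants.\<close>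
  have c2: "c 2 = 0 \<and> c 1 = 0"
  proof -
    have "tderiv (R (tvar ^ 2)) = scale_trunc7 (4 * c 1) 1"
      using D[of "tvar ^ 2"] z1 by (simp add: powd Rlin flip: sc)
    then have t: "tderiv (R (tvar ^ 2) - scale_trunc7 (4 * c 1) tvar) = 0"
      using tderiv_add[of "R (tvar ^ 2) - scale_trunc7 (4 * c 1) tvar" "scale_trunc7 (4 * c 1) tvar"]
      by (simp add: tderiv_scale tderiv_var)
    define e where "e = tcoeff (R (tvar ^ 2) - scale_trunc7 (4 * c 1) tvar) 0"
    have R2: "R (tvar ^ 2) = scale_trunc7 (4 * c 1) tvar + scale_trunc7 e 1"
      using t tderiv_eq_0_iff[OF char, of "R (tvar ^ 2) - scale_trunc7 (4 * c 1) tvar"] by (simp add: e_def algebra_simps)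
    have "2 * R (vf_bracket (tvar ^ 1) (tvar ^ 2)) = vf_bracket (R (tvar ^ 1)) (tvar ^ 2) + vf_bracket (tvar ^ 1) (R (tvar ^ 2))"
      by (rule Rhalf)
    moreover have "vf_bracket (tvar ^ 1) (tvar ^ 2 :: 'f trunc7) = tvar ^ 2" by (subst br) (simp_all add: power2_eq_square)
    moreover have "vf_bracket (R (tvar ^ 1)) (tvar ^ 2) = scale_trunc7 (2 * c 1) tvar"
      unfolding z1 cb(1) powd by (simp add: mult.commute)
    moreover have "vf_bracket (tvar ^ 1) (R (tvar ^ 2)) = - scale_trunc7 e 1"
      unfolding R2 vf_bracket_bilinear cb(2) by (simp add: vf_bracket_def tderiv_var tderiv_one)
    ultimately have eq: "scale_trunc7 2 (scale_trunc7 (4 * c 1) tvar + scale_trunc7 e 1) + scale_trunc7 e 1 = scale_trunc7 (2 * c 1) tvar"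
      using R2 by (simp add: sc)
    have v: "tcoeff (tvar :: 'f trunc7) k = (if k = 1 then 1 else 0)" for k
      using tcoeff_var_power[of 1 k, where 'a = 'f] by simp
    have "3 * e = 0"
      using arg_cong[OF eq, of "\<lambda>f. tcoeff f 0"] by (simp add: tcoeff_add tcoeff_scale tcoeff_one v)
    moreover have "8 * c 1 = 2 * c 1"
      using arg_cong[OF eq, of "\<lambda>f. tcoeff f 1"] by (simp add: tcoeff_add tcoeff_scale tcoeff_one v)
    moreover have "(2 :: 'f) \<noteq> 1" by (metis add_cancel_right_right one_add_one zero_neq_one)
    ultimately have "e = 0" "c 1 = 0" using char7_ne[OF char] by (simp_all add: num)
    then have "R (tvar ^ 2) = 0" using R2 by simp
    then show ?thesis using \<open>c 1 = 0\<close> by (simp add: c_def tcoeff_zero)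
  qed
  have R_1: "R (tvar ^ 1) = 0" using z1 c2 by simp
  have R_2: "R (tvar ^ 2) = 0" using const[of 2] R_1 c2 by simp
  have step: "R (tvar ^ n) = 0" if "R (tvar ^ (n - 1)) = 0" "3 \<le> n" "n < 7" "n \<noteq> 4" for n
  proof -
    have "2 * R (vf_bracket (tvar ^ 1) (tvar ^ n)) = vf_bracket (tvar ^ 1) (R (tvar ^ n))"
      using Rhalf[of "tvar ^ 1" "tvar ^ n"] unfolding R_1 by (simp add: vf_bracket_def tderiv_zero)
    moreover have "vf_bracket (tvar ^ 1) (tvar ^ n :: 'f trunc7) = scale_trunc7 (of_nat n - 1) (tvar ^ n)"
      using that(2) by (subst br) auto
    moreover have "vf_bracket (tvar ^ 1) (R (tvar ^ n)) = - scale_trunc7 (c n) 1"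
      unfolding const[OF that(1)] cb by (simp add: tderiv_var)
    ultimately have "scale_trunc7 2 (scale_trunc7 (of_nat n - 1) (scale_trunc7 (c n) 1)) + scale_trunc7 (c n) 1 = (0 :: 'f trunc7)"
      by (simp add: Rlin const[OF that(1)] flip: sc)
    then have "scale_trunc7 ((2 * of_nat n - 1) * c n) 1 = (0 :: 'f trunc7)"
      by (simp add: algebra_simps flip: trunc7.scale_left_distrib)
    then have "(2 * of_nat n - 1) * c n = 0" by simp
    moreover have "(2 * of_nat n - 1 :: 'f) \<noteq> 0"
    proof -
      have "\<forall>n<7. 3 \<le> n \<and> n \<noteq> 4 \<longrightarrow> (2 * of_nat n - 1 :: 'f) \<noteq> 0"
        unfolding all_less_7 by (simp add: num char7_ne[OF char])
      then show ?thesis using that by blast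
    qed
    ultimately show ?thesis using const[OF that(1)] by simp
  qed
  have R_3: "R (tvar ^ 3) = 0" using step[of 3] R_2 by simp
  have R_4: "R (tvar ^ 4) = 0"
  proof -
    have "vf_bracket (tvar ^ 2) (tvar ^ 3 :: 'f trunc7) = tvar ^ 4" by (subst br) simp_all
    then have "2 * R (tvar ^ 4) = 0"
      using Rhalf[of "tvar ^ 2" "tvar ^ 3"] unfolding R_2 R_3 by (simp add: vf_bracket_def tderiv_zero)
    then have "scale_trunc7 2 (R (tvar ^ 4)) = 0" by (simp add: sc)
    then show ?thesis using char7_ne[OF char] by simp
  qed
  have R_5: "R (tvar ^ 5) = 0" using step[of 5] R_4 by simp
  have R_6: "R (tvar ^ 6) = 0" using step[of 6] R_5 by simp
  have Rv: "R (tvar ^ i) = 0" if "i < 7" for i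
    using that R1 R_1 R_2 R_3 R_4 R_5 R_6 by (auto simp: less_7_cases)
  have "R f = 0"
  proof (rule frame_linear_eqI[OF trunc7_frame, where f = R and g = "\<lambda>_. 0" and s' = scale_trunc7])
    show "Vector_Spaces.linear scale_trunc7 scale_trunc7 R" "Vector_Spaces.linear scale_trunc7 scale_trunc7 (\<lambda>_. 0 :: 'f trunc7)"
      by (simp_all add: linear_scale_trunc7_iff Rlin)
  qed (rule Rv)
  then show ?thesis by (simp add: R_def)
qed

section \<open>Twisted forms as spaces of vector fields\<close>

text \<open>
  The map on formal sums given by \<open>a \<otimes> b \<mapsto> b \<tau>(a)\<close>. For a semilinear \<open>\<tau>\<close> it factors through the
  tensor product (\<open>tensor_ext_null\<close>).
\<close>

definition tensor_ext :: "('k::field \<Rightarrow> 'm::ab_group_add \<Rightarrow> 'm) \<Rightarrow> ('a \<Rightarrow> 'm) \<Rightarrow> ('a \<times> 'k \<Rightarrow>\<^sub>0 int) \<Rightarrow> 'm" where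
  "tensor_ext s \<tau> u = (\<Sum>p\<in>Poly_Mapping.keys u. s (of_int (poly_mapping.lookup u p) * snd p) (\<tau> (fst p)))"

lemma tensor_ext_superset:
  assumes "vector_space s" "finite S" "Poly_Mapping.keys u \<subseteq> S"
  shows "tensor_ext s \<tau> u = (\<Sum>p\<in>S. s (of_int (poly_mapping.lookup u p) * snd p) (\<tau> (fst p)))"
proof -
  interpret vector_space s by fact
  show ?thesis
    unfolding tensor_ext_def using assms(2,3)
    by (intro sum.mono_neutral_left) (auto simp: in_keys_iff)
qed

lemma tensor_ext_diff:
  assumes "vector_space s"
  shows "tensor_ext s \<tau> (u - v) = tensor_ext s \<tau> u - tensor_ext s \<tau> v"
proof -
  interpret vector_space s by fact
  let ?S = "Poly_Mapping.keys u \<union> Poly_Mapping.keys v"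
  have "Poly_Mapping.keys (u - v) \<subseteq> ?S" by (auto simp: in_keys_iff lookup_minus)
  then have "tensor_ext s \<tau> (u - v) = (\<Sum>p\<in>?S. s (of_int (poly_mapping.lookup (u - v) p) * snd p) (\<tau> (fst p)))"
    by (intro tensor_ext_superset[OF assms]) auto
  also have "\<dots> = (\<Sum>p\<in>?S. s (of_int (poly_mapping.lookup u p) * snd p) (\<tau> (fst p)))
      - (\<Sum>p\<in>?S. s (of_int (poly_mapping.lookup v p) * snd p) (\<tau> (fst p)))"
    by (simp add: lookup_minus left_diff_distrib scale_left_diff_distrib sum_subtractf)
  also have "(\<Sum>p\<in>?S. s (of_int (poly_mapping.lookup u p) * snd p) (\<tau> (fst p))) = tensor_ext s \<tau> u"
    by (rule tensor_ext_superset[OF assms, symmetric]) auto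
  also have "(\<Sum>p\<in>?S. s (of_int (poly_mapping.lookup v p) * snd p) (\<tau> (fst p))) = tensor_ext s \<tau> v"
    by (rule tensor_ext_superset[OF assms, symmetric]) auto
  finally show ?thesis .
qed

lemma tensor_ext_of: "tensor_ext s \<tau> (frag_of (x, b)) = s b (\<tau> x)"
  by (simp add: tensor_ext_def)

lemma tensor_ext_0: "tensor_ext s \<tau> 0 = 0"
  by (simp add: tensor_ext_def)

lemma tensor_ext_null:
  fixes j :: "'f::field \<Rightarrow> 'k::field"
  assumes M: "vector_space sM"
    and add: "\<And>x y. \<tau> (x + y) = \<tau> x + \<tau> y" and sc: "\<And>r x. \<tau> (s r x) = sM (j r) (\<tau> x)"
    and u: "u \<in> tensor_null j s"
  shows "tensor_ext sM \<tau> u = 0"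
proof -
  interpret vector_space sM by fact
  show ?thesis
    using u
    by induction (simp_all add: tensor_ext_0 tensor_ext_diff[OF M] tensor_ext_of add sc scale_right_distrib
        scale_left_distrib mult.commute)
qed

lemma tensor_ext_smult:
  assumes M: "vector_space sM"
  shows "tensor_ext sM \<tau> (formal_smult c u) = sM c (tensor_ext sM \<tau> u)"
proof -
  interpret vector_space sM by fact
  show ?thesis
    by (induction u rule: frag_induction[OF subset_UNIV])
       (auto simp: formal_smult_def tensor_ext_0 tensor_ext_diff[OF M] tensor_ext_of frag_extend_diff scale_right_diff_distrib)
qed

lemma tensor_ext_mult:
  assumes M: "vector_space sM"
    and br: "\<And>x y. \<tau> (mul x y) = brM (\<tau> x) (\<tau> y)"
    and lin: "\<And>y. Vector_Spaces.linear sM sM (\<lambda>x. brM x y)" "\<And>x. Vector_Spaces.linear sM sM (brM x)"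
  shows "tensor_ext sM \<tau> (formal_mult mul u v) = brM (tensor_ext sM \<tau> u) (tensor_ext sM \<tau> v)"
proof -
  interpret vector_space sM by fact
  have l: "brM (x - x') y = brM x y - brM x' y" "brM 0 y = 0" "brM (sM c x) y = sM c (brM x y)" for x x' y c
  proof -
    interpret Vector_Spaces.linear sM sM "\<lambda>x. brM x y" by (rule lin)
    show "brM (x - x') y = brM x y - brM x' y" "brM 0 y = 0" "brM (sM c x) y = sM c (brM x y)"
      by (fact diff zero scale)+
  qed
  have r: "brM y (x - x') = brM y x - brM y x'" "brM y 0 = 0" "brM y (sM c x) = sM c (brM y x)" for x x' y c
  proof -
    interpret Vector_Spaces.linear sM sM "brM y" by (rule lin)
    show "brM y (x - x') = brM y x - brM y x'" "brM y 0 = 0" "brM y (sM c x) = sM c (brM y x)"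
      by (fact diff zero scale)+
  qed
  show ?thesis
  proof (induction u rule: frag_induction[OF subset_UNIV])
    case 1
    show ?case by (simp add: formal_mult_0_left tensor_ext_0 l)
  next
    case (2 p)
    obtain x b where p: "p = (x, b)" by (cases p)
    show ?case
      by (induction v rule: frag_induction[OF subset_UNIV])
         (auto simp: p formal_mult_0_right formal_mult_of formal_mult_diff_right tensor_ext_0 tensor_ext_of
           tensor_ext_diff[OF M] l r br mult.commute)
  next
    case (3 u u')
    then show ?case by (simp add: formal_mult_diff_left tensor_ext_diff[OF M] l)
  qed
qed

lemma tensor_null_right_zero: "frag_of (x, 0) \<in> tensor_null j s"
  using tensor_null_uminus[OF tensor_null.add_right[of x 0 0 j s]] by simp

lemma tensor_null_left_zero: "frag_of (0, b) \<in> tensor_null j s"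
  using tensor_null_uminus[OF tensor_null.add_left[of 0 0 b j s]] by simp

lemma tensor_null_sum:
  "(\<And>i. i \<in> A \<Longrightarrow> f i \<in> tensor_null j s) \<Longrightarrow> (\<Sum>i\<in>A. f i) \<in> tensor_null j s"
  by (induction A rule: infinite_finite_induct) (simp_all add: tensor_null.zero tensor_null_add)

lemma tensor_null_trans:
  "u - v \<in> tensor_null j s \<Longrightarrow> v - w \<in> tensor_null j s \<Longrightarrow> u - w \<in> tensor_null j s"
  using tensor_null_add[of "u - v" j s "v - w"] by simp

lemma tensor_null_left_sum:
  "frag_of (\<Sum>i\<in>A. x i, b) - (\<Sum>i\<in>A. frag_of (x i, b)) \<in> tensor_null j s"
proof (induction A rule: infinite_finite_induct)
  case (insert a A)
  have "frag_of (x a + (\<Sum>i\<in>A. x i), b) - frag_of (x a, b) - frag_of (\<Sum>i\<in>A. x i, b) \<in> tensor_null j s"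
    by (rule tensor_null.add_left)
  from tensor_null_add[OF this insert.IH] insert.hyps show ?case by (simp add: algebra_simps)
qed (simp_all add: tensor_null_left_zero)

lemma tensor_null_right_diff:
  "frag_of (x, b - c) - (frag_of (x, b) - frag_of (x, c)) \<in> tensor_null j s"
  using tensor_null_uminus[OF tensor_null.add_right[of x "b - c" c j s]] by (simp add: algebra_simps)

text \<open>
  The coefficient \<open>u\<close> of a derivation \<open>u d/dX\<close>. The inverse map is \<open>witt_of\<close>.
\<close>

definition field_of :: "'f::field witt \<Rightarrow> 'f trunc7" where
  "field_of D = Rep_witt D tvar"

lemma Rep_witt_props:
  "Rep_witt D (f + g) = Rep_witt D f + Rep_witt D g"
  "Rep_witt D (scale_trunc7 c f) = scale_trunc7 c (Rep_witt D f)"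
  "Rep_witt D (f * g) = Rep_witt D f * g + f * Rep_witt D g"
  using Rep_witt[of D] by (simp_all add: in_derivations_trunc7_iff)

lemma Rep_witt_eq:
  fixes D :: "'f::field witt"
  assumes char: "(7 :: 'f) = 0"
  shows "Rep_witt D f = tderiv f * field_of D"
proof (rule frame_linear_eqI[OF trunc7_frame, where f = "Rep_witt D" and g = "\<lambda>f. tderiv f * field_of D" and s' = scale_trunc7])
  show "Vector_Spaces.linear scale_trunc7 scale_trunc7 (Rep_witt D)"
    "Vector_Spaces.linear scale_trunc7 scale_trunc7 (\<lambda>f. tderiv f * field_of D)"
    by (simp_all add: linear_scale_trunc7_iff Rep_witt_props tderiv_add tderiv_scale scale_trunc7_mult algebra_simps)
  have one: "Rep_witt D 1 = 0" using Rep_witt_props(3)[of D 1 1] by simp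
  show "Rep_witt D (tvar ^ i) = tderiv (tvar ^ i) * field_of D" for i
    by (induction i) (simp_all add: one tderiv_one Rep_witt_props tderiv_mult[OF char] tderiv_var algebra_simps flip: field_of_def)
qed

lemma field_of_inj:
  fixes D :: "'f::field witt"
  assumes char: "(7 :: 'f) = 0" and "field_of D = field_of D'"
  shows "D = D'"
  using Rep_witt_eq[OF char, of D] Rep_witt_eq[OF char, of D'] assms(2)
  by (simp add: Rep_witt_inject[symmetric] fun_eq_iff)

lemma field_of_simps:
  "field_of (D + D') = field_of D + field_of D'"
  "field_of (witt_scale c D) = scale_trunc7 c (field_of D)"
  by (simp_all add: field_of_def plus_witt.rep_eq witt_scale.rep_eq)

lemma field_of_bracket:
  fixes D :: "'f::field witt"
  assumes char: "(7 :: 'f) = 0"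
  shows "field_of (witt_bracket D D') = vf_bracket (field_of D) (field_of D')"
  using Rep_witt_eq[OF char, of D "field_of D'"] Rep_witt_eq[OF char, of D' "field_of D"]
  by (simp add: field_of_def witt_bracket.rep_eq commutator_def vf_bracket_def mult.commute)

definition witt_of :: "'f::field trunc7 \<Rightarrow> 'f witt" where
  "witt_of u = Abs_witt (\<lambda>f. tderiv f * u)"

lemma field_of_witt_of:
  assumes char: "(7 :: 'f::field) = 0"
  shows "field_of (witt_of u) = (u :: 'f trunc7)"
proof -
  have "(\<lambda>f. tderiv f * u) \<in> derivations scale_trunc7 (*)"
    by (simp add: in_derivations_trunc7_iff tderiv_add tderiv_scale tderiv_mult[OF char] scale_trunc7_mult algebra_simps)
  then show ?thesis by (simp add: field_of_def witt_of_def Abs_witt_inverse tderiv_var)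
qed

lemma witt_expansion:
  assumes char: "(7 :: 'f::field) = 0"
  shows "(D :: 'f witt) = (\<Sum>i<7. witt_scale (tcoeff (field_of D) i) (witt_of (tvar ^ i)))"
proof (rule field_of_inj[OF char])
  have d: "field_of (D - D') = field_of D - field_of D'" for D D' :: "'f witt"
    using field_of_simps(1)[of "D - D'" D'] by (simp add: eq_diff_eq)
  show "field_of D = field_of (\<Sum>i<7. witt_scale (tcoeff (field_of D) i) (witt_of (tvar ^ i)))"
    unfolding additive_sum(3)[OF d] field_of_simps field_of_witt_of[OF char] by (rule trunc7_expansion)
qed

text \<open>
  Extension of scalars from \<open>F\<close> to its algebraic closure, on truncated polynomials.
\<close>

definition tac :: "'f::field trunc7 \<Rightarrow> 'f alg_closure trunc7" where
  "tac f = (\<Sum>i<7. scale_trunc7 (to_ac (tcoeff f i)) (tvar ^ i))"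

lemma tcoeff_tac: "tcoeff (tac f) n = to_ac (tcoeff f n)"
proof (cases "n < 7")
  case True
  then show ?thesis unfolding tac_def by (rule tcoeff_var_sum)
qed (simp add: tcoeff_ge)

lemma tac_simps:
  "tac (f + g) = tac f + tac g" "tac (scale_trunc7 c f) = scale_trunc7 (to_ac c) (tac f)"
  "tac (f * g) = tac f * tac g" "tac (tderiv f) = tderiv (tac f)" "i < 7 \<Longrightarrow> tac (tvar ^ i) = tvar ^ i"
proof -
  show "tac (f + g) = tac f + tac g" "tac (scale_trunc7 c f) = scale_trunc7 (to_ac c) (tac f)"
    by (rule trunc7_eqI; simp add: tcoeff_tac tcoeff_add tcoeff_scale)+
  show "tac (f * g) = tac f * tac g" "tac (tderiv f) = tderiv (tac f)"
    by (rule trunc7_eqI; simp add: tcoeff_tac tcoeff_mult tcoeff_tderiv to_ac_sum)+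
  show "i < 7 \<Longrightarrow> tac (tvar ^ i) = tvar ^ i"
    by (rule trunc7_eqI) (simp add: tcoeff_tac tcoeff_var_power)
qed

lemma tac_bracket: "tac (vf_bracket u v) = vf_bracket (tac u) (tac v)"
proof -
  have d: "tac (f - g) = tac f - tac g" for f g :: "'a trunc7"
    using tac_simps(1)[of "f - g" g] by (simp add: eq_diff_eq)
  show ?thesis by (simp add: vf_bracket_def d tac_simps)
qed

text \<open>
  The given isomorphism followed by the evaluation of \<open>W \<otimes> K\<close> as vector fields over \<open>K\<close> is a map on the formal
  sums over \<open>L\<close> and \<open>K\<close>; \<open>\<theta>\<close> is its restriction to the sums \<open>x \<otimes> 1\<close>. It preserves linear independence since
  functionals on \<open>L\<close> extend to the tensor product.
\<close>

lemma twisted_form_fields: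
  fixes scaleL :: "'f::field \<Rightarrow> 'l::ab_group_add \<Rightarrow> 'l"
  assumes char: "(7 :: 'f) = 0"
    and tw: "twisted_form scaleL bracketL (witt_scale :: 'f \<Rightarrow> 'f witt \<Rightarrow> 'f witt) witt_bracket"
  shows "\<exists>\<theta> :: 'l \<Rightarrow> 'f alg_closure trunc7. (\<forall>x y. \<theta> (x + y) = \<theta> x + \<theta> y) \<and>
    (\<forall>c x. \<theta> (scaleL c x) = scale_trunc7 (to_ac c) (\<theta> x)) \<and>
    (\<forall>x y. \<theta> (bracketL x y) = vf_bracket (\<theta> x) (\<theta> y)) \<and>
    (\<forall>n v. indep_family scaleL n v \<longrightarrow> indep_family scale_trunc7 n (\<lambda>i. \<theta> (v i))) \<and>
    module.span scale_trunc7 (range \<theta>) = UNIV"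
proof -
  let ?j = "to_ac :: 'f \<Rightarrow> 'f alg_closure"
  let ?s = "scale_trunc7 :: 'f alg_closure \<Rightarrow> _"
  let ?w = "witt_scale :: 'f \<Rightarrow> _"
  obtain \<psi> where L: "nonassoc_algebra scaleL bracketL" and iso: "scalar_extension_iso ?j scaleL bracketL ?w witt_bracket \<psi>"
    using tw by (auto simp: twisted_form_def)
  interpret L: nonassoc_algebra scaleL bracketL by (rule L)
  interpret W: nonassoc_algebra ?w witt_bracket by (rule nonassoc_algebra_witt)
  have vs: "vector_space ?s" by (rule vector_space_scale_trunc7)
  note psi = iso[unfolded scalar_extension_iso_def]
  have inC: "tensor_class ?j scaleL u \<in> tensor_carrier ?j scaleL" for u by (auto simp: tensor_carrier_def)
  define \<tau> where "\<tau> = (\<lambda>D :: 'f witt. tac (field_of D))"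
  have \<tau>_add: "\<tau> (D + D') = \<tau> D + \<tau> D'" and \<tau>_scale: "\<tau> (?w c D) = ?s (?j c) (\<tau> D)"
    and \<tau>_br: "\<tau> (witt_bracket D D') = vf_bracket (\<tau> D) (\<tau> D')" for D D' c
    by (simp_all add: \<tau>_def field_of_simps field_of_bracket[OF char] tac_simps tac_bracket)
  have \<tau>_basis: "\<tau> (witt_of (tvar ^ i)) = tvar ^ i" if "i < 7" for i
    using that by (simp add: \<tau>_def field_of_witt_of[OF char] tac_simps)
  let ?e = "tensor_ext ?s \<tau>"
  note e_diff = tensor_ext_diff[OF vs]
  have e_null: "?e u = 0" if "u \<in> tensor_null ?j ?w" for u
    by (rule tensor_ext_null[OF vs \<tau>_add \<tau>_scale that])
  \<comment> \<open>Every formal sum is congruent to one of these, which makes the evaluation injective on the tensor product.\<close>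
  define std where "std = (\<lambda>k. \<Sum>i<7. frag_of (witt_of (tvar ^ i :: 'f trunc7), k i :: 'f alg_closure))"
  have e_std: "?e (std k) = (\<Sum>i<7. ?s (k i) (tvar ^ i))" for k
  proof -
    have "?e (std k) = (\<Sum>i<7. ?e (frag_of (witt_of (tvar ^ i), k i)))"
      unfolding std_def by (rule additive_sum(3)) (rule e_diff)
    also have "\<dots> = (\<Sum>i<7. ?s (k i) (tvar ^ i))"
      by (rule sum.cong) (simp_all add: tensor_ext_of \<tau>_basis)
    finally show ?thesis .
  qed
  have normal: "\<exists>k. u - std k \<in> tensor_null ?j ?w" for u
  proof (induction u rule: frag_induction[OF subset_UNIV])
    case 1
    have "std (\<lambda>_. 0) \<in> tensor_null ?j ?w"
      unfolding std_def by (rule tensor_null_sum) (rule tensor_null_right_zero)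
    from tensor_null_uminus[OF this] show ?case by (intro exI[of _ "\<lambda>_. 0"]) simp
  next
    case (2 p)
    obtain D b where p: "p = (D, b)" by (cases p)
    define c where "c = tcoeff (field_of D)"
    have "frag_of (D, b) - (\<Sum>i<7. frag_of (?w (c i) (witt_of (tvar ^ i)), b)) \<in> tensor_null ?j ?w"
      using tensor_null_left_sum[of "\<lambda>i. ?w (c i) (witt_of (tvar ^ i))" "{..<7}" b ?j ?w]
        witt_expansion[OF char, of D] by (simp add: c_def)
    moreover have "(\<Sum>i<7. frag_of (?w (c i) (witt_of (tvar ^ i)), b)) - std (\<lambda>i. ?j (c i) * b) \<in> tensor_null ?j ?w"
      unfolding std_def sum_subtractf[symmetric] by (rule tensor_null_sum) (rule tensor_null.balanced)
    ultimately show ?case unfolding p by (blast intro: tensor_null_trans)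
  next
    case (3 u u')
    then obtain k k' where k: "u - std k \<in> tensor_null ?j ?w" "u' - std k' \<in> tensor_null ?j ?w" by blast
    have "std (\<lambda>i. k i - k' i) - (std k - std k') \<in> tensor_null ?j ?w"
      unfolding std_def sum_subtractf[symmetric] by (rule tensor_null_sum) (rule tensor_null_right_diff)
    from tensor_null.diff[OF tensor_null.diff[OF k] this]
    have "u - u' - std (\<lambda>i. k i - k' i) \<in> tensor_null ?j ?w" by (simp add: algebra_simps)
    then show ?case by blast
  qed
  have e_inj: "u \<in> tensor_null ?j ?w" if u: "?e u = 0" for u
  proof -
    obtain k where k: "u - std k \<in> tensor_null ?j ?w" using normal by blast
    have "?e (std k) = 0" using e_null[OF k] u by (simp add: e_diff)
    then have "k i = 0" if "i < 7" for i
      using tcoeff_var_sum[OF that, of k] by (simp add: e_std tcoeff_zero)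
    then have "std k \<in> tensor_null ?j ?w"
      unfolding std_def by (intro tensor_null_sum) (simp add: tensor_null_right_zero)
    from tensor_null_add[OF k this] show ?thesis by simp
  qed
  have "\<exists>w. \<psi> (tensor_class ?j scaleL u) = tensor_class ?j ?w w" for u
  proof -
    have "\<psi> (tensor_class ?j scaleL u) \<in> \<psi> ` tensor_carrier ?j scaleL" using inC by (rule imageI)
    also have "\<dots> = tensor_carrier ?j ?w" using psi by (simp add: bij_betw_def)
    finally show ?thesis by (auto simp: tensor_carrier_def)
  qed
  then obtain rep where rep: "\<And>u. \<psi> (tensor_class ?j scaleL u) = tensor_class ?j ?w (rep u)" by metis
  define \<Theta> where "\<Theta> = (\<lambda>u. ?e (rep u))"
  have \<Theta>_eq: "\<Theta> u = ?e w" if "\<psi> (tensor_class ?j scaleL u) = tensor_class ?j ?w w" for u w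
  proof -
    have "rep u - w \<in> tensor_null ?j ?w" using that rep[of u] by (simp add: tensor_class_eq_iff)
    from e_null[OF this] show ?thesis by (simp add: e_diff \<Theta>_def)
  qed
  have \<Theta>_class: "\<Theta> u = \<Theta> v" if "u - v \<in> tensor_null ?j scaleL" for u v
    using that \<Theta>_eq[of u "rep v"] rep by (simp add: tensor_class_eq_iff[symmetric] \<Theta>_def)
  have \<Theta>_add: "\<Theta> (u + v) = \<Theta> u + \<Theta> v" for u v
  proof -
    have "\<psi> (tensor_class ?j scaleL (u + v)) = tensor_class ?j ?w (rep u + rep v)"
      using psi inC by (simp flip: tensor_add_class add: rep)
    then show ?thesis using \<Theta>_eq by (simp add: \<Theta>_def additive_sum(2)[of ?e, OF e_diff])
  qed
  have \<Theta>_smult: "\<Theta> (formal_smult c u) = ?s c (\<Theta> u)" for c u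
  proof -
    have "\<psi> (tensor_class ?j scaleL (formal_smult c u)) = tensor_class ?j ?w (formal_smult c (rep u))"
      using psi inC by (simp flip: tensor_smult_class add: rep)
    then show ?thesis using \<Theta>_eq tensor_ext_smult[OF vs] by (simp add: \<Theta>_def)
  qed
  have \<Theta>_mult: "\<Theta> (formal_mult bracketL u v) = vf_bracket (\<Theta> u) (\<Theta> v)" for u v
  proof -
    have "\<psi> (tensor_class ?j scaleL (formal_mult bracketL u v)) = tensor_class ?j ?w (formal_mult witt_bracket (rep u) (rep v))"
      using psi inC by (simp flip: L.tensor_mult_class W.tensor_mult_class add: rep)
    then show ?thesis using \<Theta>_eq tensor_ext_mult[OF vs \<tau>_br vf_bracket_linear] by (simp add: \<Theta>_def)
  qed
  have \<Theta>_diff: "\<Theta> (u - v) = \<Theta> u - \<Theta> v" for u v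
    using \<Theta>_add[of "u - v" v] by (simp add: eq_diff_eq)
  have \<Theta>_null: "u \<in> tensor_null ?j scaleL" if "\<Theta> u = 0" for u
  proof -
    have "rep u \<in> tensor_null ?j ?w" using that by (intro e_inj) (simp add: \<Theta>_def)
    moreover have "rep 0 \<in> tensor_null ?j ?w"
      using additive_sum(1)[OF \<Theta>_diff] by (intro e_inj) (simp add: \<Theta>_def)
    ultimately have "\<psi> (tensor_class ?j scaleL u) = \<psi> (tensor_class ?j scaleL 0)"
      unfolding rep tensor_class_eq_iff by (rule tensor_null.diff)
    moreover have "inj_on \<psi> (tensor_carrier ?j scaleL)" using psi by (simp add: bij_betw_def)
    ultimately have "tensor_class ?j scaleL u = tensor_class ?j scaleL 0" using inC by (meson inj_onD)
    then show ?thesis by (simp add: tensor_class_eq_iff)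
  qed
  define \<theta> where "\<theta> = (\<lambda>x. \<Theta> (frag_of (x, 1)))"
  have \<Theta>_of: "\<Theta> (frag_of (x, b)) = ?s b (\<theta> x)" for x b
    using \<Theta>_smult[of b "frag_of (x, 1)"] by (simp add: \<theta>_def formal_smult_def)
  have \<theta>_add: "\<theta> (x + y) = \<theta> x + \<theta> y" for x y
    using \<Theta>_class[of "frag_of (x + y, 1)" "frag_of (x, 1) + frag_of (y, 1)"] tensor_null.add_left[of x y 1 ?j scaleL]
    by (simp add: \<theta>_def \<Theta>_add diff_diff_eq)
  have \<theta>_scale: "\<theta> (scaleL c x) = ?s (?j c) (\<theta> x)" for c x
    using \<Theta>_class[OF tensor_null.balanced[of scaleL c x 1 ?j]] by (simp add: \<Theta>_of)
  have \<theta>_br: "\<theta> (bracketL x y) = vf_bracket (\<theta> x) (\<theta> y)" for x y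
    using \<Theta>_mult[of "frag_of (x, 1)" "frag_of (y, 1)"] by (simp add: \<theta>_def formal_mult_of)
  have indep: "indep_family ?s n (\<lambda>i. \<theta> (v i))" if v: "indep_family scaleL n v" for n v
    unfolding indep_family_def
  proof (intro allI impI)
    fix c i assume c: "(\<Sum>i<n. ?s (c i) (\<theta> (v i))) = 0" and i: "i < n"
    define u where "u = (\<Sum>i<n. frag_of (v i, c i))"
    have "\<Theta> u = 0" unfolding u_def additive_sum(3)[OF \<Theta>_diff] \<Theta>_of by (rule c)
    then have u: "u \<in> tensor_null ?j scaleL" by (rule \<Theta>_null)
    have vF: "vector_space ((*) :: 'f \<Rightarrow> _)" by unfold_locales (auto simp: algebra_simps)
    have vK: "vector_space ((*) :: 'f alg_closure \<Rightarrow> _)" by unfold_locales (auto simp: algebra_simps)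
    interpret LF: vector_space_pair scaleL "(*) :: 'f \<Rightarrow> _"
      using vF L.vector_space_axioms by (simp add: vector_space_pair_def)
    note fi = family_independent[OF L.vector_space_axioms v]
    obtain g where g: "Vector_Spaces.linear scaleL (*) g" "\<forall>x\<in>v ` {..<n}. g x = (if x = v i then 1 else 0 :: 'f)"
      using LF.linear_independent_extend[OF fi(2), of "\<lambda>x. if x = v i then 1 else 0"] by blast
    have gv: "g (v k) = (if k = i then 1 else 0)" if "k < n" for k
      using g(2) that i inj_onD[OF fi(1), of k i] by auto
    have "tensor_ext (*) (\<lambda>x. ?j (g x)) u = 0"
      by (rule tensor_ext_null[OF vK _ _ u]) (use g(1) in \<open>simp_all add: Vector_Spaces.linear_iff\<close>)
    moreover have "tensor_ext (*) (\<lambda>x. ?j (g x)) u = (\<Sum>k<n. tensor_ext (*) (\<lambda>x. ?j (g x)) (frag_of (v k, c k)))"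
      unfolding u_def by (rule additive_sum(3)) (rule tensor_ext_diff[OF vK])
    moreover have "\<dots> = (\<Sum>k<n. if k = i then c i else 0)"
      by (rule sum.cong) (auto simp: tensor_ext_of gv)
    ultimately show "c i = 0" using i by simp
  qed
  have span: "module.span ?s (range \<theta>) = UNIV"
  proof -
    have "\<Theta> u = tensor_ext ?s \<theta> u" for u
      by (induction u rule: frag_induction[OF subset_UNIV])
         (auto simp: additive_sum(1)[OF \<Theta>_diff] tensor_ext_0 \<Theta>_of tensor_ext_of \<Theta>_diff tensor_ext_diff[OF vs])
    then have in_span: "\<Theta> u \<in> trunc7.span (range \<theta>)" for u
      by (simp add: tensor_ext_def trunc7.span_sum trunc7.span_scale trunc7.span_base)
    have "a \<in> trunc7.span (range \<theta>)" for a
    proof -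
      have a: "?e (std (tcoeff a)) = a" unfolding e_std by (rule trunc7_expansion[symmetric])
      have "tensor_class ?j ?w (std (tcoeff a)) \<in> \<psi> ` tensor_carrier ?j scaleL"
        using psi by (auto simp: bij_betw_def tensor_carrier_def)
      then obtain u where "\<psi> (tensor_class ?j scaleL u) = tensor_class ?j ?w (std (tcoeff a))"
        by (auto simp: tensor_carrier_def)
      then have "\<Theta> u = a" using \<Theta>_eq a by simp
      then show ?thesis using in_span[of u] by simp
    qed
    then show ?thesis by blast
  qed
  show ?thesis
    using \<theta>_add \<theta>_scale \<theta>_br indep span by blast
qed

text \<open>
  Independent families of \<open>L\<close> have at most 7 members, as this holds for their images; a basis of \<open>L\<close> is mapped to a
  spanning independent family over \<open>K\<close>.
\<close>

lemma twisted_form_frame: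
  fixes scaleL :: "'f::field \<Rightarrow> 'l::ab_group_add \<Rightarrow> 'l"
  assumes char: "(7 :: 'f) = 0"
    and tw: "twisted_form scaleL bracketL (witt_scale :: 'f \<Rightarrow> 'f witt \<Rightarrow> 'f witt) witt_bracket"
  shows "\<exists>(\<theta> :: 'l \<Rightarrow> 'f alg_closure trunc7) v. (\<forall>x y. \<theta> (x + y) = \<theta> x + \<theta> y) \<and>
    (\<forall>c x. \<theta> (scaleL c x) = scale_trunc7 (to_ac c) (\<theta> x)) \<and>
    (\<forall>x y. \<theta> (bracketL x y) = vf_bracket (\<theta> x) (\<theta> y)) \<and>
    frame scaleL UNIV 7 v \<and> frame scale_trunc7 UNIV 7 (\<lambda>i. \<theta> (v i))"
proof -
  obtain \<theta> :: "'l \<Rightarrow> 'f alg_closure trunc7" where \<theta>: "\<And>x y. \<theta> (x + y) = \<theta> x + \<theta> y"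
    "\<And>c x. \<theta> (scaleL c x) = scale_trunc7 (to_ac c) (\<theta> x)" "\<And>x y. \<theta> (bracketL x y) = vf_bracket (\<theta> x) (\<theta> y)"
    and indep: "\<And>n v. indep_family scaleL n v \<Longrightarrow> indep_family scale_trunc7 n (\<lambda>i. \<theta> (v i))"
    and span: "module.span scale_trunc7 (range \<theta>) = UNIV"
    using twisted_form_fields[OF char tw] by blast
  interpret L: nonassoc_algebra scaleL bracketL using tw by (simp add: twisted_form_def)
  have vsL: "vector_space scaleL" by unfold_locales
  obtain B where B: "B \<subseteq> UNIV" "L.independent B" "UNIV \<subseteq> L.span B" "card B = L.dim UNIV" by (rule L.basis_exists)
  have bound: "card A \<le> 7" if A: "finite A" "A \<subseteq> B" for A
  proof -
    have indA: "L.independent A" using B(2) A(2) by (rule L.independent_mono)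
    obtain v where v: "bij_betw v {..<card A} A"
      using ex_bij_betw_nat_finite[OF A(1)] unfolding atLeast0LessThan by blast
    have "indep_family scaleL (card A) v"
      unfolding indep_family_def
    proof (intro allI impI)
      fix c i assume c: "(\<Sum>i<card A. scaleL (c i) (v i)) = 0" and i: "i < card A"
      let ?f = "\<lambda>b. c (inv_into {..<card A} v b)"
      have inj: "inj_on v {..<card A}" using v by (simp add: bij_betw_def)
      have "(\<Sum>b\<in>A. scaleL (?f b) b) = (\<Sum>i<card A. scaleL (?f (v i)) (v i))"
        by (rule sum.reindex_bij_betw[OF v, symmetric])
      also have "\<dots> = 0" using c inj by (simp add: inv_into_f_f)
      finally have "?f (v i) = 0"
        using L.independentD[OF indA A(1) subset_refl, of ?f "v i"] i v by (auto simp: bij_betw_def)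
      then show "c i = 0" using inj i by (simp add: inv_into_f_f)
    qed
    from indep[OF this] have "frame scale_trunc7 (trunc7.span ((\<lambda>i. \<theta> (v i)) ` {..<card A})) (card A) (\<lambda>i. \<theta> (v i))"
      by (rule frame_if_span[OF vector_space_scale_trunc7])
    note fi = family_independent[OF vector_space_scale_trunc7 indep[OF \<open>indep_family scaleL (card A) v\<close>]]
    have "(\<lambda>i. \<theta> (v i)) ` {..<card A} \<subseteq> trunc7.span ((\<lambda>i. tvar ^ i) ` {..<7})"
    proof
      fix x :: "'f alg_closure trunc7"
      show "x \<in> trunc7.span ((\<lambda>i. tvar ^ i) ` {..<7})"
        by (subst trunc7_expansion) (intro trunc7.span_sum trunc7.span_scale trunc7.span_base, auto)
    qed
    then have "card ((\<lambda>i. \<theta> (v i)) ` {..<card A}) \<le> card ((\<lambda>i. tvar ^ i :: 'f alg_closure trunc7) ` {..<7})"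
      using trunc7.independent_span_bound[OF _ fi(2)] by auto
    also have "\<dots> \<le> 7" using card_image_le[of "{..<7::nat}" "\<lambda>i. tvar ^ i :: 'f alg_closure trunc7"] by simp
    finally show ?thesis using fi(1) by (simp add: card_image)
  qed
  have "finite B"
  proof (rule ccontr)
    assume "infinite B"
    then obtain A where "A \<subseteq> B" "finite A" "card A = 8" using infinite_arbitrarily_large by blast
    with bound[of A] show False by simp
  qed
  moreover have "L.span B = UNIV" using B(3) by (rule top.extremum_uniqueI)
  ultimately obtain v where v: "frame scaleL UNIV (card B) v"
    using frame_of_finite_basis[OF vsL _ B(2)] by metis
  interpret V: frame scaleL UNIV "card B" v by (rule v)
  have frK: "frame scale_trunc7 (trunc7.span ((\<lambda>i. \<theta> (v i)) ` {..<card B})) (card B) (\<lambda>i. \<theta> (v i))"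
    by (rule frame_if_span[OF vector_space_scale_trunc7 indep[OF V.frame_indep]])
  have "range \<theta> \<subseteq> trunc7.span ((\<lambda>i. \<theta> (v i)) ` {..<card B})"
  proof
    fix y assume "y \<in> range \<theta>"
    then obtain x where y: "y = \<theta> x" by blast
    have d: "\<theta> (x - x') = \<theta> x - \<theta> x'" for x x' using \<theta>(1)[of "x - x'" x'] by (simp add: eq_diff_eq)
    have "\<theta> x = \<theta> (\<Sum>i<card B. scaleL (V.coord x i) (v i))" by (simp add: V.sum_coord)
    also have "\<dots> = (\<Sum>i<card B. scale_trunc7 (to_ac (V.coord x i)) (\<theta> (v i)))"
      by (simp add: additive_sum(3)[of \<theta>, OF d] \<theta>(2))
    also have "\<dots> \<in> trunc7.span ((\<lambda>i. \<theta> (v i)) ` {..<card B})"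
      by (intro trunc7.span_sum trunc7.span_scale trunc7.span_base) auto
    finally show "y \<in> trunc7.span ((\<lambda>i. \<theta> (v i)) ` {..<card B})" unfolding y .
  qed
  then have "trunc7.span (range \<theta>) \<subseteq> trunc7.span ((\<lambda>i. \<theta> (v i)) ` {..<card B})"
    by (rule trunc7.span_minimal) (rule trunc7.subspace_span)
  then have "trunc7.span ((\<lambda>i. \<theta> (v i)) ` {..<card B}) = UNIV" unfolding span by blast
  with frK have frK: "frame scale_trunc7 UNIV (card B) (\<lambda>i. \<theta> (v i))" by simp
  have "card B = 7"
    using frame_card_le[OF frK trunc7_frame] frame_card_le[OF trunc7_frame frK] by simp
  then show ?thesis using \<theta> v frK by auto
qed

section \<open>The normal form of twisted forms\<close>

text \<open>
  An \<open>F\<close>-form of the vector fields on the truncated line over an extension \<open>j : F \<rightarrow> K\<close>: the algebra over \<open>F\<close> is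
  mapped by \<open>\<theta>\<close> onto the \<open>F\<close>-span of a \<open>K\<close>-basis.
\<close>

locale witt_form = nonassoc_algebra scale bracket
  for scale :: "'f::field \<Rightarrow> 'l::ab_group_add \<Rightarrow> 'l" and bracket :: "'l \<Rightarrow> 'l \<Rightarrow> 'l" +
  fixes j :: "'f \<Rightarrow> 'k::field" and \<theta> :: "'l \<Rightarrow> 'k trunc7" and v :: "nat \<Rightarrow> 'l"
  assumes char: "(7 :: 'k) = 0"
    and j_hom: "j (a + a') = j a + j a'" "j (a * a') = j a * j a'" "j 1 = 1"
    and \<theta>_add: "\<theta> (l + m) = \<theta> l + \<theta> m"
    and \<theta>_scale: "\<theta> (scale a l) = scale_trunc7 (j a) (\<theta> l)"
    and \<theta>_bracket: "\<theta> (bracket l m) = vf_bracket (\<theta> l) (\<theta> m)"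
    and frame_v: "frame scale UNIV 7 v"
    and frame_\<theta>: "frame scale_trunc7 UNIV 7 (\<lambda>i. \<theta> (v i))"
begin

lemma j_0: "j 0 = 0"
  using j_hom(1)[of 0 0] by (simp only: add_0_left add_cancel_right_right)

lemma j_diff: "j (a - b) = j a - j b"
  using j_hom(1)[of "a - b" b] by (simp add: eq_diff_eq)

lemma j_of_nat: "j (of_nat n) = of_nat n"
  by (induction n) (simp_all add: j_0 j_hom)

lemma j_eq_0: "j a = 0 \<longleftrightarrow> a = 0"
proof
  assume a: "j a = 0"
  show "a = 0"
  proof (rule ccontr)
    assume "a \<noteq> 0"
    then show False using j_hom(2)[of a "1 / a"] a by (simp add: j_hom(3))
  qed
qed (simp add: j_0)

lemma \<theta>_diff: "\<theta> (l - m) = \<theta> l - \<theta> m"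
  using \<theta>_add[of "l - m" m] by (simp add: eq_diff_eq)

lemmas \<theta>_sum = additive_sum(3)[of \<theta>, OF \<theta>_diff]

lemma \<theta>_comb: "\<theta> (\<Sum>i\<in>A. scale (c i) (w i)) = (\<Sum>i\<in>A. scale_trunc7 (j (c i)) (\<theta> (w i)))"
  by (simp add: \<theta>_sum \<theta>_scale)

lemma coord_\<theta>:
  assumes "i < 7"
  shows "frame.coord scale_trunc7 7 (\<lambda>i. \<theta> (v i)) (\<theta> l) i = j (frame.coord scale 7 v l i)"
proof -
  interpret V: frame scale UNIV 7 v by (rule frame_v)
  interpret W: frame scale_trunc7 UNIV 7 "\<lambda>i. \<theta> (v i)" by (rule frame_\<theta>)
  have "\<theta> l = \<theta> (\<Sum>i<7. scale (V.coord l i) (v i))" by (simp add: V.sum_coord)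
  then show ?thesis using W.coord_comb[OF assms] by (simp add: \<theta>_comb)
qed

lemma \<theta>_inj: "\<theta> l = \<theta> m \<Longrightarrow> l = m"
proof -
  interpret V: frame scale UNIV 7 v by (rule frame_v)
  assume eq: "\<theta> l = \<theta> m"
  have "V.coord (l - m) i = 0" if "i < 7" for i
  proof -
    have "j (V.coord (l - m) i) = frame.coord scale_trunc7 7 (\<lambda>i. \<theta> (v i)) 0 i"
      using coord_\<theta>[OF that, of "l - m"] eq by (simp add: \<theta>_diff)
    also have "\<dots> = 0" by (rule frame.coord_zero[OF frame_\<theta>])
    finally show ?thesis by (simp add: j_eq_0)
  qed
  then have "(\<Sum>i<7. scale (V.coord (l - m) i) (v i)) = 0" by simp
  then have "l - m = 0" using V.sum_coord[of "l - m"] by simp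
  then show "l = m" by simp
qed

lemma frame_if_\<theta>_indep:
  assumes "indep_family scale_trunc7 7 (\<lambda>i. \<theta> (w i))"
  shows "frame scale UNIV 7 w"
proof (rule frame_exchange[OF frame_v])
  show "indep_family scale 7 w"
    unfolding indep_family_def
  proof (intro allI impI)
    fix c i assume c: "(\<Sum>i<7. scale (c i) (w i)) = 0" and i: "i < (7::nat)"
    have "(\<Sum>i<7. scale_trunc7 (j (c i)) (\<theta> (w i))) = 0"
      using arg_cong[OF c, of \<theta>] \<theta>_diff[of 0 0] by (simp add: \<theta>_comb)
    from indep_familyD[OF assms this i] show "c i = 0" by (simp add: j_eq_0)
  qed
qed simp

lemma unit_exists: "\<exists>l. tcoeff (\<theta> l) 0 \<noteq> 0"
proof (rule ccontr)
  interpret W: frame scale_trunc7 UNIV 7 "\<lambda>i. \<theta> (v i)" by (rule frame_\<theta>)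
  assume "\<nexists>l. tcoeff (\<theta> l) 0 \<noteq> 0"
  then have "tcoeff (\<Sum>i<7. scale_trunc7 (W.coord 1 i) (\<theta> (v i))) 0 = 0"
    by (simp add: tcoeff_sum tcoeff_scale)
  moreover have "(\<Sum>i<7. scale_trunc7 (W.coord 1 i) (\<theta> (v i))) = 1" by (rule W.sum_coord) simp
  ultimately show False by (simp add: tcoeff_one)
qed

text \<open>
  Let \<open>\<Gamma>\<close> be a basis of \<open>K\<close> over \<open>F\<close>. Taking the component at \<open>\<beta>\<close> in \<open>\<Gamma>\<close> gives an \<open>F\<close>-linear projection \<open>P \<beta>\<close>
  of vector fields over \<open>K\<close> onto the form, which commutes with brackets by elements of the form. So the
  components \<open>T \<beta>\<close> of multiplication by \<open>tvar\<close> satisfy the condition of \<open>vf_half_derivation\<close>, and they are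
  multiplications by functions \<open>f \<beta>\<close>. Since \<open>tvar\<close> is a \<open>K\<close>-combination of finitely many of these, not all of
  them can have linear coefficient zero.
\<close>

lemma multiplier_exists:
  "\<exists>T x. Vector_Spaces.linear scale scale T \<and> (\<forall>l. \<theta> (T l) = x * \<theta> l) \<and> tcoeff x 1 \<noteq> 0"
proof -
  interpret V: frame scale UNIV 7 v by (rule frame_v)
  interpret W: frame scale_trunc7 UNIV 7 "\<lambda>i. \<theta> (v i)" by (rule frame_\<theta>)
  define sK where "sK = (\<lambda>c k. j c * k)"
  interpret K: vector_space sK
    by unfold_locales (simp_all add: sK_def j_hom algebra_simps)
  obtain \<Gamma> where \<Gamma>: "\<Gamma> \<subseteq> UNIV" "K.independent \<Gamma>" "UNIV \<subseteq> K.span \<Gamma>" "card \<Gamma> = K.dim UNIV"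
    by (rule K.basis_exists)
  then have in_span: "k \<in> K.span \<Gamma>" for k by blast
  define r where "r = K.representation \<Gamma>"
  have r_add: "r (k + k') \<beta> = r k \<beta> + r k' \<beta>" and r_scale: "r (j c * k) \<beta> = c * r k \<beta>" for k k' \<beta> c
    using K.representation_add[OF \<Gamma>(2) in_span in_span, of k k'] K.representation_scale[OF \<Gamma>(2) in_span, of c k]
    by (simp_all add: r_def sK_def)
  have r_finite: "finite {\<beta>. r k \<beta> \<noteq> 0}" for k
    unfolding r_def by (rule K.finite_representation)
  have r_sum: "(\<Sum>\<beta>\<in>A. j (r k \<beta>) * \<beta>) = k" if "finite A" "{\<beta>. r k \<beta> \<noteq> 0} \<subseteq> A" for A k
  proof -
    have "(\<Sum>\<beta>\<in>A. j (r k \<beta>) * \<beta>) = (\<Sum>\<beta> | r k \<beta> \<noteq> 0. j (r k \<beta>) * \<beta>)"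
      by (rule sum.mono_neutral_right) (use that in \<open>auto simp: j_0\<close>)
    also have "\<dots> = k"
      using K.sum_nonzero_representation_eq[OF \<Gamma>(2) in_span, of k] by (simp add: r_def sK_def)
    finally show ?thesis .
  qed
  define P where "P = (\<lambda>\<beta> a. \<Sum>i<7. scale (r (W.coord a i) \<beta>) (v i))"
  have P_add: "P \<beta> (a + b) = P \<beta> a + P \<beta> b" for \<beta> a b
    by (simp add: P_def W.coord_add r_add scale_left_distrib sum.distrib)
  have P_diff: "P \<beta> (a - b) = P \<beta> a - P \<beta> b" for \<beta> a b
    using P_add[of \<beta> "a - b" b] by (simp add: eq_diff_eq)
  note P_sum = additive_sum(3)[of "P _", OF P_diff]
  have P_scale: "P \<beta> (scale_trunc7 (j c) a) = scale c (P \<beta> a)" for \<beta> c a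
    by (simp add: P_def W.coord_scale r_scale scale_sum_right)
  have P_\<theta>: "P \<beta> (scale_trunc7 k (\<theta> l)) = scale (r k \<beta>) l" for \<beta> k l
  proof -
    have "P \<beta> (scale_trunc7 k (\<theta> l)) = (\<Sum>i<7. scale (r k \<beta>) (scale (V.coord l i) (v i)))"
      unfolding P_def by (rule sum.cong) (simp_all add: W.coord_scale coord_\<theta> mult.commute[of k "j _"] r_scale mult.commute[of _ "r k \<beta>"])
    also have "\<dots> = scale (r k \<beta>) l"
      unfolding scale_sum_right[symmetric] by (simp add: V.sum_coord)
    finally show ?thesis .
  qed
  have W_exp: "(\<Sum>i<7. scale_trunc7 (W.coord a i) (\<theta> (v i))) = a" for a by (rule W.sum_coord) simp
  have P_bracket: "P \<beta> (vf_bracket (\<theta> l) a) = bracket l (P \<beta> a)" for \<beta> l a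
  proof -
    interpret B: Vector_Spaces.linear scale_trunc7 scale_trunc7 "vf_bracket (\<theta> l)" by (rule vf_bracket_linear)
    interpret C: Vector_Spaces.linear scale scale "bracket l"
      using vector_space_axioms by (simp add: Vector_Spaces.linear_iff mult_add_right mult_scale_right)
    have "vf_bracket (\<theta> l) a = (\<Sum>i<7. scale_trunc7 (W.coord a i) (\<theta> (bracket l (v i))))"
      by (subst W_exp[of a, symmetric]) (simp add: B.sum B.scale \<theta>_bracket)
    then show ?thesis by (simp add: P_sum P_\<theta>) (simp add: P_def C.sum C.scale)
  qed
  have bracket_skew: "bracket l m = - bracket m l" for l m
    by (rule \<theta>_inj) (use \<theta>_diff[of 0] \<theta>_diff[of 0 0] in \<open>simp add: \<theta>_bracket vf_bracket_def\<close>)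
  have P_bracket': "P \<beta> (vf_bracket a (\<theta> l)) = bracket (P \<beta> a) l" for \<beta> l a
  proof -
    have "P \<beta> (vf_bracket a (\<theta> l)) = P \<beta> (0 - vf_bracket (\<theta> l) a)" by (simp add: vf_bracket_def)
    also have "\<dots> = - bracket l (P \<beta> a)"
      unfolding P_diff P_bracket using P_diff[of \<beta> 0 0] by simp
    finally show ?thesis using bracket_skew[of "P \<beta> a" l] by simp
  qed
  define T where "T = (\<lambda>\<beta> l. P \<beta> (tvar * \<theta> l))"
  have T_lin: "Vector_Spaces.linear scale scale (T \<beta>)" for \<beta>
    using vector_space_axioms
    by (simp add: Vector_Spaces.linear_iff T_def \<theta>_add \<theta>_scale distrib_left P_add scale_trunc7_mult P_scale)
  have T_half: "T \<beta> (bracket l m) + T \<beta> (bracket l m) = bracket (T \<beta> l) m + bracket l (T \<beta> m)" for \<beta> l m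
  proof -
    have "tvar * \<theta> (bracket l m) + tvar * \<theta> (bracket l m)
        = vf_bracket (tvar * \<theta> l) (\<theta> m) + vf_bracket (\<theta> l) (tvar * \<theta> m)"
      by (simp add: \<theta>_bracket vf_bracket_def tderiv_mult[OF char] tderiv_var algebra_simps)
    from arg_cong[OF this, of "P \<beta>"] show ?thesis
      by (simp only: P_add P_bracket P_bracket' T_def)
  qed
  define S where "S = (\<lambda>\<beta> a. \<Sum>i<7. scale_trunc7 (W.coord a i) (\<theta> (T \<beta> (v i))))"
  have S_lin: "Vector_Spaces.linear scale_trunc7 scale_trunc7 (S \<beta>)" for \<beta>
    unfolding S_def by (rule linear_comb_map[OF frame_\<theta> vector_space_scale_trunc7])
  then have S_simps: "S \<beta> (a + b) = S \<beta> a + S \<beta> b" "S \<beta> (scale_trunc7 c a) = scale_trunc7 c (S \<beta> a)" for \<beta> a b c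
    by (simp_all add: linear_scale_trunc7_iff)
  have S_\<theta>: "S \<beta> (\<theta> l) = \<theta> (T \<beta> l)" for \<beta> l
  proof -
    have "\<theta> (T \<beta> l) = \<theta> (\<Sum>i<7. scale (V.coord l i) (T \<beta> (v i)))"
      using V.linear_frame_expansion[OF T_lin, of l] by simp
    also have "\<dots> = S \<beta> (\<theta> l)"
      unfolding \<theta>_comb S_def by (rule sum.cong) (simp_all add: coord_\<theta>)
    finally show ?thesis by simp
  qed
  have S_half: "2 * S \<beta> (vf_bracket a b) = vf_bracket (S \<beta> a) b + vf_bracket a (S \<beta> b)" for \<beta> a b
  proof (rule frame_bilinear_eqI[OF frame_\<theta>, where s' = scale_trunc7 and f = "\<lambda>a b. 2 * S \<beta> (vf_bracket a b)"
        and g = "\<lambda>a b. vf_bracket (S \<beta> a) b + vf_bracket a (S \<beta> b)"])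
    fix i k :: nat
    show "2 * S \<beta> (vf_bracket (\<theta> (v i)) (\<theta> (v k)))
        = vf_bracket (S \<beta> (\<theta> (v i))) (\<theta> (v k)) + vf_bracket (\<theta> (v i)) (S \<beta> (\<theta> (v k)))"
      using arg_cong[OF T_half[of \<beta> "v i" "v k"], of \<theta>]
      by (simp only: \<theta>_add \<theta>_bracket S_\<theta> mult_2 flip: \<theta>_bracket)
  qed (simp_all add: linear_scale_trunc7_iff vf_bracket_bilinear S_simps distrib_left scale_trunc7_mult
      trunc7.scale_right_distrib algebra_simps)
  define f where "f = (\<lambda>\<beta>. S \<beta> 1)"
  have T_f: "\<theta> (T \<beta> l) = f \<beta> * \<theta> l" for \<beta> l
    using vf_half_derivation[OF char S_lin S_half, of \<beta> "\<theta> l"] by (simp add: S_\<theta> f_def)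
  \<comment> \<open>Any element with an invertible image allows one to cancel it below.\<close>
  obtain l where l: "tcoeff (\<theta> l) 0 \<noteq> 0" using unit_exists by blast
  obtain h where h: "\<theta> l * h = 1" using trunc7_unit[OF char l] by blast
  let ?a = "tvar * \<theta> l"
  define A where "A = (\<Union>i<7. {\<beta>. r (W.coord ?a i) \<beta> \<noteq> 0})"
  have "?a = (\<Sum>i<7. scale_trunc7 (W.coord ?a i) (\<theta> (v i)))" by (simp only: W_exp)
  also have "\<dots> = (\<Sum>i<7. \<Sum>\<beta>\<in>A. scale_trunc7 \<beta> (scale_trunc7 (j (r (W.coord ?a i) \<beta>)) (\<theta> (v i))))"
  proof (rule sum.cong)
    fix i :: nat assume i: "i \<in> {..<7}"
    have "W.coord ?a i = (\<Sum>\<beta>\<in>A. j (r (W.coord ?a i) \<beta>) * \<beta>)"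
      by (rule r_sum[symmetric]) (use i in \<open>auto simp: A_def r_finite\<close>)
    then have "scale_trunc7 (W.coord ?a i) (\<theta> (v i)) = scale_trunc7 (\<Sum>\<beta>\<in>A. j (r (W.coord ?a i) \<beta>) * \<beta>) (\<theta> (v i))"
      by (rule arg_cong)
    then show "scale_trunc7 (W.coord ?a i) (\<theta> (v i))
        = (\<Sum>\<beta>\<in>A. scale_trunc7 \<beta> (scale_trunc7 (j (r (W.coord ?a i) \<beta>)) (\<theta> (v i))))"
      by (simp add: trunc7.scale_sum_left mult.commute)
  qed simp
  also have "\<dots> = (\<Sum>\<beta>\<in>A. scale_trunc7 \<beta> (\<theta> (T \<beta> l)))"
    by (subst sum.swap) (simp add: T_def P_def \<theta>_comb trunc7.scale_sum_right)
  also have "\<dots> = (\<Sum>\<beta>\<in>A. scale_trunc7 \<beta> (f \<beta>)) * \<theta> l"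
    by (simp add: T_f sum_distrib_right scale_trunc7_mult)
  finally have "tvar * (\<theta> l * h) = (\<Sum>\<beta>\<in>A. scale_trunc7 \<beta> (f \<beta>)) * (\<theta> l * h)"
    by (simp flip: mult.assoc)
  then have "tvar = (\<Sum>\<beta>\<in>A. scale_trunc7 \<beta> (f \<beta>))" by (simp add: h)
  from arg_cong[OF this, of "\<lambda>f. tcoeff f 1"] have "tcoeff tvar 1 = (\<Sum>\<beta>\<in>A. \<beta> * tcoeff (f \<beta>) 1)"
    by (simp only: tcoeff_sum tcoeff_scale)
  moreover have "tcoeff (tvar :: 'k trunc7) 1 = 1"
    using tcoeff_var_power[of 1 1, where 'a = 'k] by simp
  ultimately obtain \<beta> where "tcoeff (f \<beta>) 1 \<noteq> 0"
    by (metis (no_types, lifting) mult_zero_right sum.neutral zero_neq_one)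
  then show ?thesis using T_lin T_f by blast
qed

end

text \<open>
  The derivation \<open>D = h d/dX\<close> has \<open>D x = 1\<close>; applied to a linear relation between powers of \<open>x\<close> it gives one of
  smaller degree.
\<close>

lemma trunc7_powers_frame:
  fixes x h :: "'k::field trunc7"
  assumes char: "(7 :: 'k) = 0" and h: "tderiv x * h = 1"
  shows "frame scale_trunc7 UNIV 7 (\<lambda>i. x ^ i)"
proof (rule frame_exchange[OF trunc7_frame])
  have pow: "h * tderiv (x ^ Suc n) = scale_trunc7 (of_nat (Suc n)) (x ^ n)" for n
  proof (induction n)
    case (Suc n)
    have "h * tderiv (x ^ Suc (Suc n)) = h * tderiv x * x ^ Suc n + x * (h * tderiv (x ^ Suc n))"
      by (subst power_Suc) (simp only: tderiv_mult[OF char] algebra_simps)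
    also have "\<dots> = x ^ Suc n + scale_trunc7 (of_nat (Suc n)) (x ^ Suc n)"
      unfolding Suc using h by (simp add: mult.commute[of h] scale_trunc7_mult)
    also have "\<dots> = scale_trunc7 (of_nat (Suc (Suc n))) (x ^ Suc n)"
      by (simp only: of_nat_Suc[of "Suc n"] trunc7.scale_left_distrib trunc7.scale_one)
    finally show ?case .
  qed (use h in \<open>simp add: mult.commute\<close>)
  have nz: "(of_nat (Suc i) :: 'k) \<noteq> 0" if "i < 6" for i
    using inj_onD[OF of_nat_inj_char7[OF char], of "Suc i" 0] that by (auto simp del: of_nat_Suc)
  have "n \<le> 7 \<Longrightarrow> (\<Sum>i<n. scale_trunc7 (c i) (x ^ i)) = 0 \<Longrightarrow> \<forall>i<n. c i = 0" for n and c :: "nat \<Rightarrow> 'k"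
  proof (induction n arbitrary: c)
    case (Suc n)
    let ?D = "\<lambda>g. h * tderiv g"
    have D: "?D (f - g) = ?D f - ?D g" for f g
      using tderiv_add[of "f - g" g] by (simp add: algebra_simps)
    have "0 = ?D (\<Sum>i<Suc n. scale_trunc7 (c i) (x ^ i))" using Suc.prems(2) by (simp add: tderiv_zero)
    also have "\<dots> = (\<Sum>i<Suc n. scale_trunc7 (c i) (?D (x ^ i)))"
      unfolding additive_sum(3)[of ?D, OF D] by (simp add: tderiv_scale scale_trunc7_mult)
    also have "\<dots> = (\<Sum>i<n. scale_trunc7 (c (Suc i)) (?D (x ^ Suc i)))"
      by (subst sum.lessThan_Suc_shift) (simp add: tderiv_one)
    also have "\<dots> = (\<Sum>i<n. scale_trunc7 (c (Suc i) * of_nat (Suc i)) (x ^ i))"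
      by (simp only: pow trunc7.scale_scale)
    finally have "\<forall>i<n. c (Suc i) * of_nat (Suc i) = 0"
      using Suc.IH[of "\<lambda>i. c (Suc i) * of_nat (Suc i)"] Suc.prems(1) by simp
    then have c: "c (Suc i) = 0" if "i < n" for i using nz[of i] that Suc.prems(1) by auto
    have "scale_trunc7 (c 0) 1 = 0"
      using Suc.prems(2) c by (simp add: sum.lessThan_Suc_shift del: sum.lessThan_Suc)
    then have "c 0 = 0" by simp
    with c show ?case by (auto simp: less_Suc_eq_0_disj)
  qed simp
  from this[of 7] show "indep_family scale_trunc7 7 (\<lambda>i. x ^ i)"
    unfolding indep_family_def by blast
qed simp

text \<open>
  Writing vector fields as multiples of the derivation \<open>D\<close> with \<open>D x = 1\<close> replaces \<open>\<theta>\<close> by \<open>\<phi>\<close>, the value of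
  the vector field on \<open>x\<close>. The operator \<open>T\<close> acts as multiplication by \<open>x\<close>, so that any \<open>b\<close> with invertible
  \<open>w = \<phi> b\<close> generates the form: its elements correspond to \<open>w\<close> times polynomials in \<open>x\<close> over \<open>F\<close>. Hence
  
  \<^item> \<open>x^7\<close> is a constant in \<open>F\<close>, because it multiplies \<open>w\<close> into the form;
  
  \<^item> \<open>[b, T b]\<close> corresponds to \<open>w^2\<close>, so that \<open>w\<close> itself is a polynomial in \<open>x\<close> over \<open>F\<close>;
  
  \<^item> then \<open>w^7\<close>, a constant \<open>\<gamma>\<close>, corresponds to an element \<open>l\<close> of the form, and \<open>[l, T l]\<close> shows that
  \<open>\<gamma>\<close> is in \<open>F\<close>.
  
  After division by \<open>\<gamma>\<close> there is an element corresponding to 1, and \<open>T\<close> generates the basis from it.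
\<close>

lemma witt_frame_exists:
  assumes "witt_form scale bracket j \<theta> v"
  shows "\<exists>\<alpha> e. witt_frame scale bracket \<alpha> e"
proof -
  interpret witt_form scale bracket j \<theta> v by fact
  obtain T x where \<theta>_T: "\<And>l. \<theta> (T l) = x * \<theta> l"
    and x1: "tcoeff x 1 \<noteq> 0"
    using multiplier_exists by blast
  have dx0: "tcoeff (tderiv x) 0 \<noteq> 0" using x1 by (simp add: tcoeff_tderiv)
  obtain h where h: "tderiv x * h = 1" using trunc7_unit[OF char dx0] by blast
  interpret X: frame scale_trunc7 UNIV 7 "\<lambda>i. x ^ i" by (rule trunc7_powers_frame[OF char h])
  define \<phi> where "\<phi> = (\<lambda>l. \<theta> l * tderiv x)"
  define D where "D = (\<lambda>f. h * tderiv f)"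
  have \<phi>_comb: "\<phi> (\<Sum>i\<in>A. scale (c i) (w i)) = (\<Sum>i\<in>A. scale_trunc7 (j (c i)) (\<phi> (w i)))" for A c and w :: "nat \<Rightarrow> 'b"
    by (simp add: \<phi>_def \<theta>_comb sum_distrib_right scale_trunc7_mult)
  have \<phi>_scale: "\<phi> (scale c l) = scale_trunc7 (j c) (\<phi> l)" for c l
    by (simp add: \<phi>_def \<theta>_scale scale_trunc7_mult)
  have \<phi>_inj: "l = m" if "\<phi> l = \<phi> m" for l m
  proof (rule \<theta>_inj)
    have "\<theta> l * (tderiv x * h) = \<theta> m * (tderiv x * h)" using that by (simp add: \<phi>_def flip: mult.assoc)
    then show "\<theta> l = \<theta> m" by (simp add: h)
  qed
  have D_mult: "D (f * g) = D f * g + f * D g" for f g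
    by (simp add: D_def tderiv_mult[OF char] algebra_simps)
  have D_x: "D x = 1" using h by (simp add: D_def mult.commute)
  have \<phi>_bracket: "\<phi> (bracket l m) = \<phi> l * D (\<phi> m) - \<phi> m * D (\<phi> l)" for l m
  proof -
    have "\<phi> (bracket l m) = (tderiv x * h) * (\<theta> l * tderiv (\<theta> m) * tderiv x - \<theta> m * tderiv (\<theta> l) * tderiv x)"
      unfolding h by (simp add: \<phi>_def \<theta>_bracket vf_bracket_def algebra_simps)
    also have "\<dots> = \<phi> l * D (\<phi> m) - \<phi> m * D (\<phi> l)"
      by (simp add: \<phi>_def D_def tderiv_mult[OF char] algebra_simps)
    finally show ?thesis .
  qed
  have \<phi>_T: "\<phi> ((T ^^ i) l) = x ^ i * \<phi> l" for i l
    by (induction i) (simp_all add: \<phi>_def \<theta>_T mult.assoc)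
  have \<phi>_bracket_T: "\<phi> (bracket l (T l)) = \<phi> l * \<phi> l" for l
    using \<phi>_T[of 1 l] by (simp add: \<phi>_bracket D_mult D_x algebra_simps)
  have T_frame: "frame scale UNIV 7 (\<lambda>i. (T ^^ i) l)" if u: "\<phi> l * u = 1" for l u
  proof (rule frame_if_\<theta>_indep)
    show "indep_family scale_trunc7 7 (\<lambda>i. \<theta> ((T ^^ i) l))"
      unfolding indep_family_def
    proof (intro allI impI)
      fix c and i :: nat
      assume c: "(\<Sum>i<7. scale_trunc7 (c i) (\<theta> ((T ^^ i) l))) = 0" and i: "i < 7"
      have "(\<Sum>i<7. scale_trunc7 (c i) (\<theta> ((T ^^ i) l))) * (tderiv x * u) = (\<Sum>i<7. scale_trunc7 (c i) (\<phi> ((T ^^ i) l) * u))"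
        by (simp add: sum_distrib_right scale_trunc7_mult \<phi>_def mult.assoc)
      also have "\<dots> = (\<Sum>i<7. scale_trunc7 (c i) (x ^ i))"
        by (simp add: \<phi>_T mult.assoc u)
      finally have "(\<Sum>i<7. scale_trunc7 (c i) (x ^ i)) = 0" unfolding c by simp
      from indep_familyD[OF X.frame_indep this i] show "c i = 0" .
    qed
  qed
  have quotient: "\<exists>c. f = (\<Sum>i<7. scale_trunc7 (j (c i)) (x ^ i))" if u: "\<phi> l * u = 1" and m: "\<phi> m = f * \<phi> l" for l m u f
  proof -
    interpret F: frame scale UNIV 7 "\<lambda>i. (T ^^ i) l" by (rule T_frame[OF u])
    have "f * \<phi> l = \<phi> (\<Sum>i<7. scale (F.coord m i) ((T ^^ i) l))" by (simp add: F.sum_coord m)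
    also have "\<dots> = (\<Sum>i<7. scale_trunc7 (j (F.coord m i)) (x ^ i)) * \<phi> l"
      by (simp add: \<phi>_comb \<phi>_T sum_distrib_right scale_trunc7_mult)
    finally have "f * (\<phi> l * u) = (\<Sum>i<7. scale_trunc7 (j (F.coord m i)) (x ^ i)) * (\<phi> l * u)"
      by (simp flip: mult.assoc)
    then show ?thesis unfolding u by auto
  qed
  have scalar: "\<exists>c. \<gamma> = j c" if u: "\<phi> l * u = 1" and m: "\<phi> m = scale_trunc7 \<gamma> 1 * \<phi> l" for l m u \<gamma>
  proof -
    obtain c where c: "scale_trunc7 \<gamma> 1 = (\<Sum>i<7. scale_trunc7 (j (c i)) (x ^ i))"
      using quotient[OF u m] by blast
    have "(\<Sum>i<7. scale_trunc7 (if i = 0 then \<gamma> else 0) (x ^ i)) = (\<Sum>i<(7::nat). if i = 0 then scale_trunc7 \<gamma> 1 else 0)"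
      by (rule sum.cong) auto
    then have "(\<Sum>i<7. scale_trunc7 (if i = 0 then \<gamma> else 0) (x ^ i)) = (\<Sum>i<7. scale_trunc7 (j (c i)) (x ^ i))"
      by (simp flip: c)
    from X.coeff_eqI[OF this, of 0] show ?thesis by auto
  qed
  obtain b where b: "tcoeff (\<theta> b) 0 \<noteq> 0" using unit_exists by blast
  define w where "w = \<phi> b"
  have w0: "tcoeff w 0 \<noteq> 0" using b dx0 by (simp add: w_def \<phi>_def tcoeff_mult_0)
  obtain u where u: "\<phi> b * u = 1" using trunc7_unit[OF char w0] by (auto simp: w_def)
  obtain \<alpha> where \<alpha>: "tcoeff x 0 ^ 7 = j \<alpha>"
    using scalar[OF u, of "(T ^^ 7) b" "tcoeff x 0 ^ 7"] by (auto simp: \<phi>_T trunc7_power_7[OF char])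
  have x7: "x ^ 7 = scale_trunc7 (j \<alpha>) 1" by (simp add: trunc7_power_7[OF char] \<alpha>)
  obtain c where c: "w = (\<Sum>i<7. scale_trunc7 (j (c i)) (x ^ i))"
    using quotient[OF u, of "bracket b (T b)" w] by (auto simp: \<phi>_bracket_T w_def)
  define G where "G = (\<lambda>m. \<Sum>i<7. scale (c i) ((T ^^ i) m))"
  have "\<phi> (G m) = w * \<phi> m" for m
    by (simp add: G_def \<phi>_comb \<phi>_T c sum_distrib_right scale_trunc7_mult)
  then have \<phi>_G: "\<phi> ((G ^^ n) b) = w ^ Suc n" for n
    by (induction n) (simp_all add: w_def)
  define \<gamma> where "\<gamma> = tcoeff w 0 ^ 7"
  have \<gamma>0: "\<gamma> \<noteq> 0" using w0 by (simp add: \<gamma>_def)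
  define l where "l = (G ^^ 6) b"
  have l: "\<phi> l = scale_trunc7 \<gamma> 1"
    using \<phi>_G[of 6] trunc7_power_7[OF char, of w] by (simp add: l_def \<gamma>_def)
  have lu: "\<phi> l * scale_trunc7 (1 / \<gamma>) 1 = 1" using \<gamma>0 by (simp add: l scale_trunc7_mult)
  obtain c0 where c0: "\<gamma> = j c0"
    using scalar[OF lu, of "bracket l (T l)" \<gamma>] by (auto simp: \<phi>_bracket_T l)
  then have "c0 \<noteq> 0" using \<gamma>0 by (auto simp: j_0)
  define e where "e = (\<lambda>k. (T ^^ k) (scale (1 / c0) l))"
  have e0: "\<phi> (scale (1 / c0) l) = 1"
    using \<open>c0 \<noteq> 0\<close> j_hom(2)[of "1 / c0" c0] by (simp add: \<phi>_scale l c0 j_hom(3))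
  then have \<phi>_e: "\<phi> (e k) = x ^ k" for k by (simp add: e_def \<phi>_T)
  have D_pow: "D (x ^ n) = scale_trunc7 (of_nat n) (x ^ (n - 1))" for n
  proof (induction n)
    case (Suc n)
    have "D (x ^ Suc n) = x ^ n + scale_trunc7 (of_nat n) (x * x ^ (n - 1))"
      by (simp add: D_mult D_x Suc scale_trunc7_mult)
    also have "scale_trunc7 (of_nat n) (x * x ^ (n - 1)) = scale_trunc7 (of_nat n) (x ^ n)"
      by (cases n) simp_all
    finally show ?case by (simp add: trunc7.scale_left_distrib)
  qed (simp add: D_def tderiv_one)
  have "witt_frame scale bracket \<alpha> e"
    unfolding witt_frame_def
  proof (intro conjI allI impI)
    show "nonassoc_algebra scale bracket" by (rule nonassoc_algebra_axioms)
    show "frame scale UNIV 7 e" unfolding e_def by (rule T_frame[of _ 1]) (simp add: e0)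
    fix m k :: nat assume mk: "m < 7" "k < 7"
    let ?n = "m + k - 1"
    have "x ^ m * scale_trunc7 (of_nat k) (x ^ (k - 1)) = scale_trunc7 (of_nat k) (x ^ ?n)"
      by (cases k) (simp_all add: scale_trunc7_mult power_add)
    moreover have "x ^ k * scale_trunc7 (of_nat m) (x ^ (m - 1)) = scale_trunc7 (of_nat m) (x ^ ?n)"
      by (cases m) (simp_all add: scale_trunc7_mult power_add mult.commute)
    ultimately have "\<phi> (bracket (e m) (e k)) = scale_trunc7 (of_nat k - of_nat m) (x ^ ?n)"
      by (simp add: \<phi>_bracket \<phi>_e D_pow trunc7.scale_left_diff_distrib)
    also have "x ^ ?n = scale_trunc7 (j (wrap \<alpha> ?n)) (x ^ (?n mod 7))"
    proof (cases "?n < 7")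
      case False
      then have "?n div 7 = 1" using mk by auto
      then have "?n = 7 + ?n mod 7" using mult_div_mod_eq[of 7 ?n] by simp
      then have "x ^ ?n = x ^ 7 * x ^ (?n mod 7)" using power_add[of x 7 "?n mod 7"] by simp
      then show ?thesis using False by (simp add: x7 scale_trunc7_mult wrap_def)
    qed (simp add: wrap_def j_hom)
    also have "scale_trunc7 (of_nat k - of_nat m) (scale_trunc7 (j (wrap \<alpha> ?n)) (x ^ (?n mod 7)))
        = \<phi> (scale ((of_nat k - of_nat m) * wrap \<alpha> ?n) (e (?n mod 7)))"
      by (simp add: \<phi>_scale \<phi>_e j_hom j_diff j_of_nat)
    finally show "bracket (e m) (e k) = scale ((of_nat k - of_nat m) * wrap \<alpha> ?n) (e (?n mod 7))"
      by (rule \<phi>_inj)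
  qed
  then show ?thesis by blast
qed

section \<open>Embeddings of twisted forms into the derivations of the split Cayley algebra\<close>

theorem theorem7:
  fixes scaleC :: "'f::field \<Rightarrow> 'c::ab_group_add \<Rightarrow> 'c"
    and multC :: "'c \<Rightarrow> 'c \<Rightarrow> 'c" and normC :: "'c \<Rightarrow> 'f"
    and scaleL :: "'f \<Rightarrow> 'l::ab_group_add \<Rightarrow> 'l" and bracketL :: "'l \<Rightarrow> 'l \<Rightarrow> 'l"
  assumes "CHAR('f) = 7"
    and "split_cayley_algebra scaleC multC normC"
    and "twisted_form scaleL bracketL
           (witt_scale :: 'f \<Rightarrow> 'f witt \<Rightarrow> 'f witt) (witt_bracket :: 'f witt \<Rightarrow> 'f witt \<Rightarrow> 'f witt)"
  shows "(\<exists>\<iota>. lie_embedding_in_Der scaleL bracketL scaleC multC \<iota>) \<and>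
    (\<forall>\<iota>\<^sub>1 \<iota>\<^sub>2. lie_embedding_in_Der scaleL bracketL scaleC multC \<iota>\<^sub>1 \<longrightarrow>
             lie_embedding_in_Der scaleL bracketL scaleC multC \<iota>\<^sub>2 \<longrightarrow>
       (\<exists>\<phi>. algebra_automorphism scaleC multC \<phi> \<and>
            (\<forall>x. \<iota>\<^sub>2 x = \<phi> \<circ> \<iota>\<^sub>1 x \<circ> inv_into UNIV \<phi>)))"
proof -
  interpret split_cayley_algebra scaleC multC normC by fact
  have char: "(7 :: 'f) = 0" using of_nat_CHAR[where 'a = 'f] assms(1) by simp
  obtain y where y: "half_density_basis y"
    using idempotent_exists half_density_basis_exists[OF char] by metis
  obtain \<theta> :: "'l \<Rightarrow> 'f alg_closure trunc7" and v where \<theta>: "\<forall>x y. \<theta> (x + y) = \<theta> x + \<theta> y"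
    "\<forall>c x. \<theta> (scaleL c x) = scale_trunc7 (to_ac c) (\<theta> x)" "\<forall>x y. \<theta> (bracketL x y) = vf_bracket (\<theta> x) (\<theta> y)"
    "frame scaleL UNIV 7 v" "frame scale_trunc7 UNIV 7 (\<lambda>i. \<theta> (v i))"
    using twisted_form_frame[OF char assms(3)] by blast
  have "(7 :: 'f alg_closure) = to_ac 7" by simp
  then have charK: "(7 :: 'f alg_closure) = 0" by (simp add: char)
  interpret L: nonassoc_algebra scaleL bracketL using assms(3) by (simp add: twisted_form_def)
  have "witt_form scaleL bracketL to_ac \<theta> v"
    by (intro witt_form.intro witt_form_axioms.intro L.nonassoc_algebra_axioms) (use \<theta> charK in simp_all)
  then obtain \<alpha> e where e: "witt_frame scaleL bracketL \<alpha> e" using witt_frame_exists by blast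
  from lie_embedding_exists[OF char y e] lie_embeddings_conjugate[OF char y e] show ?thesis by blast
qed

end
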